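(* The sequence $\Theta_N(u)$ converges in measure, as $N\to\infty$, with respect to the measure $\mu$. Denote by $\Theta(u)$ the limit and define the probability measure $$d\rho(u)\equiv\Theta(u)\,d\mu(u).$$ Then for every $p\in[1,\infty)$, $\Theta(u)\in L^p(d\mu(u))$ and the sequence $\Theta_N$ converges to $\Theta$ in $L^p(d\mu(u))$ as $N$ tends to infinity.
   Context: $\mathbb{S}^1=\mathbb{R}/2\pi\mathbb{Z}$; $L^p$ norms on $\mathbb{S}^1$ are taken with respect to the normalized measure $\frac{dx}{2\pi}$. $X^0(\mathbb{S}^1)=\bigcap_{\sigma>0}H^{-\sigma}(\mathbb{S}^1)$. $\Pi_N$ is the projector on Fourier modes $|n|\le N$ and $u_N=\Pi_Nu$. The measure $\mu$ is the law on $X^0(\mathbb{S}^1)$ of $\varphi(\omega,x)=\sum_{n\in\mathbb{Z}}\frac{g_n(\omega)}{(1+|n|)^{1/2}}e^{inx}$, where $(g_n)_{n\in\mathbb{Z}}$ are independent normalized complex Gaussians ($g_n=\frac1{\sqrt2}(h_n+i\ell_n)$ with $h_n,\ell_n$ independent real standard Gaussians). Let $\chi\in\mathcal{C}_0^\infty(\mathbb{R})$ with $0\le\chi\le1$, $\chi\not\equiv0$, let $\alpha_N=\int\|u_N\|^2_{L^2}d\mu(u)=\sum_{|n|\le N}\frac1{1+|n|}$, and set $$\Theta_N(u)=\beta_N\,\chi\big(\|u_N\|^2_{L^2}-\alpha_N\big)\,e^{-\left(\|u_N\|^4_{L^4}-2\|u_N\|^4_{L^2}\right)},$$ where $\beta_N>0$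 is chosen so that $\Theta_N\,d\mu$ is a probability measure. *)

theory Defs
  imports "HOL-Probability.Probability"
begin

section \<open>$L^p$ spaces and convergence in measure\<close>

definition Lp_fun :: "'a measure \<Rightarrow> real \<Rightarrow> ('a \<Rightarrow> 'b::{banach,second_countable_topology}) \<Rightarrow> bool" where
  "Lp_fun M p f \<longleftrightarrow> f \<in> borel_measurable M \<and> integrable M (\<lambda>x. norm (f x) powr p)"

definition Lp_norm :: "'a measure \<Rightarrow> real \<Rightarrow> ('a \<Rightarrow> 'b::{banach,second_countable_topology}) \<Rightarrow> real" where
  "Lp_norm M p f = (LINT x|M. norm (f x) powr p) powr (1 / p)"

text \<open>Membership in $L^p$ is required of all functions involved, since the Bochner integral of a
  non-integrable function is \<open>0\<close>.\<close>

definition converges_in_Lp ::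
  "'a measure \<Rightarrow> real \<Rightarrow> (nat \<Rightarrow> 'a \<Rightarrow> 'b::{banach,second_countable_topology}) \<Rightarrow> ('a \<Rightarrow> 'b) \<Rightarrow> bool" where
  "converges_in_Lp M p F f \<longleftrightarrow>
     (\<forall>n. Lp_fun M p (F n)) \<and> Lp_fun M p f \<and> (\<lambda>n. Lp_norm M p (\<lambda>x. F n x - f x)) \<longlonglongrightarrow> 0"

definition converges_in_measure ::
  "'a measure \<Rightarrow> (nat \<Rightarrow> 'a \<Rightarrow> 'b::{banach,second_countable_topology}) \<Rightarrow> ('a \<Rightarrow> 'b) \<Rightarrow> bool" where
  "converges_in_measure M F f \<longleftrightarrow>
     (\<forall>n. F n \<in> borel_measurable M) \<and> f \<in> borel_measurable M \<and>
     (\<forall>\<epsilon>>0. (\<lambda>n. measure M {x \<in> space M. norm (F n x - f x) \<ge> \<epsilon>}) \<longlonglongrightarrow> 0)"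

section \<open>Sobolev spaces on the circle and the space $X^0$\<close>

text \<open>A distribution \<open>u\<close> on the circle is represented by the sequence of its Fourier
  coefficients, \<open>u n\<close> being the coefficient of $e^{inx}$.\<close>

definition in_sobolev :: "real \<Rightarrow> (int \<Rightarrow> complex) \<Rightarrow> bool" where
  "in_sobolev s u \<longleftrightarrow> (\<lambda>n. (1 + (real_of_int n)\<^sup>2) powr s * (cmod (u n))\<^sup>2) summable_on UNIV"

definition sobolev_norm :: "real \<Rightarrow> (int \<Rightarrow> complex) \<Rightarrow> real" where
  "sobolev_norm s u = sqrt (\<Sum>\<^sub>\<infinity>n. (1 + (real_of_int n)\<^sup>2) powr s * (cmod (u n))\<^sup>2)"

definition X0 :: "(int \<Rightarrow> complex) set" where
  "X0 = {u. \<forall>\<sigma>>0. in_sobolev (- \<sigma>) u}"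

text \<open>The natural topology of the intersection, i.e. the coarsest one that makes all the
  inclusions of $X^0$ into $H^{-\sigma}$ continuous, and its Borel $\sigma$-algebra.\<close>

definition X0_topology :: "(int \<Rightarrow> complex) topology" where
  "X0_topology = topology_generated_by
     {{v \<in> X0. sobolev_norm (- \<sigma>) (\<lambda>n. v n - u n) < \<epsilon>} | u \<sigma> \<epsilon>. u \<in> X0 \<and> \<sigma> > 0 \<and> \<epsilon> > 0}"

definition X0_borel :: "(int \<Rightarrow> complex) measure" where
  "X0_borel = sigma X0 {U. openin X0_topology U}"

section \<open>The Gaussian measure\<close>

text \<open>Fourier coefficients of the random series, with $g_n = (h_n + i \ell_n)/\sqrt 2$.\<close>

definition random_series :: "(int \<Rightarrow> 'w \<Rightarrow> real) \<Rightarrow> (int \<Rightarrow> 'w \<Rightarrow> real) \<Rightarrow> 'w \<Rightarrow> int \<Rightarrow> complex" where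
  "random_series h l \<omega> n =
     (Complex (h n \<omega>) (l n \<omega>) / complex_of_real (sqrt 2)) / complex_of_real (sqrt (1 + \<bar>real_of_int n\<bar>))"

text \<open>The series belongs to \<open>X0\<close> only almost surely; on the exceptional null event it is replaced
  by \<open>0\<close>, which does not affect the law.\<close>

definition gaussian_law ::
  "'w measure \<Rightarrow> (int \<Rightarrow> 'w \<Rightarrow> real) \<Rightarrow> (int \<Rightarrow> 'w \<Rightarrow> real) \<Rightarrow> (int \<Rightarrow> complex) measure" where
  "gaussian_law M h l =
     distr M X0_borel (\<lambda>\<omega>. if random_series h l \<omega> \<in> X0 then random_series h l \<omega> else (\<lambda>_. 0))"

section \<open>The truncated densities\<close>

text \<open>Functions on the circle are $2\pi$-periodic functions on the line, and the following is the
  measure $dx/2\pi$ on a period.\<close>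

definition circle_measure :: "real measure" where
  "circle_measure = uniform_measure lborel {0..<2 * pi}"

definition fourier_proj :: "nat \<Rightarrow> (int \<Rightarrow> complex) \<Rightarrow> real \<Rightarrow> complex" where
  "fourier_proj N u x = (\<Sum>n | \<bar>n\<bar> \<le> int N. u n * exp (\<i> * of_int n * of_real x))"

definition alpha :: "(int \<Rightarrow> complex) measure \<Rightarrow> nat \<Rightarrow> real" where
  "alpha \<mu> N = (LINT u|\<mu>. (Lp_norm circle_measure 2 (fourier_proj N u))\<^sup>2)"

definition Theta_N ::
  "(int \<Rightarrow> complex) measure \<Rightarrow> (real \<Rightarrow> real) \<Rightarrow> (nat \<Rightarrow> real) \<Rightarrow> nat \<Rightarrow> (int \<Rightarrow> complex) \<Rightarrow> real" where
  "Theta_N \<mu> cutoff \<beta> N u =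
     \<beta> N * cutoff ((Lp_norm circle_measure 2 (fourier_proj N u))\<^sup>2 - alpha \<mu> N)
       * exp (- (Lp_norm circle_measure 4 (fourier_proj N u) ^ 4
                 - 2 * Lp_norm circle_measure 2 (fourier_proj N u) ^ 4))"

definition smooth_compact_support :: "(real \<Rightarrow> real) \<Rightarrow> bool" where
  "smooth_compact_support cutoff \<longleftrightarrow>
     (\<forall>k. (deriv ^^ k) cutoff differentiable_on UNIV) \<and> compact (closure {x. cutoff x \<noteq> 0})"

text \<open>\<open>\<beta> N\<close> normalises \<open>Theta_N\<close> to a probability density. For finitely many small \<open>N\<close> this can be
  impossible: $\|u_N\|_{L^2}^2 - \alpha_N \ge -\alpha_N$, so \<open>cutoff\<close> may vanish identically on the
  range of its argument. Hence the normalisation is required for all large \<open>N\<close> only.\<close>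

definition normalising :: "(int \<Rightarrow> complex) measure \<Rightarrow> (real \<Rightarrow> real) \<Rightarrow> (nat \<Rightarrow> real) \<Rightarrow> bool" where
  "normalising \<mu> cutoff \<beta> \<longleftrightarrow>
     (\<forall>\<^sub>F N in sequentially. \<beta> N > 0 \<and> prob_space (density \<mu> (\<lambda>u. ennreal (Theta_N \<mu> cutoff \<beta> N u))))"

end

theory Submission
  imports Defs
begin

text \<open>Write $u_n = g_n / (1 + |n|)^{1/2}$ with normalised complex Gaussians $g_n$, and let
\<open>wt n\<close> be $1 / (1 + |n|)$.

Expanding the norms of $u_N$ in Fourier coefficients (\<open>energy_eq_norms\<close>) shows that
$\|u_N\|_{L^4}^4 - 2 \|u_N\|_{L^2}^4 = S_N - D_N$. Here $S_N$ runs over the quadruples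
$n_1 + n_2 = n_3 + n_4$ in which no $n_1, n_2$ equals an $n_3, n_4$, and $D_N$ is the convergent
sum of $|u_n|^4$: subtracting $2 \|u_N\|_{L^2}^4$ removes precisely the divergent resonant terms.
The coefficients of $S_N$ are square summable, with a tail beyond $N$ of order at most $N^{-1/8}$
(\<open>sum_wt_quad_tail\<close>), so $S_N$, $D_N$ and $\|u_N\|_{L^2}^2 - \alpha_N$ converge in $L^1$, and
the weight $\chi(\|u_N\|_{L^2}^2 - \alpha_N) e^{-(S_N - D_N)}$ converges in measure.

Convergence in $L^p$ needs bounds on the moments of the weight that are uniform in $N$, and they
come from Nelson's argument (\<open>nelson\<close>). On the support of the cutoff,
$S_N - D_N \ge - \|u_N\|_{L^2}^4 \ge - C (\log N)^2$, which is not uniform. But an energy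
below $-C j^2$ cannot occur with the modes up to $2^j$ alone, so for $N > 2^j$ it forces one of three rare events: the
renormalised mass drops between $2^j$ and $N$ (\<open>wick_mass_drop\<close>), or one of $S_N - S_{2^j}$,
$D_N - D_{2^j}$ is large. A moment of order $k$ bounds the probability of the latter by
$(4k)^{4k} (C 2^{-j/8})^k$, and with $k$ a large multiple of $j$ this beats $e^{C j^2}$.

The moments of $S_N$ of every order are bounded directly (\<open>quad_chaos_moment\<close>).
All coefficients are nonnegative, so Wick's formula bounds the moment by a sum over pairings, and
each pairing is estimated by applying Cauchy--Schwarz along its edges
(\<open>sum_prod_le_Cauchy_Schwarz\<close>).

Finally $\beta_N$ stays bounded because the integral of the weight stays away from zero
(\<open>partition_function_ge\<close>): as $\sum 1 / (1 + |n|)$ diverges, the renormalised mass charges every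
interval, uniformly in all large $N$. Vitali's theorem then turns convergence in measure into
convergence in every $L^p$. All this takes place on an arbitrary probability space with Gaussian
coordinates, and applies to $X^0$ because the random series almost surely belongs to $X^0$ and because
the topology of $X^0$ has a countable base, which makes the law of the series a Borel measure.\<close>

section \<open>Moments of a complex Gaussian variable\<close>

definition std_normal :: "real measure" where
  "std_normal = density lborel (\<lambda>x. ennreal (std_normal_density x))"

definition std_cgauss :: "complex measure" where
  "std_cgauss = distr (std_normal \<Otimes>\<^sub>M std_normal) borel (\<lambda>(x, y). Complex x y / complex_of_real (sqrt 2))"

lemma sets_std_normal [simp, measurable_cong]: "sets std_normal = sets borel"
  by (simp add: std_normal_def)

lemma space_std_normal [simp]: "space std_normal = UNIV"
  by (simp add: std_normal_def)

lemma prob_space_std_normal: "prob_space std_normal"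
  unfolding std_normal_def by (rule prob_space_normal_density) simp

lemma std_normal_moments:
  "integrable std_normal (\<lambda>x. complex_of_real x ^ k)"
  "(LINT x|std_normal. complex_of_real x ^ Suc k) = of_nat k * (LINT x|std_normal. complex_of_real x ^ (k - 1))"
proof -
  have red: "integrable std_normal (\<lambda>x. complex_of_real x ^ k)"
    "(LINT x|std_normal. complex_of_real x ^ k) = complex_of_real (LINT x|lborel. std_normal_density x * x ^ k)" for k
  proof -
    have i: "integrable lborel (\<lambda>x. std_normal_density x * x ^ k)"
      by (rule integrable_std_normal_moment)
    have eq: "(\<lambda>x. std_normal_density x *\<^sub>R complex_of_real x ^ k) = (\<lambda>x. complex_of_real (std_normal_density x * x ^ k))"
      by (auto simp: scaleR_conv_of_real)
    show "integrable std_normal (\<lambda>x. complex_of_real x ^ k)"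
      unfolding std_normal_def
      by (subst integrable_density) (use i in \<open>auto simp: eq simp del: of_real_mult\<close>)
    show "(LINT x|std_normal. complex_of_real x ^ k) = complex_of_real (LINT x|lborel. std_normal_density x * x ^ k)"
      unfolding std_normal_def
      by (subst integral_density) (use i in \<open>auto simp: eq simp del: of_real_mult\<close>)
  qed
  show "integrable std_normal (\<lambda>x. complex_of_real x ^ k)" by (rule red)
  have "(LINT x|lborel. std_normal_density x * x ^ Suc k) = k * (LINT x|lborel. std_normal_density x * x ^ (k - 1))"
  proof (cases "even k")
    case True
    then obtain j where k: "k = 2 * j" by auto
    have "(LINT x|lborel. std_normal_density x * x ^ (k - 1)) = 0" if "j > 0"
    proof -
      obtain i where "k - 1 = 2 * i + 1" using k \<open>j > 0\<close> by (metis Suc_pred add.commute mult_Suc_right plus_1_eq_Suc Suc_1 diff_Suc_1 add_Suc)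
      then show ?thesis using integral_std_normal_moment_odd[of i] by simp
    qed
    then show ?thesis using integral_std_normal_moment_odd[of j] k by (cases "j = 0") auto
  next
    case False
    then obtain j where k: "k = 2 * j + 1" by (auto elim: oddE)
    then have "Suc k = 2 * Suc j" "k - 1 = 2 * j" by auto
    moreover have "fact (2 * Suc j) / (2 ^ Suc j * fact (Suc j)) = (real k) * (fact (2 * j) / (2 ^ j * fact j))"
    proof -
      have "fact (2 * Suc j) = 2 * (real j + 1) * (real k * fact (2 * j))"
        by (simp add: k algebra_simps)
      moreover have "2 ^ Suc j * fact (Suc j) = 2 * (real j + 1) * (2 ^ j * fact j)"
        by (simp add: algebra_simps)
      ultimately show ?thesis
        by (simp only: times_divide_eq_right) (rule mult_divide_mult_cancel_left, simp)
    qed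
    ultimately show ?thesis using integral_std_normal_moment_even by metis
  qed
  then show "(LINT x|std_normal. complex_of_real x ^ Suc k) = of_nat k * (LINT x|std_normal. complex_of_real x ^ (k - 1))"
    unfolding red by simp
qed

text \<open>Gaussian integration by parts, obtained from the recursion for the moments by linearity.\<close>

lemma std_normal_poly:
  fixes p :: "complex poly"
  shows "integrable std_normal (\<lambda>x. poly p (complex_of_real x))"
    and "(LINT x|std_normal. of_real x * poly p (of_real x)) = (LINT x|std_normal. poly (pderiv p) (of_real x))"
proof -
  have i: "integrable std_normal (\<lambda>x. poly p (complex_of_real x))" for p
    unfolding poly_altdef by (intro Bochner_Integration.integrable_sum integrable_mult_right std_normal_moments)
  then show "integrable std_normal (\<lambda>x. poly p (complex_of_real x))" .
  have e: "poly p (complex_of_real x) = (\<Sum>k\<le>degree p. coeff p k * of_real x ^ k)" for x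
    by (simp add: poly_altdef)
  have d: "poly (pderiv p) z = (\<Sum>k\<le>degree p. coeff p k * (of_nat k * z ^ (k - 1)))" for z
  proof -
    have pder: "pderiv (sum f A) = (\<Sum>k\<in>A. pderiv (f k))" for f :: "nat \<Rightarrow> complex poly" and A
      by (induction A rule: infinite_finite_induct) (simp_all add: pderiv_add)
    have "p = (\<Sum>k\<le>degree p. monom (coeff p k) k)" by (simp add: poly_as_sum_of_monoms)
    then have "pderiv p = pderiv (\<Sum>k\<le>degree p. monom (coeff p k) k)" by simp
    also have "\<dots> = (\<Sum>k\<le>degree p. monom (of_nat k * coeff p k) (k - 1))"
      by (simp add: pder pderiv_monom)
    finally have "poly (pderiv p) z = poly (\<Sum>k\<le>degree p. monom (of_nat k * coeff p k) (k - 1)) z" by simp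
    then show ?thesis by (simp add: poly_sum poly_monom algebra_simps)
  qed
  have "(LINT x|std_normal. of_real x * poly p (of_real x)) = (LINT x|std_normal. (\<Sum>k\<le>degree p. coeff p k * of_real x ^ Suc k))"
    by (simp add: e sum_distrib_left algebra_simps)
  also have "\<dots> = (\<Sum>k\<le>degree p. coeff p k * (LINT x|std_normal. of_real x ^ Suc k))"
    by (subst Bochner_Integration.integral_sum) (auto intro!: integrable_mult_right std_normal_moments simp del: power_Suc)
  also have "\<dots> = (\<Sum>k\<le>degree p. coeff p k * (LINT x|std_normal. of_nat k * of_real x ^ (k - 1)))"
    by (simp add: std_normal_moments del: power_Suc)
  also have "\<dots> = (LINT x|std_normal. poly (pderiv p) (of_real x))"
    unfolding d by (subst Bochner_Integration.integral_sum) (auto intro!: integrable_mult_right std_normal_moments simp del: power_Suc)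
  finally show "(LINT x|std_normal. of_real x * poly p (of_real x)) = (LINT x|std_normal. poly (pderiv p) (of_real x))" .
qed

definition plane_monomial :: "nat \<Rightarrow> nat \<Rightarrow> real \<Rightarrow> real \<Rightarrow> complex" where
  "plane_monomial a b x y = Complex x y ^ a * cnj (Complex x y) ^ b"

lemma Complex_measurable [measurable (raw)]:
  assumes "f \<in> borel_measurable M" "g \<in> borel_measurable M"
  shows "(\<lambda>x. Complex (f x) (g x)) \<in> borel_measurable M"
  unfolding Complex_eq using assms by measurable

lemma cnj_measurable [measurable]: "cnj \<in> borel_measurable borel"
  by (intro borel_measurable_continuous_onI continuous_intros)

lemma integrable_plane_monomial: "integrable (std_normal \<Otimes>\<^sub>M std_normal) (\<lambda>(x, y). plane_monomial a b x y)"
proof -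
  interpret N: prob_space std_normal by (rule prob_space_std_normal)
  interpret NN: pair_prob_space std_normal std_normal ..
  have abs: "integrable std_normal (\<lambda>x. \<bar>x\<bar> ^ k)" for k
    using integrable_norm[OF std_normal_moments(1)[of k]] by (simp add: norm_power)
  let ?k = "a + b"
  have 1: "integrable (std_normal \<Otimes>\<^sub>M std_normal) (\<lambda>(x, y). \<bar>x\<bar> ^ ?k)"
    by (intro NN.Fubini_integrable) (use abs in \<open>auto simp: N.prob_space[unfolded space_std_normal]\<close>)
  have 2: "integrable (std_normal \<Otimes>\<^sub>M std_normal) (\<lambda>(x, y). \<bar>y\<bar> ^ ?k)"
    by (intro NN.Fubini_integrable) (use abs in \<open>auto simp: N.prob_space[unfolded space_std_normal]\<close>)
  have "integrable (std_normal \<Otimes>\<^sub>M std_normal) (\<lambda>z. 2 ^ ?k * (\<bar>fst z\<bar> ^ ?k + \<bar>snd z\<bar> ^ ?k))"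
    using Bochner_Integration.integrable_add[OF 1 2] by (simp add: split_def)
  then show ?thesis
  proof (rule Bochner_Integration.integrable_bound)
    show "(\<lambda>(x, y). plane_monomial a b x y) \<in> borel_measurable (std_normal \<Otimes>\<^sub>M std_normal)"
      unfolding plane_monomial_def by measurable
    show "AE z in std_normal \<Otimes>\<^sub>M std_normal. norm (case z of (x, y) \<Rightarrow> plane_monomial a b x y) \<le> norm (2 ^ ?k * (\<bar>fst z\<bar> ^ ?k + \<bar>snd z\<bar> ^ ?k))"
    proof (intro AE_I2, clarify)
      fix x y :: real
      have "norm (plane_monomial a b x y) = cmod (Complex x y) ^ ?k"
        by (simp add: plane_monomial_def norm_mult norm_power power_add)
      also have "\<dots> \<le> (2 * max \<bar>x\<bar> \<bar>y\<bar>) ^ ?k"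
        using cmod_le[of "Complex x y"] by (intro power_mono) auto
      also have "\<dots> \<le> 2 ^ ?k * (\<bar>x\<bar> ^ ?k + \<bar>y\<bar> ^ ?k)"
        by (auto simp: power_mult_distrib max_def)
      finally show "norm (plane_monomial a b x y) \<le> norm (2 ^ ?k * (\<bar>fst (x, y)\<bar> ^ ?k + \<bar>snd (x, y)\<bar> ^ ?k))" by simp
    qed
  qed
qed

definition plane_moment :: "nat \<Rightarrow> nat \<Rightarrow> complex" where
  "plane_moment a b = (LINT z|(std_normal \<Otimes>\<^sub>M std_normal). (case z of (x, y) \<Rightarrow> plane_monomial a b x y))"

text \<open>With $z = x + i y$, integration by parts in both variables replaces the factor $z$ by the operator
$\partial_x + i \partial_y$. It annihilates $z$ and maps $\bar z$ to $2$, so it only lowers the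
power of $\bar z$.\<close>

lemma plane_moment_Suc: "plane_moment (Suc a) b = 2 * of_nat b * plane_moment a (b - 1)"
proof -
  interpret N: prob_space std_normal by (rule prob_space_std_normal)
  interpret NN: pair_prob_space std_normal std_normal ..
  let ?NN = "std_normal \<Otimes>\<^sub>M std_normal"
  have cm: "Complex x y = of_real x + \<i> * of_real y" "cnj (Complex x y) = of_real x - \<i> * of_real y" for x y
    by (simp_all add: complex_eq_iff)
  have X: "(LINT x|std_normal. of_real x * plane_monomial a b x y) = (LINT x|std_normal. of_nat a * plane_monomial (a - 1) b x y + of_nat b * plane_monomial a (b - 1) x y)" for y
  proof -
    define p where "p = [:\<i> * of_real y, 1:] ^ a * [:- (\<i> * complex_of_real y), 1:] ^ b"
    have "poly p (of_real x) = plane_monomial a b x y" for x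
      by (simp add: p_def plane_monomial_def cm algebra_simps)
    moreover have "poly (pderiv p) (of_real x) = of_nat a * plane_monomial (a - 1) b x y + of_nat b * plane_monomial a (b - 1) x y" for x
      by (simp add: p_def plane_monomial_def cm pderiv_mult pderiv_power pderiv_pCons algebra_simps)
    ultimately show ?thesis using std_normal_poly(2)[of p] by simp
  qed
  have Y: "(LINT y|std_normal. of_real y * plane_monomial a b x y) = (LINT y|std_normal. \<i> * of_nat a * plane_monomial (a - 1) b x y - \<i> * of_nat b * plane_monomial a (b - 1) x y)" for x
  proof -
    define p where "p = [:of_real x, \<i>:] ^ a * [:complex_of_real x, -\<i>:] ^ b"
    have "poly p (of_real y) = plane_monomial a b x y" for y
      by (simp add: p_def plane_monomial_def cm algebra_simps)
    moreover have "poly (pderiv p) (of_real y) = \<i> * of_nat a * plane_monomial (a - 1) b x y - \<i> * of_nat b * plane_monomial a (b - 1) x y" for y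
      by (simp add: p_def plane_monomial_def cm pderiv_mult pderiv_power pderiv_pCons algebra_simps)
    ultimately show ?thesis using std_normal_poly(2)[of p] by simp
  qed
  have ix: "integrable ?NN (\<lambda>(x, y). of_real x * plane_monomial a b x y)" and iy: "integrable ?NN (\<lambda>(x, y). of_real y * plane_monomial a b x y)"
  proof -
    have e: "of_real x * plane_monomial a b x y = (plane_monomial (Suc a) b x y + plane_monomial a (Suc b) x y) / 2"
      "of_real y * plane_monomial a b x y = (plane_monomial (Suc a) b x y - plane_monomial a (Suc b) x y) / (2 * \<i>)" for x y
      by (simp_all add: plane_monomial_def cm field_simps)
    show "integrable ?NN (\<lambda>(x, y). of_real x * plane_monomial a b x y)"
      using Bochner_Integration.integrable_add[OF integrable_plane_monomial[of "Suc a" b] integrable_plane_monomial[of a "Suc b"]]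
      unfolding e split_def by (rule integrable_divide)
    show "integrable ?NN (\<lambda>(x, y). of_real y * plane_monomial a b x y)"
      using Bochner_Integration.integrable_diff[OF integrable_plane_monomial[of "Suc a" b] integrable_plane_monomial[of a "Suc b"]]
      unfolding e split_def by (rule integrable_divide)
  qed
  have g: "integrable ?NN (\<lambda>z. c * (case z of (x, y) \<Rightarrow> plane_monomial i j x y))" for c i j
    by (intro integrable_mult_right integrable_plane_monomial)
  have EX: "(LINT (x,y)|?NN. of_real x * plane_monomial a b x y) = of_nat a * plane_moment (a - 1) b + of_nat b * plane_moment a (b - 1)"
  proof -
    have "(LINT (x,y)|?NN. of_real x * plane_monomial a b x y) = (LINT y|std_normal. (LINT x|std_normal. of_real x * plane_monomial a b x y))"
      by (rule NN.integral_snd[OF ix, symmetric])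
    also have "\<dots> = (LINT y|std_normal. (LINT x|std_normal. of_nat a * plane_monomial (a - 1) b x y + of_nat b * plane_monomial a (b - 1) x y))"
      unfolding X ..
    also have "\<dots> = (LINT (x,y)|?NN. of_nat a * plane_monomial (a - 1) b x y + of_nat b * plane_monomial a (b - 1) x y)"
      using Bochner_Integration.integrable_add[OF g[of "of_nat a" "a-1" b] g[of "of_nat b" a "b-1"]]
      by (intro NN.integral_snd) (simp add: split_def)
    also have "\<dots> = of_nat a * plane_moment (a - 1) b + of_nat b * plane_moment a (b - 1)"
      using Bochner_Integration.integral_add[OF g[of "of_nat a" "a-1" b] g[of "of_nat b" a "b-1"]]
      by (simp add: split_def plane_moment_def)
    finally show ?thesis .
  qed
  have EY: "(LINT (x,y)|?NN. of_real y * plane_monomial a b x y) = \<i> * of_nat a * plane_moment (a - 1) b - \<i> * of_nat b * plane_moment a (b - 1)"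
  proof -
    have "(LINT (x,y)|?NN. of_real y * plane_monomial a b x y) = (LINT x|std_normal. (LINT y|std_normal. of_real y * plane_monomial a b x y))"
      using NN.integral_fst'[OF iy] by simp
    also have "\<dots> = (LINT x|std_normal. (LINT y|std_normal. \<i> * of_nat a * plane_monomial (a - 1) b x y - \<i> * of_nat b * plane_monomial a (b - 1) x y))"
      unfolding Y ..
    also have "\<dots> = (LINT (x,y)|?NN. \<i> * of_nat a * plane_monomial (a - 1) b x y - \<i> * of_nat b * plane_monomial a (b - 1) x y)"
      using Bochner_Integration.integrable_diff[OF g[of "\<i> * of_nat a" "a-1" b] g[of "\<i> * of_nat b" a "b-1"]]
      by (subst NN.integral_fst'[symmetric]) (simp_all only: split_def fst_conv snd_conv)
    also have "\<dots> = \<i> * of_nat a * plane_moment (a - 1) b - \<i> * of_nat b * plane_moment a (b - 1)"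
      using Bochner_Integration.integral_diff[OF g[of "\<i> * of_nat a" "a-1" b] g[of "\<i> * of_nat b" a "b-1"]]
      by (simp add: split_def plane_moment_def)
    finally show ?thesis .
  qed
  have "plane_moment (Suc a) b = (LINT z|?NN. (case z of (x, y) \<Rightarrow> of_real x * plane_monomial a b x y) + \<i> * (case z of (x, y) \<Rightarrow> of_real y * plane_monomial a b x y))"
    unfolding plane_moment_def by (intro Bochner_Integration.integral_cong) (auto simp: plane_monomial_def cm algebra_simps)
  also have "\<dots> = (LINT (x,y)|?NN. of_real x * plane_monomial a b x y) + \<i> * (LINT (x,y)|?NN. of_real y * plane_monomial a b x y)"
    using ix iy by (subst Bochner_Integration.integral_add) auto
  also have "\<dots> = 2 * of_nat b * plane_moment a (b - 1)"
    unfolding EX EY by (simp add: algebra_simps)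
  finally show ?thesis .
qed

lemma plane_moment_eq: "plane_moment a b = (if a = b then 2 ^ a * fact a else 0)"
proof (induction a arbitrary: b)
  case (Suc a)
  show ?case by (cases b) (auto simp: plane_moment_Suc Suc.IH)
next
  case 0
  interpret N: prob_space std_normal by (rule prob_space_std_normal)
  interpret NN: pair_prob_space std_normal std_normal ..
  have "plane_moment 0 b = cnj (plane_moment b 0)"
    unfolding plane_moment_def
    by (rule trans[OF _ Bochner_Integration.integral_cnj], rule Bochner_Integration.integral_cong) (auto simp: plane_monomial_def)
  also have "\<dots> = (if 0 = b then 1 else 0)"
  proof (cases b)
    case 0
    then show ?thesis using NN.prob_space by (simp add: plane_moment_def plane_monomial_def split_def)
  qed (simp add: plane_moment_Suc)
  finally show ?case by simp
qed

lemma std_cgauss_moments: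
  "integrable std_cgauss (\<lambda>z. z ^ a * cnj z ^ b)"
  "(LINT z|std_cgauss. z ^ a * cnj z ^ b) = (if a = b then fact a else 0)"
proof -
  let ?NN = "std_normal \<Otimes>\<^sub>M std_normal"
  have m: "(\<lambda>(x, y). Complex x y / complex_of_real (sqrt 2)) \<in> borel_measurable ?NN"
    by measurable
  have e: "(case w of (x, y) \<Rightarrow> Complex x y / complex_of_real (sqrt 2)) ^ a * cnj (case w of (x, y) \<Rightarrow> Complex x y / complex_of_real (sqrt 2)) ^ b
     = (case w of (x, y) \<Rightarrow> plane_monomial a b x y) / complex_of_real (sqrt 2) ^ (a + b)" for w
    by (auto simp: plane_monomial_def power_divide power_add split: prod.split)
  show "integrable std_cgauss (\<lambda>z. z ^ a * cnj z ^ b)"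
    unfolding std_cgauss_def using integrable_plane_monomial[of a b] by (subst integrable_distr_eq[OF m]) (auto simp: e)
  have "(LINT z|std_cgauss. z ^ a * cnj z ^ b) = plane_moment a b / complex_of_real (sqrt 2) ^ (a + b)"
    unfolding std_cgauss_def by (subst integral_distr[OF m]) (auto simp: e plane_moment_def)
  also have "\<dots> = (if a = b then fact a else 0)"
  proof (cases "a = b")
    case True
    have "complex_of_real (sqrt 2) ^ (a + a) = (complex_of_real ((sqrt 2)\<^sup>2)) ^ a"
      by (metis mult_2 of_real_power power_mult)
    also have "\<dots> = 2 ^ a" by simp
    finally show ?thesis using True by (simp add: plane_moment_eq)
  qed (simp add: plane_moment_eq)
  finally show "(LINT z|std_cgauss. z ^ a * cnj z ^ b) = (if a = b then fact a else 0)" .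
qed


text \<open>The density is positive, so a null open set would be a Lebesgue null set.\<close>

lemma emeasure_std_normal_pos:
  assumes "open U" "U \<noteq> {}"
  shows "emeasure std_normal U > 0"
proof (rule ccontr)
  assume "\<not> ?thesis"
  then have "emeasure std_normal U = 0" by simp
  moreover have U: "U \<in> sets borel" using assms by auto
  ultimately have "(\<integral>\<^sup>+x. ennreal (std_normal_density x) * indicator U x \<partial>lborel) = 0"
    unfolding std_normal_def by (subst (asm) emeasure_density) auto
  then have "AE x in lborel. ennreal (std_normal_density x) * indicator U x = 0"
    using U by (subst (asm) nn_integral_0_iff_AE) auto
  moreover have "std_normal_density x > 0" for x
    by (rule normal_density_pos) simp
  ultimately have "AE x in lborel. x \<notin> U"
    by (auto simp: indicator_def ennreal_eq_0_iff not_le[symmetric] elim!: eventually_mono split: if_splits)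
  then have null: "emeasure lborel U = 0"
    using U by (subst (asm) AE_iff_measurable[where N=U]) auto
  obtain a where "a \<in> U" using assms by auto
  then obtain e where e: "e > 0" "ball a e \<subseteq> U" using assms(1) openE by blast
  have "ennreal e = emeasure lborel {a<..<a + e}" using e by simp
  also have "\<dots> \<le> emeasure lborel U"
    using e U by (intro emeasure_mono) (auto simp: dist_real_def)
  finally show False using null e by simp
qed

lemma emeasure_std_cgauss_pos:
  assumes "open U" "U \<noteq> {}"
  shows "emeasure std_cgauss U > 0"
proof -
  interpret N: prob_space std_normal by (rule prob_space_std_normal)
  interpret NN: pair_prob_space std_normal std_normal ..
  let ?NN = "std_normal \<Otimes>\<^sub>M std_normal"
  let ?f = "\<lambda>(x, y). Complex x y / complex_of_real (sqrt 2)"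
  have m [measurable]: "?f \<in> borel_measurable ?NN" by measurable
  have "continuous_on UNIV ?f"
    by (auto simp: split_def Complex_eq intro!: continuous_intros)
  then have op: "open (?f -` U)" using assms(1) by (rule open_vimage[rotated])
  obtain z where z: "z \<in> U" using assms by auto
  have "?f (Re z * sqrt 2, Im z * sqrt 2) = z" by (simp add: complex_eq_iff)
  with z have "(Re z * sqrt 2, Im z * sqrt 2) \<in> ?f -` U" by simp
  from open_prod_elim[OF op this] obtain A B where AB: "open A" "open B"
    "(Re z * sqrt 2, Im z * sqrt 2) \<in> A \<times> B" "A \<times> B \<subseteq> ?f -` U" by blast
  have "0 < emeasure std_normal A * emeasure std_normal B"
    using AB by (auto simp: ennreal_zero_less_mult_iff intro!: emeasure_std_normal_pos)
  also have "\<dots> = emeasure ?NN (A \<times> B)"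
    using AB by (intro N.emeasure_pair_measure_Times[symmetric]) auto
  also have "\<dots> \<le> emeasure ?NN (?f -` U \<inter> space ?NN)"
    using AB assms by (intro emeasure_mono measurable_sets[OF m]) (auto simp: space_pair_measure)
  also have "\<dots> = emeasure std_cgauss U"
    unfolding std_cgauss_def using assms by (intro emeasure_distr[symmetric] m) auto
  finally show ?thesis .
qed

text \<open>The estimates are proved for an arbitrary family of independent normalised complex Gaussians: they
then apply to the family on which the random series is built and to the coordinates of $X^0$.\<close>

locale complex_gaussians = prob_space P for P :: "'a measure" +
  fixes g :: "int \<Rightarrow> 'a \<Rightarrow> complex"
  assumes indep: "indep_vars (\<lambda>_. borel) g UNIV"
    and law: "\<And>n. distr P borel (g n) = std_cgauss"
begin

lemma g_measurable [measurable]: "g n \<in> borel_measurable P"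
  using indep by (simp add: indep_vars_def)

lemma moment_integrable: "integrable P (\<lambda>\<omega>. g n \<omega> ^ a * cnj (g n \<omega>) ^ b)"
  using std_cgauss_moments(1)[of a b] unfolding law[of n, symmetric]
  by (subst (asm) integrable_distr_eq) auto

lemma moment: "expectation (\<lambda>\<omega>. g n \<omega> ^ a * cnj (g n \<omega>) ^ b) = (if a = b then fact a else 0)"
  using std_cgauss_moments(2)[of a b] unfolding law[of n, symmetric]
  by (subst (asm) integral_distr) auto

lemma open_pos:
  assumes "open U" "U \<noteq> {}"
  shows "prob (g n -` U \<inter> space P) > 0"
  using emeasure_std_cgauss_pos[OF assms] assms unfolding law[of n, symmetric]
  by (subst (asm) emeasure_distr) (auto simp: emeasure_eq_measure)

end

lemma complex_gaussians_of_real_gaussians: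
  fixes h l :: "int \<Rightarrow> 'w \<Rightarrow> real"
  assumes "prob_space M"
    and ind: "prob_space.indep_vars M (\<lambda>_. borel) (case_sum h l) UNIV"
    and h: "\<And>n. distributed M lborel (h n) std_normal_density"
    and l: "\<And>n. distributed M lborel (l n) std_normal_density"
  shows "complex_gaussians M (\<lambda>n \<omega>. Complex (h n \<omega>) (l n \<omega>) / complex_of_real (sqrt 2))"
proof -
  interpret prob_space M by fact
  have [measurable]: "h n \<in> borel_measurable M" "l n \<in> borel_measurable M" for n
    using h[of n] l[of n] by (auto simp: distributed_def)
  show ?thesis
  proof
    let ?K = "\<lambda>n::int. {Inl n, Inr n} :: (int + int) set"
    have 1: "indep_vars (\<lambda>n. PiM (?K n) (\<lambda>_. borel)) (\<lambda>n \<omega>. restrict (\<lambda>i. case_sum h l i \<omega>) (?K n)) UNIV"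
      by (rule indep_vars_restrict[OF ind]) (auto simp: disjoint_family_on_def)
    have "indep_vars (\<lambda>_. borel) (\<lambda>n \<omega>. (\<lambda>f. Complex (f (Inl n)) (f (Inr n)) / complex_of_real (sqrt 2)) (restrict (\<lambda>i. case_sum h l i \<omega>) (?K n))) UNIV"
      by (rule indep_vars_compose2[OF 1]) measurable
    then show "indep_vars (\<lambda>_. borel) (\<lambda>n \<omega>. Complex (h n \<omega>) (l n \<omega>) / complex_of_real (sqrt 2)) UNIV"
      by simp
  next
    fix n
    have "indep_var (PiM {Inl n} (\<lambda>_. borel)) (\<lambda>\<omega>. restrict (\<lambda>i. case_sum h l i \<omega>) {Inl n})
       (PiM {Inr n} (\<lambda>_. borel)) (\<lambda>\<omega>. restrict (\<lambda>i. case_sum h l i \<omega>) {Inr n})"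
      by (rule indep_var_restrict[OF ind]) auto
    from indep_var_compose[OF this, where ?Y1.0="\<lambda>f. f (Inl n)" and ?Y2.0="\<lambda>f. f (Inr n)" and ?N1.0=borel and ?N2.0=borel]
    have "indep_var borel (h n) borel (l n)" by (simp add: comp_def)
    then have pair: "distr M borel (h n) \<Otimes>\<^sub>M distr M borel (l n) = distr M (borel \<Otimes>\<^sub>M borel) (\<lambda>\<omega>. (h n \<omega>, l n \<omega>))"
      by (simp add: indep_var_distribution_eq)
    have hd: "distr M borel (h n) = std_normal"
      using distributed_distr_eq_density[OF h[of n]] by (simp add: std_normal_def cong: distr_cong)
    have ld: "distr M borel (l n) = std_normal"
      using distributed_distr_eq_density[OF l[of n]] by (simp add: std_normal_def cong: distr_cong)
    have "std_cgauss = distr (distr M (borel \<Otimes>\<^sub>M borel) (\<lambda>\<omega>. (h n \<omega>, l n \<omega>))) borel (\<lambda>(x, y). Complex x y / complex_of_real (sqrt 2))"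
      unfolding std_cgauss_def pair[symmetric] hd ld ..
    also have "\<dots> = distr M borel (\<lambda>\<omega>. Complex (h n \<omega>) (l n \<omega>) / complex_of_real (sqrt 2))"
      by (subst distr_distr) (auto simp: comp_def)
    finally show "distr M borel (\<lambda>\<omega>. Complex (h n \<omega>) (l n \<omega>) / complex_of_real (sqrt 2)) = std_cgauss" ..
  qed
qed

section \<open>Wick pairings and Cauchy--Schwarz along a pairing\<close>

lemma sum_PiE_insert:
  fixes F :: "('e \<Rightarrow> 'i) \<Rightarrow> real"
  assumes "e \<notin> E"
  shows "(\<Sum>\<xi>\<in>insert e E \<rightarrow>\<^sub>E I. F \<xi>) = (\<Sum>\<xi>\<in>E \<rightarrow>\<^sub>E I. \<Sum>x\<in>I. F (\<xi>(e := x)))"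
proof -
  have inj: "inj_on (\<lambda>(x, \<xi>). \<xi>(e := x)) (I \<times> (E \<rightarrow>\<^sub>E I))"
    using inj_combinator[OF assms, of "\<lambda>_. I"] by simp
  have ins: "insert e E \<rightarrow>\<^sub>E I = (\<lambda>(x, \<xi>). \<xi>(e := x)) ` (I \<times> (E \<rightarrow>\<^sub>E I))"
    by (rule PiE_insert_eq)
  have "(\<Sum>\<xi>\<in>insert e E \<rightarrow>\<^sub>E I. F \<xi>) = (\<Sum>(x, \<xi>)\<in>I \<times> (E \<rightarrow>\<^sub>E I). F (\<xi>(e := x)))"
    by (subst ins, subst sum.reindex[OF inj]) (simp add: split_def comp_def)
  also have "\<dots> = (\<Sum>x\<in>I. \<Sum>\<xi>\<in>E \<rightarrow>\<^sub>E I. F (\<xi>(e := x)))"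
    by (rule sum.cartesian_product[symmetric])
  also have "\<dots> = (\<Sum>\<xi>\<in>E \<rightarrow>\<^sub>E I. \<Sum>x\<in>I. F (\<xi>(e := x)))"
    by (rule sum.swap)
  finally show ?thesis .
qed

text \<open>Read \<open>V\<close> as the vertices and \<open>E\<close> as the edges of a graph in which every edge joins exactly two vertices;
the sum runs over the labels of the edges, and the factor of a vertex sees only the labels of
the edges at that vertex. Summing over the label of one edge, Cauchy--Schwarz replaces the two
factors that see it by their $\ell^2$ norms in that label, which then no longer depend on
it. The induction removes the edges one by one. The number of labels does not enter the bound.\<close>

lemma sum_prod_le_Cauchy_Schwarz:
  fixes f :: "'v \<Rightarrow> ('e \<Rightarrow> 'i) \<Rightarrow> real"
  assumes "finite E" "finite V"
    and "\<And>v. v \<in> V \<Longrightarrow> dep v \<subseteq> E"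
    and "\<And>e. e \<in> E \<Longrightarrow> card {v \<in> V. e \<in> dep v} = 2"
    and "\<And>v \<xi>. 0 \<le> f v \<xi>"
    and "\<And>v \<xi> \<xi>'. (\<And>e. e \<in> dep v \<Longrightarrow> \<xi> e = \<xi>' e) \<Longrightarrow> f v \<xi> = f v \<xi>'"
  shows "(\<Sum>\<xi>\<in>E \<rightarrow>\<^sub>E I. \<Prod>v\<in>V. f v \<xi>) \<le> (\<Prod>v\<in>V. sqrt (\<Sum>\<xi>\<in>dep v \<rightarrow>\<^sub>E I. (f v \<xi>)\<^sup>2))"
  using assms
proof (induction E arbitrary: f dep rule: finite_induct)
  case empty
  have "f v (\<lambda>x. undefined) = sqrt (\<Sum>\<xi>\<in>dep v \<rightarrow>\<^sub>E I. (f v \<xi>)\<^sup>2)" if "v \<in> V" for v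
    using empty.prems(2)[OF that] empty.prems(4) by (auto simp: PiE_empty_domain)
  then show ?case by (simp add: PiE_empty_domain cong: prod.cong)
next
  case (insert e E)
  note depE = insert.prems(2) and two = insert.prems(3) and nonneg = insert.prems(4) and loc = insert.prems(5)
  \<comment> \<open>a factor that sees the label is replaced by its norm in that label\<close>
  define f' where "f' v \<xi> = (if e \<in> dep v then sqrt (\<Sum>x\<in>I. (f v (\<xi>(e := x)))\<^sup>2) else f v \<xi>)" for v \<xi>
  define dep' where "dep' v = dep v - {e}" for v
  \<comment> \<open>the two factors that see the label of the edge that is summed out\<close>
  obtain v w where vw: "{v \<in> V. e \<in> dep v} = {v, w}" "v \<noteq> w"
    using two[of e] by (auto simp: card_2_iff)
  have V: "V = {v, w} \<union> (V - {v, w})" using vw by auto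
  have split: "(\<Prod>u\<in>V. h u) = h v * h w * (\<Prod>u\<in>V - {v, w}. h u)" for h :: "'v \<Rightarrow> real"
    by (subst V, subst prod.union_disjoint) (use vw insert.prems(1) in auto)
  have "(\<Sum>\<xi>\<in>insert e E \<rightarrow>\<^sub>E I. \<Prod>v\<in>V. f v \<xi>) = (\<Sum>\<xi>\<in>E \<rightarrow>\<^sub>E I. \<Sum>x\<in>I. \<Prod>v\<in>V. f v (\<xi>(e := x)))"
    by (rule sum_PiE_insert) fact
  also have "\<dots> \<le> (\<Sum>\<xi>\<in>E \<rightarrow>\<^sub>E I. \<Prod>v\<in>V. f' v \<xi>)"
  proof (rule sum_mono)
    fix \<xi> assume "\<xi> \<in> E \<rightarrow>\<^sub>E I"
    have other: "f u (\<xi>(e := x)) = f' u \<xi>" if "u \<in> V - {v, w}" for u x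
    proof -
      have "e \<notin> dep u" using that vw(1) by blast
      then have "f u (\<xi>(e := x)) = f u \<xi>" by (intro loc) auto
      then show ?thesis using \<open>e \<notin> dep u\<close> by (simp add: f'_def)
    qed
    have "(\<Sum>x\<in>I. \<Prod>v\<in>V. f v (\<xi>(e := x))) = (\<Sum>x\<in>I. f v (\<xi>(e := x)) * f w (\<xi>(e := x))) * (\<Prod>u\<in>V - {v, w}. f' u \<xi>)"
      unfolding split sum_distrib_right using other by (intro sum.cong arg_cong2[where f="(*)"] prod.cong) auto
    also have "\<dots> \<le> (f' v \<xi> * f' w \<xi>) * (\<Prod>u\<in>V - {v, w}. f' u \<xi>)"
    proof (intro mult_right_mono prod_nonneg)
      have "v \<in> V" "w \<in> V" "e \<in> dep v" "e \<in> dep w" using vw by auto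
      then show "(\<Sum>x\<in>I. f v (\<xi>(e := x)) * f w (\<xi>(e := x))) \<le> f' v \<xi> * f' w \<xi>"
        unfolding f'_def using L2_set_mult_ineq[of "\<lambda>x. f v (\<xi>(e := x))" "\<lambda>x. f w (\<xi>(e := x))" I] nonneg
        by (simp add: L2_set_def)
    qed (auto simp: f'_def nonneg sum_nonneg)
    finally show "(\<Sum>x\<in>I. \<Prod>v\<in>V. f v (\<xi>(e := x))) \<le> (\<Prod>v\<in>V. f' v \<xi>)"
      unfolding split .
  qed
  also have "\<dots> \<le> (\<Prod>v\<in>V. sqrt (\<Sum>\<xi>\<in>dep' v \<rightarrow>\<^sub>E I. (f' v \<xi>)\<^sup>2))"
  proof (rule insert.IH)
    show "dep' u \<subseteq> E" if "u \<in> V" for u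
      using depE[OF that] by (auto simp: dep'_def)
    show "card {v \<in> V. e' \<in> dep' v} = 2" if "e' \<in> E" for e'
    proof -
      have "{v \<in> V. e' \<in> dep' v} = {v \<in> V. e' \<in> dep v}"
        using that insert.hyps by (auto simp: dep'_def)
      then show ?thesis using two[of e'] that by simp
    qed
    show "0 \<le> f' u \<xi>" for u \<xi>
      by (auto simp: f'_def nonneg sum_nonneg)
    show "f' u \<xi> = f' u \<xi>'" if "\<And>e. e \<in> dep' u \<Longrightarrow> \<xi> e = \<xi>' e" for u \<xi> \<xi>'
    proof (cases "e \<in> dep u")
      case True
      then have "f u (\<xi>(e := x)) = f u (\<xi>'(e := x))" for x
        using that by (intro loc) (auto simp: dep'_def)
      then show ?thesis by (simp add: f'_def True)
    next
      case False
      then have "f u \<xi> = f u \<xi>'" using that by (intro loc) (auto simp: dep'_def)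
      then show ?thesis using False by (simp add: f'_def)
    qed
  qed fact
  also have "\<dots> = (\<Prod>v\<in>V. sqrt (\<Sum>\<xi>\<in>dep v \<rightarrow>\<^sub>E I. (f v \<xi>)\<^sup>2))"
  proof (intro prod.cong refl arg_cong[where f=sqrt])
    fix u assume "u \<in> V"
    show "(\<Sum>\<xi>\<in>dep' u \<rightarrow>\<^sub>E I. (f' u \<xi>)\<^sup>2) = (\<Sum>\<xi>\<in>dep u \<rightarrow>\<^sub>E I. (f u \<xi>)\<^sup>2)"
    proof (cases "e \<in> dep u")
      case True
      then have "dep u = insert e (dep' u)" "e \<notin> dep' u" by (auto simp: dep'_def)
      then have "(\<Sum>\<xi>\<in>dep u \<rightarrow>\<^sub>E I. (f u \<xi>)\<^sup>2) = (\<Sum>\<xi>\<in>dep' u \<rightarrow>\<^sub>E I. \<Sum>x\<in>I. (f u (\<xi>(e := x)))\<^sup>2)"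
        using sum_PiE_insert[of e "dep' u" "\<lambda>\<xi>. (f u \<xi>)\<^sup>2" I] by simp
      then show ?thesis
        by (simp add: f'_def True sum_nonneg)
    next
      case False
      then have "dep' u = dep u" by (auto simp: dep'_def)
      then show ?thesis using False by (simp add: f'_def)
    qed
  qed
  finally show ?case .
qed

text \<open>The Wick pairings: the slots in \<open>A\<close> hold the variables and those in \<open>B\<close> the conjugate
variables, and a slot can only be matched with a slot that carries the same label.\<close>

definition pairings :: "'s set \<Rightarrow> ('s \<Rightarrow> 'i) \<Rightarrow> 't set \<Rightarrow> ('t \<Rightarrow> 'i) \<Rightarrow> ('s \<Rightarrow> 't) set" where
  "pairings A a B b = {\<pi> \<in> A \<rightarrow>\<^sub>E B. bij_betw \<pi> A B \<and> (\<forall>i\<in>A. b (\<pi> i) = a i)}"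

lemma finite_pairings: "finite A \<Longrightarrow> finite B \<Longrightarrow> finite (pairings A a B b)"
  unfolding pairings_def by (rule finite_subset[of _ "A \<rightarrow>\<^sub>E B"]) (auto intro: finite_PiE)

lemma card_pairings_le:
  assumes "finite A"
  shows "card (pairings A a A b) \<le> card A ^ card A"
proof -
  have "card (pairings A a A b) \<le> card (A \<rightarrow>\<^sub>E A)"
    using assms by (intro card_mono finite_PiE) (auto simp: pairings_def)
  then show ?thesis using assms by (simp add: card_PiE)
qed

text \<open>Both sides obey the same recursion: a slot \<open>x\<close> of \<open>A\<close> can be matched with each slot of \<open>B\<close> of
the same label, and after removing the two slots a pairing of the remaining ones is left.\<close>

lemma prod_fact_le_card_pairings:
  assumes "finite A" "finite B" "finite I" "a ` A \<subseteq> I" "b ` B \<subseteq> I"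
    and "\<And>n. n \<in> I \<Longrightarrow> card {i \<in> A. a i = n} = card {j \<in> B. b j = n}"
  shows "(\<Prod>n\<in>I. fact (card {i \<in> A. a i = n})) \<le> card (pairings A a B b)"
  using assms
proof (induction A arbitrary: B rule: finite_induct)
  case empty
  have "B = {}"
  proof (rule ccontr)
    assume "B \<noteq> {}"
    then obtain j where "j \<in> B" by auto
    then have "card {j' \<in> B. b j' = b j} = 0" "b j \<in> I" using empty.prems(5)[of "b j"] empty.prems by auto
    then show False using \<open>j \<in> B\<close> empty.prems(1) by auto
  qed
  then show ?case by (simp add: pairings_def PiE_empty_domain bij_betw_def)
next
  case (insert x A)
  let ?C = "{y \<in> B. b y = a x}"
  have xI: "a x \<in> I" using insert.prems by auto
  have cx: "card {i \<in> insert x A. a i = n} = card {i \<in> A. a i = n} + (if n = a x then 1 else 0)" for n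
  proof -
    have "{i \<in> insert x A. a i = n} = (if n = a x then insert x {i \<in> A. a i = n} else {i \<in> A. a i = n})" by auto
    then show ?thesis using insert.hyps by simp
  qed
  have sub: "(\<Prod>n\<in>I. fact (card {i \<in> A. a i = n})) \<le> card (pairings A a (B - {y}) b)" if y: "y \<in> ?C" for y
  proof (rule insert.IH)
    fix n assume "n \<in> I"
    have "{j \<in> B - {y}. b j = n} = (if n = a x then {j \<in> B. b j = n} - {y} else {j \<in> B. b j = n})" using y by auto
    then have "card {j \<in> B - {y}. b j = n} = card {j \<in> B. b j = n} - (if n = a x then 1 else 0)"
      using y by (auto simp: card_Diff_singleton)
    then show "card {i \<in> A. a i = n} = card {j \<in> B - {y}. b j = n}"
      using insert.prems(5)[OF \<open>n \<in> I\<close>] cx[of n] by auto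
  qed (use insert.prems in auto)
  have "(\<Prod>n\<in>I. fact (card {i \<in> insert x A. a i = n})) =
      (\<Prod>n\<in>I. (if n = a x then card ?C else 1) * fact (card {i \<in> A. a i = n}))"
  proof (intro prod.cong refl)
    fix n assume n: "n \<in> I"
    show "fact (card {i \<in> insert x A. a i = n}) = (if n = a x then card ?C else 1) * fact (card {i \<in> A. a i = n})"
    proof (cases "n = a x")
      case True
      then have "card ?C = Suc (card {i \<in> A. a i = n})"
        using cx[of n] insert.prems(5)[OF n] by auto
      then show ?thesis unfolding cx[of n] using True by (simp only: simp_thms if_True fact_Suc add_Suc_right add_0_right One_nat_def of_nat_id)
    next
      case False
      then show ?thesis unfolding cx[of n] by simp
    qed
  qed
  also have "\<dots> = card ?C * (\<Prod>n\<in>I. fact (card {i \<in> A. a i = n}))"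
    using xI insert.prems by (simp add: prod.distrib prod.delta')
  also have "\<dots> = (\<Sum>y\<in>?C. (\<Prod>n\<in>I. fact (card {i \<in> A. a i = n})))" by simp
  also have "\<dots> \<le> (\<Sum>y\<in>?C. card (pairings A a (B - {y}) b))"
    by (rule sum_mono) (rule sub)
  also have "\<dots> = card (SIGMA y:?C. pairings A a (B - {y}) b)"
    using insert by (subst card_SigmaI) (auto intro!: finite_pairings)
  also have "\<dots> = card ((\<lambda>(y, \<pi>). \<pi>(x := y)) ` (SIGMA y:?C. pairings A a (B - {y}) b))"
    by (rule card_image[symmetric], rule inj_on_subset[OF inj_combinator[OF \<open>x \<notin> A\<close>, of "\<lambda>_. B"]]) (auto simp: pairings_def)
  also have "\<dots> \<le> card (pairings (insert x A) a B b)"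
  proof (rule card_mono)
    show "(\<lambda>(y, \<pi>). \<pi>(x := y)) ` (SIGMA y:?C. pairings A a (B - {y}) b) \<subseteq> pairings (insert x A) a B b"
    proof (clarify)
      fix y \<pi> assume y: "y \<in> B" "b y = a x" and p: "\<pi> \<in> pairings A a (B - {y}) b"
      have "bij_betw (\<pi>(x := y)) A (B - {y})"
        using p \<open>x \<notin> A\<close> by (subst bij_betw_cong[of A _ \<pi>]) (auto simp: pairings_def)
      then have "bij_betw (\<pi>(x := y)) (A \<union> {x}) ((B - {y}) \<union> {y})"
        by (rule bij_betw_combine) (auto simp: bij_betw_def)
      then have "bij_betw (\<pi>(x := y)) (insert x A) B"
        using y by (simp add: insert_absorb)
      then show "\<pi>(x := y) \<in> pairings (insert x A) a B b"
        using p y \<open>x \<notin> A\<close> by (auto simp: pairings_def PiE_iff extensional_def)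
    qed
  qed (use insert in \<open>auto intro: finite_pairings\<close>)
  finally show ?case .
qed


lemma prod_power_fibers:
  fixes z :: "'i \<Rightarrow> 'b::comm_monoid_mult"
  assumes "finite A" "finite I" "a ` A \<subseteq> I"
  shows "(\<Prod>i\<in>A. z (a i)) = (\<Prod>n\<in>I. z n ^ card {i \<in> A. a i = n})"
proof -
  have "(\<Prod>i\<in>A. z (a i)) = (\<Prod>n\<in>I. \<Prod>i\<in>{i \<in> A. a i = n}. z (a i))"
    by (rule prod.group[symmetric]) fact+
  also have "\<dots> = (\<Prod>n\<in>I. z n ^ card {i \<in> A. a i = n})"
    by (intro prod.cong refl) simp
  finally show ?thesis .
qed

context complex_gaussians
begin

text \<open>By independence the expectation is a product over the labels. A label contributes a factorial if
it occurs equally often in both families, and zero otherwise.\<close>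

lemma
  assumes "finite A" "finite B"
  shows wick_integrable: "integrable P (\<lambda>\<omega>. (\<Prod>i\<in>A. g (a i) \<omega>) * (\<Prod>j\<in>B. cnj (g (b j) \<omega>)))" (is "integrable P ?F")
    and wick_bound: "norm (expectation (\<lambda>\<omega>. (\<Prod>i\<in>A. g (a i) \<omega>) * (\<Prod>j\<in>B. cnj (g (b j) \<omega>)))) \<le> card (pairings A a B b)"
proof -
  define I where "I = a ` A \<union> b ` B"
  have I: "finite I" "a ` A \<subseteq> I" "b ` B \<subseteq> I" using assms by (auto simp: I_def)
  let ?X = "\<lambda>n \<omega>. g n \<omega> ^ card {i \<in> A. a i = n} * cnj (g n \<omega>) ^ card {j \<in> B. b j = n}"
  have F: "?F = (\<lambda>\<omega>. \<Prod>n\<in>I. ?X n \<omega>)"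
    using assms I by (simp add: prod_power_fibers[where z="\<lambda>n. g n _" and I=I]
        prod_power_fibers[where z="\<lambda>n. cnj (g n _)" and I=I] prod.distrib)
  have ind: "indep_vars (\<lambda>_. borel) ?X I"
    by (rule indep_vars_compose2[OF indep_vars_subset[OF indep]]) auto
  show "integrable P ?F"
    unfolding F by (rule indep_vars_integrable[OF I(1) ind moment_integrable])
  have "expectation ?F = (\<Prod>n\<in>I. expectation (?X n))"
    unfolding F by (rule indep_vars_lebesgue_integral[OF I(1) ind moment_integrable])
  also have "\<dots> = (\<Prod>n\<in>I. if card {i \<in> A. a i = n} = card {j \<in> B. b j = n} then fact (card {i \<in> A. a i = n}) else 0)"
    by (simp add: moment)
  finally have E: "expectation ?F = \<dots>" .
  show "norm (expectation ?F) \<le> card (pairings A a B b)"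
  proof (cases "\<forall>n\<in>I. card {i \<in> A. a i = n} = card {j \<in> B. b j = n}")
    case True
    then have "(\<Prod>n\<in>I. if card {i \<in> A. a i = n} = card {j \<in> B. b j = n} then fact (card {i \<in> A. a i = n}) else 0)
       = (\<Prod>n\<in>I. fact (card {i \<in> A. a i = n}) :: complex)"
      by (intro prod.cong) auto
    then have "expectation ?F = of_nat (\<Prod>n\<in>I. fact (card {i \<in> A. a i = n}))"
      unfolding E by simp
    then show ?thesis
      using prod_fact_le_card_pairings[OF assms I] True by (simp only: norm_of_nat of_nat_le_iff)
  next
    case False
    then have "expectation ?F = 0" unfolding E using I(1) by (subst prod_zero_iff) auto
    then show ?thesis by simp
  qed
qed

end

section \<open>Moments of quartic chaoses\<close>

type_synonym quad = "int \<times> int \<times> int \<times> int"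

text \<open>The quadruple \<open>(a, b, c, d)\<close> stands for the monomial $z_a z_b \bar z_c \bar z_d$. A boolean selects the first
or the second slot of either kind, so that the slots of a product of quadruples are pairs of
a position and a boolean.\<close>

definition plus_idx :: "quad \<Rightarrow> bool \<Rightarrow> int" where
  "plus_idx q s = (if s then fst (snd q) else fst q)"

definition minus_idx :: "quad \<Rightarrow> bool \<Rightarrow> int" where
  "minus_idx q s = (if s then snd (snd (snd q)) else fst (snd (snd q)))"

definition quad_monomial :: "(int \<Rightarrow> complex) \<Rightarrow> quad \<Rightarrow> complex" where
  "quad_monomial z q = (\<Prod>s\<in>UNIV. z (plus_idx q s)) * (\<Prod>s\<in>UNIV. cnj (z (minus_idx q s)))"

text \<open>For such a quadruple no Wick pairing can match two slots of the same monomial, so the pairing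
is a graph without loops.\<close>

definition nonresonant :: "quad \<Rightarrow> bool" where
  "nonresonant q \<longleftrightarrow> (\<forall>s t. plus_idx q s \<noteq> minus_idx q t)"

text \<open>The quadruple at position \<open>v\<close> when \<open>\<xi>\<close> labels the plus slots and \<open>\<sigma>\<close> maps a minus slot to the
plus slot with which it is paired.\<close>

definition label_quad :: "('v \<times> bool \<Rightarrow> 'v \<times> bool) \<Rightarrow> ('v \<times> bool \<Rightarrow> int) \<Rightarrow> 'v \<Rightarrow> quad" where
  "label_quad \<sigma> \<xi> v = (\<xi> (v, False), \<xi> (v, True), \<xi> (\<sigma> (v, False)), \<xi> (\<sigma> (v, True)))"

lemma quad_eqI:
  assumes "\<And>s. plus_idx q s = plus_idx q' s" "\<And>s. minus_idx q s = minus_idx q' s"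
  shows "q = q'"
  using assms[of True] assms[of False] by (auto simp: plus_idx_def minus_idx_def prod_eq_iff)

lemma idx_label_quad [simp]:
  "plus_idx (label_quad \<sigma> \<xi> v) s = \<xi> (v, s)" "minus_idx (label_quad \<sigma> \<xi> v) s = \<xi> (\<sigma> (v, s))"
  by (auto simp: label_quad_def plus_idx_def minus_idx_def)

text \<open>For a fixed pairing, the labels of the plus slots determine all quadruples. So the sum is a sum
over edge labels of the graph whose vertices are the \<open>m\<close> positions and whose edges join
each plus slot to its partner. A loop makes all terms vanish, and otherwise Cauchy--Schwarz along the edges applies:
for each position the labels of its four slots determine a quadruple, whence the square sum of \<open>c\<close>.\<close>

lemma sum_over_pairing_le:
  fixes c :: "quad \<Rightarrow> real" and m :: nat
  assumes Q: "finite Q" "\<And>q. q \<in> Q \<Longrightarrow> nonresonant q" and c: "\<And>q. 0 \<le> c q"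
    and \<pi>: "bij_betw \<pi> ({..<m} \<times> UNIV) ({..<m} \<times> UNIV)"
  shows "(\<Sum>q | q \<in> {..<m} \<rightarrow>\<^sub>E Q \<and> (\<forall>i\<in>{..<m} \<times> UNIV. minus_idx (q (fst (\<pi> i))) (snd (\<pi> i)) = plus_idx (q (fst i)) (snd i)). \<Prod>v<m. c (q v))
     \<le> sqrt (\<Sum>q\<in>Q. (c q)\<^sup>2) ^ m"
proof -
  define Sl where "Sl = {..<m} \<times> (UNIV :: bool set)"
  have finS: "finite Sl" by (simp add: Sl_def)
  define \<sigma> where "\<sigma> = inv_into Sl \<pi>"
  have \<pi>S: "bij_betw \<pi> Sl Sl" using \<pi> by (simp add: Sl_def)
  have \<sigma>S: "bij_betw \<sigma> Sl Sl" unfolding \<sigma>_def by (rule bij_betw_inv_into[OF \<pi>S])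
  have \<sigma>\<pi>: "\<sigma> (\<pi> s) = s" "\<pi> (\<sigma> s) = s" "\<pi> s \<in> Sl" "\<sigma> s \<in> Sl" if "s \<in> Sl" for s
    using that \<pi>S \<sigma>S by (auto simp: \<sigma>_def bij_betw_inv_into_left bij_betw_inv_into_right bij_betwE)
  define G where "G = {q \<in> {..<m} \<rightarrow>\<^sub>E Q. \<forall>i\<in>Sl. minus_idx (q (fst (\<pi> i))) (snd (\<pi> i)) = plus_idx (q (fst i)) (snd i)}"
  define I where "I = (\<Union>q\<in>Q. range (plus_idx q))"
  have finI: "finite I" unfolding I_def using Q by (auto simp: plus_idx_def)
  define f where "f v \<xi> = (if label_quad \<sigma> \<xi> v \<in> Q then c (label_quad \<sigma> \<xi> v) else 0)" for v and \<xi> :: "nat \<times> bool \<Rightarrow> int"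
  have f0: "0 \<le> f v \<xi>" for v \<xi> by (simp add: f_def c)
  define lab where "lab q = restrict (\<lambda>i. plus_idx (q (fst i)) (snd i)) Sl" for q :: "nat \<Rightarrow> quad"
  have lab: "label_quad \<sigma> (lab q) v = q v" if "q \<in> G" "v < m" for q v
  proof (rule quad_eqI; unfold idx_label_quad)
    fix s
    have s: "(v, s) \<in> Sl" using that by (auto simp: Sl_def)
    show "lab q (v, s) = plus_idx (q v) s" using s by (simp add: lab_def)
    have "lab q (\<sigma> (v, s)) = plus_idx (q (fst (\<sigma> (v, s)))) (snd (\<sigma> (v, s)))"
      using \<sigma>\<pi>[OF s] by (simp add: lab_def)
    also have "\<dots> = minus_idx (q (fst (\<pi> (\<sigma> (v, s))))) (snd (\<pi> (\<sigma> (v, s))))"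
      using that(1) \<sigma>\<pi>(4)[OF s] by (simp add: G_def)
    finally show "lab q (\<sigma> (v, s)) = minus_idx (q v) s" using \<sigma>\<pi>[OF s] by simp
  qed
  have inj: "inj_on lab G"
  proof (rule inj_onI)
    fix q q' assume q: "q \<in> G" "q' \<in> G" "lab q = lab q'"
    show "q = q'"
    proof (rule PiE_ext)
      show "q \<in> {..<m} \<rightarrow>\<^sub>E Q" "q' \<in> {..<m} \<rightarrow>\<^sub>E Q" using q by (auto simp: G_def)
      show "q v = q' v" if "v \<in> {..<m}" for v
        using lab[OF q(1), of v] lab[OF q(2), of v] that q(3) by simp
    qed
  qed
  have "(\<Sum>q\<in>G. \<Prod>v<m. c (q v)) = (\<Sum>q\<in>G. \<Prod>v<m. f v (lab q))"
  proof (intro sum.cong prod.cong refl)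
    fix q v assume q: "q \<in> G" and v: "v \<in> {..<m}"
    then have "q v \<in> Q" by (auto simp: G_def)
    then show "c (q v) = f v (lab q)" using lab[OF q, of v] v by (simp add: f_def)
  qed
  also have "\<dots> = (\<Sum>\<xi>\<in>lab ` G. \<Prod>v<m. f v \<xi>)"
    by (simp add: sum.reindex[OF inj])
  also have "\<dots> \<le> (\<Sum>\<xi>\<in>Sl \<rightarrow>\<^sub>E I. \<Prod>v<m. f v \<xi>)"
  proof (rule sum_mono2)
    show "finite (Sl \<rightarrow>\<^sub>E I)" using finS finI by (intro finite_PiE) auto
    show "lab ` G \<subseteq> Sl \<rightarrow>\<^sub>E I"
    proof
      fix \<xi> assume "\<xi> \<in> lab ` G"
      then obtain q where q: "q \<in> G" "\<xi> = lab q" by auto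
      show "\<xi> \<in> Sl \<rightarrow>\<^sub>E I"
      proof (rule PiE_I)
        fix i assume "i \<in> Sl"
        then have "q (fst i) \<in> Q" using q by (auto simp: G_def Sl_def)
        then show "\<xi> i \<in> I" using q \<open>i \<in> Sl\<close> by (auto simp: lab_def I_def)
      qed (auto simp: q lab_def)
    qed
  qed (intro prod_nonneg f0 ballI)
  also have "\<dots> \<le> sqrt (\<Sum>q\<in>Q. (c q)\<^sup>2) ^ m"
  proof (cases "\<exists>i\<in>Sl. fst (\<pi> i) = fst i")
    case True
    then obtain v s t where vst: "v < m" "\<pi> (v, s) = (v, t)" "(v, s) \<in> Sl" 
      unfolding Sl_def by (metis mem_Sigma_iff lessThan_iff prod.collapse fst_conv)
    have "f v \<xi> = 0" for \<xi>
    proof -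
      have "\<sigma> (v, t) = (v, s)" using \<sigma>\<pi>(1)[OF vst(3)] vst(2) by simp
      then have "plus_idx (label_quad \<sigma> \<xi> v) s = minus_idx (label_quad \<sigma> \<xi> v) t" by simp
      then have "\<not> nonresonant (label_quad \<sigma> \<xi> v)" unfolding nonresonant_def by blast
      then show ?thesis using Q(2)[of "label_quad \<sigma> \<xi> v"] by (auto simp: f_def)
    qed
    then have z: "(\<Prod>v<m. f v \<xi>) = 0" for \<xi> using vst(1) by (intro prod_zero) auto
    show ?thesis unfolding z by (simp add: sum_nonneg)
  next
    case False
    define dep where "dep v = {(v, False), (v, True), \<sigma> (v, False), \<sigma> (v, True)}" for v
    have "(\<Sum>\<xi>\<in>Sl \<rightarrow>\<^sub>E I. \<Prod>v<m. f v \<xi>) \<le> (\<Prod>v<m. sqrt (\<Sum>\<xi>\<in>dep v \<rightarrow>\<^sub>E I. (f v \<xi>)\<^sup>2))"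
    proof (rule sum_prod_le_Cauchy_Schwarz[OF finS])
      show "dep v \<subseteq> Sl" if "v \<in> {..<m}" for v
      proof -
        have "(v, s) \<in> Sl" for s using that by (simp add: Sl_def)
        then show ?thesis using \<sigma>\<pi>(4) by (simp add: dep_def)
      qed
      show "card {v \<in> {..<m}. e \<in> dep v} = 2" if e: "e \<in> Sl" for e
      proof -
        have "e \<in> dep v \<longleftrightarrow> v = fst e \<or> v = fst (\<pi> e)" if v: "v < m" for v
        proof -
          have "e = \<sigma> (v, s) \<longleftrightarrow> \<pi> e = (v, s)" for s
          proof -
            have "(v, s) \<in> Sl" using v by (simp add: Sl_def)
            then show ?thesis using \<sigma>\<pi>(1)[OF e] \<sigma>\<pi>(2)[of "(v, s)"] by metis
          qed
          moreover have "(\<exists>s. \<pi> e = (v, s)) \<longleftrightarrow> v = fst (\<pi> e)" by (metis fst_conv prod.collapse)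
          moreover have "(\<exists>s. e = (v, s)) \<longleftrightarrow> v = fst e" by (metis fst_conv prod.collapse)
          moreover have "e \<in> dep v \<longleftrightarrow> (\<exists>s. e = (v, s)) \<or> (\<exists>s. e = \<sigma> (v, s))"
            by (auto simp: dep_def ex_bool_eq)
          ultimately show ?thesis by simp
        qed
        moreover have "fst e < m" "fst (\<pi> e) < m" using e \<sigma>\<pi>(3)[OF e] by (auto simp: Sl_def)
        ultimately have "{v \<in> {..<m}. e \<in> dep v} = {fst e, fst (\<pi> e)}" by auto
        then show ?thesis using False e by (auto simp: card_2_iff)
      qed
      show "f v \<xi> = f v \<xi>'" if "\<And>e. e \<in> dep v \<Longrightarrow> \<xi> e = \<xi>' e" for v \<xi> \<xi>'
      proof -
        have "label_quad \<sigma> \<xi> v = label_quad \<sigma> \<xi>' v"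
          using that by (auto simp: label_quad_def dep_def)
        then show ?thesis by (simp add: f_def)
      qed
    qed (auto simp: f0)
    also have "\<dots> \<le> (\<Prod>v<m. sqrt (\<Sum>q\<in>Q. (c q)\<^sup>2))"
    proof (intro prod_mono conjI real_sqrt_le_mono)
      fix v
      have finD: "finite (dep v \<rightarrow>\<^sub>E I)" using finI by (intro finite_PiE) (auto simp: dep_def)
      have injq: "inj_on (\<lambda>\<xi>. label_quad \<sigma> \<xi> v) (dep v \<rightarrow>\<^sub>E I)"
      proof (rule inj_onI)
        fix \<xi> \<xi>' assume h: "\<xi> \<in> dep v \<rightarrow>\<^sub>E I" "\<xi>' \<in> dep v \<rightarrow>\<^sub>E I" "label_quad \<sigma> \<xi> v = label_quad \<sigma> \<xi>' v"
        show "\<xi> = \<xi>'"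
          by (rule PiE_ext[OF h(1,2)]) (use h(3) in \<open>auto simp: dep_def label_quad_def\<close>)
      qed
      have "(\<Sum>\<xi>\<in>dep v \<rightarrow>\<^sub>E I. (f v \<xi>)\<^sup>2) = (\<Sum>\<xi>\<in>dep v \<rightarrow>\<^sub>E I. if label_quad \<sigma> \<xi> v \<in> Q then (c (label_quad \<sigma> \<xi> v))\<^sup>2 else 0)"
        by (intro sum.cong) (auto simp: f_def)
      also have "\<dots> = (\<Sum>q\<in>(\<lambda>\<xi>. label_quad \<sigma> \<xi> v) ` (dep v \<rightarrow>\<^sub>E I). if q \<in> Q then (c q)\<^sup>2 else 0)"
        by (simp add: sum.reindex[OF injq])
      also have "\<dots> = (\<Sum>q\<in>(\<lambda>\<xi>. label_quad \<sigma> \<xi> v) ` (dep v \<rightarrow>\<^sub>E I) \<inter> Q. (c q)\<^sup>2)"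
        using finD by (subst sum.inter_restrict) auto
      also have "\<dots> \<le> (\<Sum>q\<in>Q. (c q)\<^sup>2)"
        using Q by (intro sum_mono2) auto
      finally show "(\<Sum>\<xi>\<in>dep v \<rightarrow>\<^sub>E I. (f v \<xi>)\<^sup>2) \<le> (\<Sum>q\<in>Q. (c q)\<^sup>2)" .
    qed (auto simp: sum_nonneg)
    finally show ?thesis by simp
  qed
  finally show ?thesis by (simp add: G_def Sl_def)
qed

context complex_gaussians
begin


lemma quad_chaos_power:
  assumes "finite Q"
  shows "(\<Sum>q\<in>Q. complex_of_real (c q) * quad_monomial z q) ^ m =
    (\<Sum>q\<in>{..<m} \<rightarrow>\<^sub>E Q. complex_of_real (\<Prod>v<m. c (q v)) *
       ((\<Prod>i\<in>{..<m} \<times> UNIV. z (plus_idx (q (fst i)) (snd i))) * (\<Prod>i\<in>{..<m} \<times> UNIV. cnj (z (minus_idx (q (fst i)) (snd i))))))"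
proof -
  have "(\<Sum>q\<in>Q. complex_of_real (c q) * quad_monomial z q) ^ m = (\<Prod>v<m. \<Sum>q\<in>Q. complex_of_real (c q) * quad_monomial z q)"
    by simp
  also have "\<dots> = (\<Sum>q\<in>{..<m} \<rightarrow>\<^sub>E Q. \<Prod>v<m. complex_of_real (c (q v)) * quad_monomial z (q v))"
    using assms by (intro prod_sum_PiE) auto
  also have "\<dots> = (\<Sum>q\<in>{..<m} \<rightarrow>\<^sub>E Q. complex_of_real (\<Prod>v<m. c (q v)) *
       ((\<Prod>i\<in>{..<m} \<times> UNIV. z (plus_idx (q (fst i)) (snd i))) * (\<Prod>i\<in>{..<m} \<times> UNIV. cnj (z (minus_idx (q (fst i)) (snd i))))))"
    unfolding quad_monomial_def by (simp only: prod.distrib of_real_prod prod.cartesian_product split_def fst_conv snd_conv)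
  finally show ?thesis .
qed

lemma quad_chaos_integrable:
  assumes "finite Q"
  shows "integrable P (\<lambda>\<omega>. (\<Sum>q\<in>Q. complex_of_real (c q) * quad_monomial (\<lambda>n. g n \<omega>) q) ^ m)"
  unfolding quad_chaos_power[OF assms]
  by (intro Bochner_Integration.integrable_sum integrable_mult_right wick_integrable) auto

lemma quad_chaos_moment_aux:
  assumes "finite Q"
  shows "norm (expectation (\<lambda>\<omega>. (\<Sum>q\<in>Q. complex_of_real (c q) * quad_monomial (\<lambda>n. g n \<omega>) q) ^ m))
     \<le> (\<Sum>q\<in>{..<m} \<rightarrow>\<^sub>E Q. \<bar>\<Prod>v<m. c (q v)\<bar> * card (pairings ({..<m} \<times> UNIV) (\<lambda>i. plus_idx (q (fst i)) (snd i))
          ({..<m} \<times> UNIV) (\<lambda>i. minus_idx (q (fst i)) (snd i))))"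
  unfolding quad_chaos_power[OF assms]
  by (subst Bochner_Integration.integral_sum, (intro integrable_mult_right wick_integrable; simp),
      rule sum_norm_le, subst integral_mult_right_zero, unfold norm_mult norm_of_real,
      intro mult_left_mono wick_bound) auto

text \<open>The sign of the coefficients matters: it allows replacing the Gaussian expectation of each term by an
upper bound, the number of its pairings. The factor in front is a crude count of all pairings. Its logarithm is
$o(m^2)$, and this is what Nelson's argument will require.\<close>

lemma quad_chaos_moment:
  assumes Q: "finite Q" "\<And>q. q \<in> Q \<Longrightarrow> nonresonant q" and c: "\<And>q. 0 \<le> c q"
  shows "norm (expectation (\<lambda>\<omega>. (\<Sum>q\<in>Q. complex_of_real (c q) * quad_monomial (\<lambda>n. g n \<omega>) q) ^ m))
     \<le> real (2 * m) ^ (2 * m) * sqrt (\<Sum>q\<in>Q. (c q)\<^sup>2) ^ m"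
proof -
  define Sl where "Sl = {..<m} \<times> (UNIV :: bool set)"
  have finS: "finite Sl" by (simp add: Sl_def)
  let ?pl = "\<lambda>q i. plus_idx (q (fst i)) (snd i)" and ?mi = "\<lambda>q i. minus_idx (q (fst i)) (snd i)"
  let ?B = "{\<pi> \<in> Sl \<rightarrow>\<^sub>E Sl. bij_betw \<pi> Sl Sl}"
  have finB: "finite ?B" using finS by (auto intro: finite_subset[OF _ finite_PiE[OF finS finS]])
  have finQ: "finite ({..<m} \<rightarrow>\<^sub>E Q)" using Q by (intro finite_PiE) auto
  have "norm (expectation (\<lambda>\<omega>. (\<Sum>q\<in>Q. complex_of_real (c q) * quad_monomial (\<lambda>n. g n \<omega>) q) ^ m))
     \<le> (\<Sum>q\<in>{..<m} \<rightarrow>\<^sub>E Q. \<bar>\<Prod>v<m. c (q v)\<bar> * card (pairings Sl (?pl q) Sl (?mi q)))"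
    unfolding Sl_def by (rule quad_chaos_moment_aux) fact
  also have "\<dots> = (\<Sum>q\<in>{..<m} \<rightarrow>\<^sub>E Q. \<Sum>\<pi>\<in>?B. if \<forall>i\<in>Sl. ?mi q (\<pi> i) = ?pl q i then \<Prod>v<m. c (q v) else 0)"
  proof (intro sum.cong refl)
    fix q
    have "pairings Sl (?pl q) Sl (?mi q) = {\<pi> \<in> ?B. \<forall>i\<in>Sl. ?mi q (\<pi> i) = ?pl q i}"
      by (auto simp: pairings_def)
    then show "\<bar>\<Prod>v<m. c (q v)\<bar> * card (pairings Sl (?pl q) Sl (?mi q)) =
       (\<Sum>\<pi>\<in>?B. if \<forall>i\<in>Sl. ?mi q (\<pi> i) = ?pl q i then \<Prod>v<m. c (q v) else 0)"
      using sum.inter_filter[OF finB, of "\<lambda>_. \<Prod>v<m. c (q v)" "\<lambda>\<pi>. \<forall>i\<in>Sl. ?mi q (\<pi> i) = ?pl q i"]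
      by (simp add: c prod_nonneg mult.commute)
  qed
  also have "\<dots> = (\<Sum>\<pi>\<in>?B. \<Sum>q\<in>{..<m} \<rightarrow>\<^sub>E Q. if \<forall>i\<in>Sl. ?mi q (\<pi> i) = ?pl q i then \<Prod>v<m. c (q v) else 0)"
    by (rule sum.swap)
  also have "\<dots> \<le> (\<Sum>\<pi>\<in>?B. sqrt (\<Sum>q\<in>Q. (c q)\<^sup>2) ^ m)"
  proof (rule sum_mono)
    fix \<pi> assume "\<pi> \<in> ?B"
    then have "bij_betw \<pi> ({..<m} \<times> UNIV) ({..<m} \<times> UNIV)" by (simp add: Sl_def)
    from sum_over_pairing_le[OF Q c this]
    show "(\<Sum>q\<in>{..<m} \<rightarrow>\<^sub>E Q. if \<forall>i\<in>Sl. ?mi q (\<pi> i) = ?pl q i then \<Prod>v<m. c (q v) else 0) \<le> sqrt (\<Sum>q\<in>Q. (c q)\<^sup>2) ^ m"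
      by (subst sum.inter_filter[OF finQ, symmetric]) (simp add: Sl_def)
  qed
  also have "\<dots> = card ?B * sqrt (\<Sum>q\<in>Q. (c q)\<^sup>2) ^ m" by simp
  also have "\<dots> \<le> real (2 * m) ^ (2 * m) * sqrt (\<Sum>q\<in>Q. (c q)\<^sup>2) ^ m"
  proof (rule mult_right_mono)
    have "card ?B \<le> card (Sl \<rightarrow>\<^sub>E Sl)" using finS by (intro card_mono finite_PiE) auto
    also have "\<dots> = (2 * m) ^ (2 * m)"
      using finS by (simp add: card_PiE) (simp add: Sl_def mult.commute)
    finally show "real (card ?B) \<le> real (2 * m) ^ (2 * m)"
      unfolding of_nat_power[symmetric] of_nat_le_iff .
  qed (simp add: sum_nonneg)
  finally show ?thesis .
qed

text \<open>The quadruples \<open>(n, n, n, n)\<close> allow loops, so Cauchy--Schwarz along the edges is not available, but as the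
coefficients are summable it is enough to count the pairings.\<close>

lemma quartic_sum_moment:
  assumes "finite A" and c: "\<And>n. 0 \<le> c n"
  shows "integrable P (\<lambda>\<omega>. (\<Sum>n\<in>A. c n * cmod (g n \<omega>) ^ 4) ^ m)"
    and "expectation (\<lambda>\<omega>. (\<Sum>n\<in>A. c n * cmod (g n \<omega>) ^ 4) ^ m) \<le> real (2 * m) ^ (2 * m) * (\<Sum>n\<in>A. c n) ^ m"
proof -
  let ?c = "\<lambda>q::quad. if (\<exists>n\<in>A. q = (n, n, n, n)) then c (fst q) else 0"
  let ?Q = "(\<lambda>n. (n, n, n, n)) ` A"
  let ?S = "\<lambda>\<omega>. \<Sum>q\<in>?Q. complex_of_real (?c q) * quad_monomial (\<lambda>n. g n \<omega>) q"
  let ?T = "\<lambda>\<omega>. \<Sum>n\<in>A. c n * cmod (g n \<omega>) ^ 4"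
  have finQ: "finite ?Q" using assms by simp
  have mon: "quad_monomial z (n, n, n, n) = complex_of_real (cmod (z n) ^ 4)" for z n
  proof -
    have "quad_monomial z (n, n, n, n) = (z n * cnj (z n))\<^sup>2"
      by (simp add: quad_monomial_def plus_idx_def minus_idx_def UNIV_bool power2_eq_square algebra_simps)
    also have "\<dots> = complex_of_real (cmod (z n) ^ 4)"
      by (simp add: complex_norm_square[symmetric] power_mult[symmetric])
    finally show ?thesis .
  qed
  have ST: "?S \<omega> = complex_of_real (?T \<omega>)" for \<omega>
    using assms by (subst sum.reindex) (auto simp: inj_on_def mon intro!: sum.cong)
  then have STm: "(\<lambda>\<omega>. ?S \<omega> ^ m) = (\<lambda>\<omega>. complex_of_real (?T \<omega> ^ m))" by simp
  have "integrable P (\<lambda>\<omega>. ?S \<omega> ^ m)" by (rule quad_chaos_integrable[OF finQ])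
  then show i: "integrable P (\<lambda>\<omega>. ?T \<omega> ^ m)" unfolding STm by (simp only: complex_of_real_integrable_eq)
  have T0: "0 \<le> ?T \<omega>" for \<omega> using c by (auto intro!: sum_nonneg)
  have "expectation (\<lambda>\<omega>. ?T \<omega> ^ m) = norm (expectation (\<lambda>\<omega>. ?S \<omega> ^ m))"
    unfolding STm integral_complex_of_real norm_of_real using T0
    by (intro abs_of_nonneg[symmetric] Bochner_Integration.integral_nonneg zero_le_power)
  also have "\<dots> \<le> (\<Sum>q\<in>{..<m} \<rightarrow>\<^sub>E ?Q. \<bar>\<Prod>v<m. ?c (q v)\<bar> * card (pairings ({..<m} \<times> UNIV) (\<lambda>i. plus_idx (q (fst i)) (snd i))
          ({..<m} \<times> UNIV) (\<lambda>i. minus_idx (q (fst i)) (snd i))))"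
    by (rule quad_chaos_moment_aux[OF finQ])
  also have "\<dots> \<le> (\<Sum>q\<in>{..<m} \<rightarrow>\<^sub>E ?Q. (\<Prod>v<m. ?c (q v)) * real (2 * m) ^ (2 * m))"
  proof (rule sum_mono)
    fix q :: "nat \<Rightarrow> quad"
    have "card (pairings ({..<m} \<times> (UNIV::bool set)) a ({..<m} \<times> UNIV) b) \<le> (2 * m) ^ (2 * m)" for a b :: "nat \<times> bool \<Rightarrow> int"
      using card_pairings_le[of "{..<m} \<times> (UNIV::bool set)" a b] by (simp add: mult.commute)
    then have "real (card (pairings ({..<m} \<times> (UNIV::bool set)) a ({..<m} \<times> UNIV) b)) \<le> real (2 * m) ^ (2 * m)" for a b :: "nat \<times> bool \<Rightarrow> int"
      unfolding of_nat_power[symmetric] of_nat_le_iff .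
    moreover have "0 \<le> (\<Prod>v<m. ?c (q v))" using c by (intro prod_nonneg) auto
    ultimately show "\<bar>\<Prod>v<m. ?c (q v)\<bar> * card (pairings ({..<m} \<times> UNIV) (\<lambda>i. plus_idx (q (fst i)) (snd i))
          ({..<m} \<times> UNIV) (\<lambda>i. minus_idx (q (fst i)) (snd i))) \<le> (\<Prod>v<m. ?c (q v)) * real (2 * m) ^ (2 * m)"
      by (simp only: abs_of_nonneg) (intro mult_left_mono, auto)
  qed
  also have "\<dots> = real (2 * m) ^ (2 * m) * (\<Prod>v<m. \<Sum>q\<in>?Q. ?c q)"
    using finQ by (subst prod_sum_PiE) (auto simp: sum_distrib_left mult.commute)
  also have "(\<Sum>q\<in>?Q. ?c q) = (\<Sum>n\<in>A. c n)"
    using assms by (subst sum.reindex) (auto simp: inj_on_def intro!: sum.cong)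
  finally show "expectation (\<lambda>\<omega>. ?T \<omega> ^ m) \<le> real (2 * m) ^ (2 * m) * (\<Sum>n\<in>A. c n) ^ m"
    by simp
qed

end

section \<open>Counting quadruples\<close>

definition wt :: "int \<Rightarrow> real" where
  "wt n = 1 / (1 + \<bar>real_of_int n\<bar>)"

text \<open>The exponent is such that \<open>vt n ^ 3\<close> is \<open>wt n powr (7 / 8)\<close>, which keeps a factor \<open>wt n powr (1 / 8)\<close> in reserve,
while \<open>vt n ^ 4\<close> is \<open>wt n powr (7 / 6)\<close>, which is summable.\<close>

definition vt :: "int \<Rightarrow> real" where
  "vt n = wt n powr (7 / 24)"

lemma wt_pos [simp]: "0 < wt n" and wt_le_1 [simp]: "wt n \<le> 1"
  by (simp_all add: wt_def)

lemma wt_nonneg [simp]: "0 \<le> wt n" and wt_nz [simp]: "wt n \<noteq> 0"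
  using wt_pos[of n] by linarith+

lemma vt_nonneg [simp]: "0 \<le> vt n"
  by (simp add: vt_def)

lemma vt_power3: "vt n ^ 3 = wt n powr (7 / 8)"
  unfolding vt_def by (simp add: powr_power)

lemma vt_power4: "vt n ^ 4 = wt n powr (7 / 6)"
  unfolding vt_def by (simp add: powr_power)

text \<open>The larger of $|a|$ and $|b|$ is at least half of $|a + b|$. Two factors at this index are exchanged for
factors at \<open>a + b\<close>, and the remaining one is bounded by the factor at the other index.\<close>

lemma vt_product_le: "vt a ^ 3 * vt b ^ 3 \<le> 4 * vt (a + b) ^ 2 * (vt a ^ 4 + vt b ^ 4)"
proof -
  have *: "vt a ^ 3 * vt b ^ 3 \<le> 4 * vt (a + b) ^ 2 * vt b ^ 4" if "\<bar>a\<bar> \<ge> \<bar>b\<bar>" for a b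
  proof -
    have "real_of_int \<bar>a + b\<bar> \<le> real_of_int (2 * \<bar>a\<bar>)"
      using that by simp
    then have "1 + \<bar>real_of_int (a + b)\<bar> \<le> 2 * (1 + \<bar>real_of_int a\<bar>)" by simp
    then have "wt a \<le> 2 * wt (a + b)"
      unfolding wt_def by (simp add: field_simps)
    then have "vt a \<le> (2 * wt (a + b)) powr (7 / 24)"
      unfolding vt_def by (intro powr_mono2) auto
    also have "\<dots> = 2 powr (7 / 24) * vt (a + b)"
      unfolding vt_def by (simp add: powr_mult)
    also have "\<dots> \<le> 2 powr 1 * vt (a + b)"
      by (intro mult_right_mono powr_mono) auto
    finally have 1: "vt a \<le> 2 * vt (a + b)" by simp
    have "wt a \<le> wt b" using that unfolding wt_def by (intro divide_left_mono) auto
    then have 2: "vt a \<le> vt b" unfolding vt_def by (intro powr_mono2) auto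
    have "vt a ^ 3 * vt b ^ 3 = vt a ^ 2 * (vt a * vt b ^ 3)"
      by (simp add: power2_eq_square power3_eq_cube)
    also have "\<dots> \<le> (2 * vt (a + b)) ^ 2 * (vt b * vt b ^ 3)"
      by (intro mult_mono power_mono 1 2) auto
    also have "\<dots> = 4 * vt (a + b) ^ 2 * vt b ^ 4"
      by (simp add: power_mult_distrib power_Suc[symmetric] del: power_Suc)
    finally show ?thesis .
  qed
  consider "\<bar>a\<bar> \<ge> \<bar>b\<bar>" | "\<bar>b\<bar> \<ge> \<bar>a\<bar>" by linarith
  then show ?thesis
  proof cases
    case 1
    have "0 \<le> 4 * vt (a + b) ^ 2 * vt a ^ 4" by simp
    with *[OF 1] show ?thesis unfolding distrib_left by linarith
  next
    case 2
    have "0 \<le> 4 * vt (a + b) ^ 2 * vt b ^ 4" by simp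
    moreover have "vt a ^ 3 * vt b ^ 3 \<le> 4 * vt (a + b) ^ 2 * vt a ^ 4"
      using *[OF 2] by (simp only: add.commute[of b a] mult.commute[of "vt b ^ 3"])
    ultimately show ?thesis unfolding distrib_left by linarith
  qed
qed

lemma sum_wt_powr_le:
  assumes "finite A" and p: "1 < p"
  shows "(\<Sum>n\<in>A. wt n powr p) \<le> 2 * (\<Sum>n. real (Suc n) powr (- p))"
proof -
  let ?f = "\<lambda>n. real (Suc n) powr (- p)"
  have "summable (\<lambda>n. real n powr (- p))" using p by (subst summable_real_powr_iff) simp
  then have sm: "summable ?f" by (subst summable_Suc_iff)
  have w: "wt n powr p = ?f (nat \<bar>n\<bar>)" for n
  proof -
    have "wt n = inverse (real (Suc (nat \<bar>n\<bar>)))" by (simp add: wt_def inverse_eq_divide)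
    then show ?thesis by (simp only:) (simp add: powr_minus inverse_powr)
  qed
  have *: "(\<Sum>n\<in>B. wt n powr p) \<le> (\<Sum>n. ?f n)" if "finite B" "inj_on (\<lambda>n. nat \<bar>n\<bar>) B" for B
  proof -
    have "(\<Sum>n\<in>B. wt n powr p) = sum ?f ((\<lambda>n. nat \<bar>n\<bar>) ` B)"
      unfolding w by (subst sum.reindex[OF that(2)]) simp
    also have "\<dots> \<le> (\<Sum>n. ?f n)" using that by (intro sum_le_suminf sm) auto
    finally show ?thesis .
  qed
  have "(\<Sum>n\<in>A. wt n powr p) = (\<Sum>n\<in>A \<inter> {0..}. wt n powr p) + (\<Sum>n\<in>A \<inter> {..<0}. wt n powr p)"
    using assms by (subst sum.union_disjoint[symmetric]) (auto intro!: sum.cong)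
  also have "\<dots> \<le> 2 * (\<Sum>n. ?f n)"
    unfolding mult_2 using assms by (intro add_mono *) (auto simp: inj_on_def)
  finally show ?thesis .
qed

definition vt_sum :: real where
  "vt_sum = 2 * (\<Sum>n. real (Suc n) powr (- (7 / 6)))"

lemma sum_vt_le: "finite A \<Longrightarrow> (\<Sum>n\<in>A. vt n ^ 4) \<le> vt_sum"
  unfolding vt_power4 vt_sum_def by (rule sum_wt_powr_le) auto

lemma vt_sum_nonneg: "0 \<le> vt_sum"
  using sum_vt_le[of "{}"] by simp

definition wt_quad :: "int \<times> int \<times> int \<times> int \<Rightarrow> real" where
  "wt_quad = (\<lambda>(a, b, c, d). wt a * wt b * wt c * wt d)"

definition vt_quad :: "int \<times> int \<times> int \<times> int \<Rightarrow> real" where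
  "vt_quad = (\<lambda>(a, b, c, d). vt a ^ 3 * vt b ^ 3 * vt c ^ 3 * vt d ^ 3)"

text \<open>The fourth index is determined by the others. Applying the product inequality to the last two
indices and then to the first two always leaves a summable fourth power.\<close>

lemma sum_vt_quad_le:
  assumes "finite Q" "\<And>a b c d. (a, b, c, d) \<in> Q \<Longrightarrow> a + b = c + d"
  shows "(\<Sum>q\<in>Q. vt_quad q) \<le> 64 * vt_sum ^ 3"
proof -
  define I where "I = fst ` Q \<union> (fst \<circ> snd) ` Q \<union> (fst \<circ> snd \<circ> snd) ` Q"
  have fin: "finite I" using assms by (simp add: I_def)
  let ?T = "(\<lambda>(a, b, c, d). (a, b, c)) :: int \<times> int \<times> int \<times> int \<Rightarrow> int \<times> int \<times> int"
  have inj: "inj_on ?T Q" 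
    by (rule inj_onI) (clarsimp, metis assms(2) add_left_cancel)
  have "(\<Sum>q\<in>Q. vt_quad q) = (\<Sum>(a, b, c)\<in>?T ` Q. vt_quad (a, b, c, a + b - c))"
    using assms(2) by (subst sum.reindex[OF inj]) (force intro!: sum.cong)
  also have "\<dots> \<le> (\<Sum>(a, b, c)\<in>I \<times> I \<times> I. vt_quad (a, b, c, a + b - c))"
    using fin by (intro sum_mono2) (force simp: I_def vt_quad_def)+
  also have "\<dots> = (\<Sum>a\<in>I. \<Sum>b\<in>I. \<Sum>c\<in>I. vt_quad (a, b, c, a + b - c))"
    by (simp add: sum.cartesian_product split_def)
  also have "\<dots> \<le> (\<Sum>a\<in>I. \<Sum>b\<in>I. 32 * vt_sum * (vt a ^ 4 + vt b ^ 4) * vt (a + b) ^ 4)"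
  proof (intro sum_mono)
    fix a b
    have "(\<Sum>c\<in>I. vt_quad (a, b, c, a + b - c)) = (vt a ^ 3 * vt b ^ 3) * (\<Sum>c\<in>I. vt c ^ 3 * vt (a + b - c) ^ 3)"
      by (simp add: vt_quad_def sum_distrib_left mult.assoc)
    also have "\<dots> \<le> (4 * vt (a + b) ^ 2 * (vt a ^ 4 + vt b ^ 4)) * (8 * vt_sum * vt (a + b) ^ 2)"
    proof (rule mult_mono[OF vt_product_le])
      have "(\<Sum>c\<in>I. vt c ^ 3 * vt (a + b - c) ^ 3) \<le> (\<Sum>c\<in>I. 4 * vt (a + b) ^ 2 * (vt c ^ 4 + vt (a + b - c) ^ 4))"
      proof (rule sum_mono)
        fix c
        show "vt c ^ 3 * vt (a + b - c) ^ 3 \<le> 4 * vt (a + b) ^ 2 * (vt c ^ 4 + vt (a + b - c) ^ 4)"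
          using vt_product_le[of c "a + b - c"] by simp
      qed
      also have "\<dots> = 4 * vt (a + b) ^ 2 * ((\<Sum>c\<in>I. vt c ^ 4) + (\<Sum>c\<in>I. vt (a + b - c) ^ 4))"
        by (simp only: sum.distrib[symmetric] sum_distrib_left[symmetric])
      also have "(\<Sum>c\<in>I. vt (a + b - c) ^ 4) = (\<Sum>c\<in>(\<lambda>c. a + b - c) ` I. vt c ^ 4)"
        by (subst sum.reindex) (auto simp: inj_on_def)
      also have "4 * vt (a + b) ^ 2 * ((\<Sum>c\<in>I. vt c ^ 4) + \<dots>) \<le> 4 * vt (a + b) ^ 2 * (vt_sum + vt_sum)"
        using fin by (intro mult_left_mono add_mono sum_vt_le) auto
      finally show "(\<Sum>c\<in>I. vt c ^ 3 * vt (a + b - c) ^ 3) \<le> 8 * vt_sum * vt (a + b) ^ 2" by (simp add: mult.commute)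
    qed (auto intro!: sum_nonneg)
    also have "\<dots> = 32 * vt_sum * (vt a ^ 4 + vt b ^ 4) * (vt (a + b) ^ 2 * vt (a + b) ^ 2)"
      by (simp add: algebra_simps)
    finally show "(\<Sum>c\<in>I. vt_quad (a, b, c, a + b - c)) \<le> 32 * vt_sum * (vt a ^ 4 + vt b ^ 4) * vt (a + b) ^ 4"
      by (simp add: power_add[symmetric])
  qed
  also have "\<dots> = 32 * vt_sum * ((\<Sum>a\<in>I. vt a ^ 4 * (\<Sum>b\<in>I. vt (a + b) ^ 4)) + (\<Sum>b\<in>I. vt b ^ 4 * (\<Sum>a\<in>I. vt (a + b) ^ 4)))"
  proof -
    have "(\<Sum>b\<in>I. vt b ^ 4 * (\<Sum>a\<in>I. vt (a + b) ^ 4)) = (\<Sum>a\<in>I. \<Sum>b\<in>I. vt b ^ 4 * vt (a + b) ^ 4)"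
      unfolding sum_distrib_left by (rule sum.swap)
    then show ?thesis
      by (simp only: sum_distrib_left sum.distrib[symmetric] distrib_right[symmetric] mult.assoc)
  qed
  also have "\<dots> \<le> 32 * vt_sum * (vt_sum * vt_sum + vt_sum * vt_sum)"
  proof -
    have s: "(\<Sum>b\<in>I. vt (a + b) ^ 4) \<le> vt_sum" for a
    proof -
      have "(\<Sum>b\<in>I. vt (a + b) ^ 4) = (\<Sum>c\<in>(+) a ` I. vt c ^ 4)"
        by (subst sum.reindex) (auto simp: inj_on_def)
      then show ?thesis using sum_vt_le[of "(+) a ` I"] fin by simp
    qed
    have t: "(\<Sum>a\<in>I. vt a ^ 4 * (\<Sum>b\<in>I. vt (a + b) ^ 4)) \<le> vt_sum * vt_sum"
    proof -
      have "(\<Sum>a\<in>I. vt a ^ 4 * (\<Sum>b\<in>I. vt (a + b) ^ 4)) \<le> (\<Sum>a\<in>I. vt a ^ 4 * vt_sum)"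
        by (intro sum_mono mult_left_mono s) auto
      also have "\<dots> = (\<Sum>a\<in>I. vt a ^ 4) * vt_sum" by (simp add: sum_distrib_right)
      also have "\<dots> \<le> vt_sum * vt_sum" using fin by (intro mult_right_mono sum_vt_le vt_sum_nonneg)
      finally show ?thesis .
    qed
    have t': "(\<Sum>b\<in>I. vt b ^ 4 * (\<Sum>a\<in>I. vt (a + b) ^ 4)) \<le> vt_sum * vt_sum"
      using t by (simp add: add.commute)
    show ?thesis using t t' vt_sum_nonneg by (intro mult_left_mono add_mono) auto
  qed
  also have "\<dots> = 64 * vt_sum ^ 3" by (simp add: power3_eq_cube)
  finally show ?thesis .
qed

lemma wt_gain:
  assumes "int N < \<bar>n\<bar>"
  shows "wt n powr (1 / 8) \<le> real (Suc N) powr (- 1 / 8)"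
proof -
  have "real (Suc N) \<le> 1 + \<bar>real_of_int n\<bar>" using assms by linarith
  then have "wt n \<le> inverse (real (Suc N))" by (simp add: wt_def field_simps)
  then have "wt n powr (1 / 8) \<le> inverse (real (Suc N)) powr (1 / 8)" by (intro powr_mono2) auto
  then show ?thesis by (simp add: powr_minus inverse_powr)
qed

text \<open>The reserve \<open>wt n powr (1 / 8)\<close> at an index beyond \<open>N\<close> provides the decay.\<close>

lemma sum_wt_quad_tail:
  assumes "finite Q" "\<And>a b c d. (a, b, c, d) \<in> Q \<Longrightarrow> a + b = c + d"
    and big: "\<And>a b c d. (a, b, c, d) \<in> Q \<Longrightarrow> int N < \<bar>a\<bar> \<or> int N < \<bar>b\<bar> \<or> int N < \<bar>c\<bar> \<or> int N < \<bar>d\<bar>"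
  shows "(\<Sum>q\<in>Q. wt_quad q) \<le> real (Suc N) powr (- 1 / 8) * (64 * vt_sum ^ 3)"
proof -
  have w: "wt n = vt n ^ 3 * wt n powr (1 / 8)" for n
    unfolding vt_power3 by (simp add: powr_add[symmetric])
  have u: "wt n powr (1 / 8) \<le> 1" "0 \<le> wt n powr (1 / 8)" for n
    using powr_mono2[of "1/8" "wt n" 1] by auto
  have "(\<Sum>q\<in>Q. wt_quad q) \<le> (\<Sum>q\<in>Q. real (Suc N) powr (- 1 / 8) * vt_quad q)"
  proof (rule sum_mono)
    fix q assume q: "q \<in> Q"
    obtain a b c d where [simp]: "q = (a, b, c, d)" by (cases q) auto
    let ?u = "\<lambda>n. wt n powr (1 / 8)"
    have m: "x * y \<le> x" "x * y \<le> y" "0 \<le> x * y" "x * y \<le> 1"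
      if "0 \<le> x" "x \<le> 1" "0 \<le> y" "y \<le> 1" for x y :: real
      using that mult_left_le[of y x] mult_left_le[of x y] by (auto simp: mult.commute intro: mult_le_one)
    have "?u a * ?u b * ?u c * ?u d \<le> real (Suc N) powr (- 1 / 8)"
    proof -
      note ab = m[OF u(2)[of a] u(1)[of a] u(2)[of b] u(1)[of b]]
      note abc = m[OF ab(3,4) u(2)[of c] u(1)[of c]]
      note abcd = m[OF abc(3,4) u(2)[of d] u(1)[of d]]
      have n1: "?u a * ?u b * ?u c * ?u d \<le> ?u a" and n2: "?u a * ?u b * ?u c * ?u d \<le> ?u b"
        and n3: "?u a * ?u b * ?u c * ?u d \<le> ?u c" and n4: "?u a * ?u b * ?u c * ?u d \<le> ?u d"
        using ab abc abcd by linarith+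
      consider "int N < \<bar>a\<bar>" | "int N < \<bar>b\<bar>" | "int N < \<bar>c\<bar>" | "int N < \<bar>d\<bar>" using big[of a b c d] q by auto
      then show ?thesis
        using wt_gain n1 n2 n3 n4 by cases (meson order_trans)+
    qed
    then have "vt_quad q * (?u a * ?u b * ?u c * ?u d) \<le> vt_quad q * real (Suc N) powr (- 1 / 8)"
      by (intro mult_left_mono) (auto simp: vt_quad_def)
    moreover have "wt_quad q = vt_quad q * (?u a * ?u b * ?u c * ?u d)"
      unfolding wt_quad_def vt_quad_def by simp (subst (1 2 3 4) w, simp)
    ultimately show "wt_quad q \<le> real (Suc N) powr (- 1 / 8) * vt_quad q"
      by (simp only: mult.commute)
  qed
  also have "\<dots> = real (Suc N) powr (- 1 / 8) * (\<Sum>q\<in>Q. vt_quad q)" by (simp add: sum_distrib_left)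
  also have "\<dots> \<le> real (Suc N) powr (- 1 / 8) * (64 * vt_sum ^ 3)"
    by (intro mult_left_mono sum_vt_quad_le assms) auto
  finally show ?thesis .
qed

lemma sum_wt_sq_tail:
  assumes "finite A" "\<And>n. n \<in> A \<Longrightarrow> int N < \<bar>n\<bar>"
  shows "(\<Sum>n\<in>A. (wt n)\<^sup>2) \<le> real (Suc N) powr (- 1 / 8) * vt_sum"
proof -
  have "(\<Sum>n\<in>A. (wt n)\<^sup>2) \<le> (\<Sum>n\<in>A. real (Suc N) powr (- 1 / 8) * vt n ^ 4)"
  proof (rule sum_mono)
    fix n assume "n \<in> A"
    have "(wt n)\<^sup>2 = wt n powr 2" by simp
    also have "\<dots> \<le> wt n powr (1 / 8 + 7 / 6)" by (intro powr_mono') auto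
    also have "\<dots> = wt n powr (1 / 8) * vt n ^ 4" by (simp only: powr_add vt_power4)
    also have "\<dots> \<le> real (Suc N) powr (- 1 / 8) * vt n ^ 4"
      using assms \<open>n \<in> A\<close> by (intro mult_right_mono wt_gain) auto
    finally show "(wt n)\<^sup>2 \<le> real (Suc N) powr (- 1 / 8) * vt n ^ 4" .
  qed
  also have "\<dots> = real (Suc N) powr (- 1 / 8) * (\<Sum>n\<in>A. vt n ^ 4)" by (simp add: sum_distrib_left)
  also have "\<dots> \<le> real (Suc N) powr (- 1 / 8) * vt_sum"
    using assms by (intro mult_left_mono sum_vt_le) auto
  finally show ?thesis .
qed

section \<open>Limits in $L^1$, in measure and in $L^p$\<close>

lemma ex_fast_subseq:
  fixes e :: "nat \<Rightarrow> real"
  assumes "e \<longlonglongrightarrow> 0"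
  obtains r where "strict_mono r" "\<And>k. e (r k) \<le> (1/2)^k"
proof -
  have ev: "\<exists>n>m. e n \<le> (1/2)^k" for k m :: nat
  proof -
    have "eventually (\<lambda>n. e n < (1/2)^k) sequentially"
      using order_tendstoD(2)[OF assms] by auto
    with eventually_gt_at_top[of m] have "eventually (\<lambda>n. n > m \<and> e n < (1/2)^k) sequentially"
      by (rule eventually_conj)
    then obtain n where "n > m" "e n < (1/2)^k" using eventually_happens'[OF sequentially_bot] by blast
    then show ?thesis by (intro exI[of _ n]) auto
  qed
  have "\<exists>r. \<forall>k. e (r k) \<le> (1/2)^k \<and> r k < r (Suc k)"
  proof (rule dependent_nat_choice)
    show "\<exists>n. e n \<le> (1/2) ^ 0" using ev by blast
    show "\<exists>n. e n \<le> (1/2) ^ Suc k \<and> m < n" for m k using ev by blast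
  qed
  then show ?thesis using that by (auto simp: strict_mono_Suc_iff)
qed

lemma (in prob_space) expectation_abs_le_sqrt:
  assumes [measurable]: "X \<in> borel_measurable M" and i: "integrable M (\<lambda>\<omega>. (X \<omega>)\<^sup>2)"
  shows "expectation (\<lambda>\<omega>. \<bar>X \<omega>\<bar>) \<le> sqrt (expectation (\<lambda>\<omega>. (X \<omega>)\<^sup>2))"
proof -
  have iX: "integrable M X" using square_integrable_imp_integrable[OF _ i] by simp
  have "(expectation (\<lambda>\<omega>. \<bar>X \<omega>\<bar>))\<^sup>2 \<le> expectation (\<lambda>\<omega>. \<bar>X \<omega>\<bar>\<^sup>2)"
    using variance_positive[of "\<lambda>\<omega>. \<bar>X \<omega>\<bar>"] variance_eq[of "\<lambda>\<omega>. \<bar>X \<omega>\<bar>"] iX i by simp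
  then show ?thesis by (intro real_le_rsqrt) simp
qed

lemma (in prob_space) markov_power:
  assumes [measurable]: "X \<in> borel_measurable M" and i: "integrable M (\<lambda>\<omega>. X \<omega> ^ m)"
    and nn: "\<And>\<omega>. 0 \<le> X \<omega> ^ m"
  shows "prob {\<omega> \<in> space M. 1 \<le> X \<omega>} \<le> expectation (\<lambda>\<omega>. X \<omega> ^ m)"
proof -
  have "prob {\<omega> \<in> space M. 1 \<le> X \<omega>} = expectation (indicator {\<omega> \<in> space M. 1 \<le> X \<omega>})" by simp
  also have "\<dots> \<le> expectation (\<lambda>\<omega>. X \<omega> ^ m)"
    by (intro integral_mono i integrable_const_bound[of _ 1]) (auto simp: indicator_def nn)
  finally show ?thesis .
qed

text \<open>Completeness of $L^1$: a subsequence with summable increments converges almost everywhere, and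
Fatou's lemma transfers the bounds to its limit.\<close>

lemma (in prob_space) L1_Cauchy_imp_limit:
  fixes X :: "nat \<Rightarrow> 'a \<Rightarrow> real"
  assumes int: "\<And>n. integrable M (X n)" and e: "e \<longlonglongrightarrow> 0"
    and cauchy: "\<And>m n. n \<le> m \<Longrightarrow> expectation (\<lambda>x. \<bar>X m x - X n x\<bar>) \<le> e n"
  obtains Y where "integrable M Y" "(\<lambda>n. expectation (\<lambda>x. \<bar>X n x - Y x\<bar>)) \<longlonglongrightarrow> 0"
proof -
  note [measurable] = borel_measurable_integrable[OF int]
  obtain r where r: "strict_mono r" "\<And>k. e (r k) \<le> (1/2)^k" using ex_fast_subseq[OF e] by blast
  have nn: "(\<integral>\<^sup>+x. ennreal \<bar>X m x - X n x\<bar> \<partial>M) \<le> ennreal (e n)" if "n \<le> m" for m n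
    using cauchy[OF that] int by (subst nn_integral_eq_integral) (auto intro: ennreal_leI)
  define Z where "Z k x = X (r (Suc k)) x - X (r k) x" for k x
  have [measurable]: "Z k \<in> borel_measurable M" for k unfolding Z_def by measurable
  have "(\<integral>\<^sup>+x. (\<Sum>k. ennreal \<bar>Z k x\<bar>) \<partial>M) = (\<Sum>k. \<integral>\<^sup>+x. ennreal \<bar>Z k x\<bar> \<partial>M)"
    by (rule nn_integral_suminf) measurable
  also have "\<dots> \<le> (\<Sum>k. ennreal ((1/2)^k))"
  proof (intro suminf_le allI)
    fix k
    have "(\<integral>\<^sup>+x. ennreal \<bar>Z k x\<bar> \<partial>M) \<le> ennreal (e (r k))"
      unfolding Z_def using r(1) by (intro nn) (auto simp: strict_mono_less_eq)
    also have "\<dots> \<le> ennreal ((1/2)^k)" by (intro ennreal_leI r)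
    finally show "(\<integral>\<^sup>+x. ennreal \<bar>Z k x\<bar> \<partial>M) \<le> ennreal ((1/2)^k)" .
  qed auto
  also have "\<dots> < top" by (subst suminf_ennreal2) (auto intro!: summable_geometric)
  finally have "AE x in M. (\<Sum>k. ennreal \<bar>Z k x\<bar>) \<noteq> \<infinity>"
    by (intro nn_integral_noteq_infinite) auto
  then have conv: "AE x in M. convergent (\<lambda>k. X (r k) x)"
  proof eventually_elim
    case (elim x)
    then have "summable (\<lambda>k. \<bar>Z k x\<bar>)" by (intro summable_suminf_not_top) auto
    then have "summable (\<lambda>k. Z k x)" by (rule summable_rabs_cancel)
    then have "convergent (\<lambda>n. \<Sum>k<n. Z k x)" by (simp add: summable_iff_convergent)
    then have "convergent (\<lambda>n. X (r n) x - X (r 0) x)"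
      using sum_lessThan_telescope[of "\<lambda>k. X (r k) x"] by (simp add: Z_def)
    from convergent_add[OF this convergent_const[of "X (r 0) x"]] show ?case by simp
  qed
  define Y where "Y x = lim (\<lambda>k. X (r k) x)" for x
  have [measurable]: "Y \<in> borel_measurable M" unfolding Y_def by measurable
  from conv have lim: "AE x in M. (\<lambda>k. X (r k) x) \<longlonglongrightarrow> Y x"
    unfolding Y_def by eventually_elim (simp add: convergent_LIMSEQ_iff)
  have bound: "(\<integral>\<^sup>+x. ennreal \<bar>X n x - Y x\<bar> \<partial>M) \<le> ennreal (e n)" for n
  proof -
    have "(\<integral>\<^sup>+x. ennreal \<bar>X n x - Y x\<bar> \<partial>M) = (\<integral>\<^sup>+x. liminf (\<lambda>k. ennreal \<bar>X (r k) x - X n x\<bar>) \<partial>M)"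
    proof (rule nn_integral_cong_AE)
      from lim show "AE x in M. ennreal \<bar>X n x - Y x\<bar> = liminf (\<lambda>k. ennreal \<bar>X (r k) x - X n x\<bar>)"
      proof eventually_elim
        case (elim x)
        then have "(\<lambda>k. ennreal \<bar>X (r k) x - X n x\<bar>) \<longlonglongrightarrow> ennreal \<bar>Y x - X n x\<bar>"
          by (intro tendsto_intros)
        from lim_imp_Liminf[OF _ this] show ?case by (simp add: abs_minus_commute)
      qed
    qed
    also have "\<dots> \<le> liminf (\<lambda>k. \<integral>\<^sup>+x. ennreal \<bar>X (r k) x - X n x\<bar> \<partial>M)"
      by (rule nn_integral_liminf) measurable
    also have "\<dots> \<le> limsup (\<lambda>k. \<integral>\<^sup>+x. ennreal \<bar>X (r k) x - X n x\<bar> \<partial>M)"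
      by (intro Liminf_le_Limsup) auto
    also have "\<dots> \<le> ennreal (e n)"
    proof (rule Limsup_bounded)
      show "\<forall>\<^sub>F k in sequentially. (\<integral>\<^sup>+x. ennreal \<bar>X (r k) x - X n x\<bar> \<partial>M) \<le> ennreal (e n)"
        using eventually_ge_at_top[of n]
      proof eventually_elim
        case (elim k)
        then have "n \<le> r k" using strict_mono_imp_increasing[OF r(1), of k] by linarith
        then show ?case by (rule nn)
      qed
    qed
    finally show ?thesis .
  qed
  have intd: "integrable M (\<lambda>x. X n x - Y x)" for n
  proof (rule integrableI_bounded)
    have "(\<integral>\<^sup>+x. ennreal (norm (X n x - Y x)) \<partial>M) \<le> ennreal (e n)" using bound[of n] by simp
    also have "\<dots> < \<infinity>" by simp
    finally show "(\<integral>\<^sup>+x. ennreal (norm (X n x - Y x)) \<partial>M) < \<infinity>" .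
  qed measurable
  have "integrable M Y"
    using Bochner_Integration.integrable_diff[OF int[of 0] intd[of 0]] by simp
  moreover have "expectation (\<lambda>x. \<bar>X n x - Y x\<bar>) \<le> max 0 (e n)" for n
  proof -
    have "ennreal (expectation (\<lambda>x. \<bar>X n x - Y x\<bar>)) = (\<integral>\<^sup>+x. ennreal \<bar>X n x - Y x\<bar> \<partial>M)"
      using intd[of n] by (subst nn_integral_eq_integral) auto
    also have "\<dots> \<le> ennreal (max 0 (e n))" 
      by (rule order_trans[OF bound ennreal_leI]) simp
    finally show ?thesis by (subst (asm) ennreal_le_iff) auto
  qed
  then have "(\<lambda>n. expectation (\<lambda>x. \<bar>X n x - Y x\<bar>)) \<longlonglongrightarrow> 0"
    by (intro tendsto_sandwich[OF _ _ tendsto_const tendsto_max[OF tendsto_const e, of 0, simplified]]) auto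
  ultimately show ?thesis by (rule that)
qed

text \<open>If the probabilities did not tend to zero, they would stay away from zero along a subsequence,
and almost everywhere convergence along a further subsequence contradicts this.\<close>

lemma (in prob_space) converges_in_measure_of_subsequences:
  fixes F :: "nat \<Rightarrow> 'a \<Rightarrow> real"
  assumes [measurable]: "\<And>n. F n \<in> borel_measurable M" "f \<in> borel_measurable M"
    and sub: "\<And>r. strict_mono (r :: nat \<Rightarrow> nat) \<Longrightarrow> \<exists>s::nat \<Rightarrow> nat. strict_mono s \<and> (AE x in M. (\<lambda>k. F (r (s k)) x) \<longlonglongrightarrow> f x)"
  shows "converges_in_measure M F f"
  unfolding converges_in_measure_def
proof (intro conjI allI impI)
  fix \<epsilon> :: real assume "\<epsilon> > 0"
  let ?p = "\<lambda>n. measure M {x \<in> space M. norm (F n x - f x) \<ge> \<epsilon>}"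
  show "?p \<longlonglongrightarrow> 0"
  proof (rule ccontr)
    assume "\<not> ?p \<longlonglongrightarrow> 0"
    then obtain \<delta> where "\<delta> > 0" and "\<not> (\<forall>\<^sub>F n in sequentially. dist (?p n) 0 < \<delta>)"
      unfolding tendsto_iff by blast
    then have \<delta>: "\<delta> > 0" "\<exists>\<^sub>F n in sequentially. \<delta> \<le> ?p n"
      by (auto simp: not_eventually not_less elim!: frequently_elim1)
    then have "\<exists>r::nat \<Rightarrow> nat. strict_mono r \<and> (\<forall>k. \<delta> \<le> ?p (r k))"
    proof -
      have inf: "infinite {n. \<delta> \<le> ?p n}" using \<delta>(2) by (simp add: frequently_cofinite[symmetric] cofinite_eq_sequentially)
      show ?thesis
        using infinite_enumerate[OF inf] by auto
    qed
    then obtain r :: "nat \<Rightarrow> nat" where r: "strict_mono r" "\<And>k. \<delta> \<le> ?p (r k)" by blast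
    from sub[OF r(1)] obtain s :: "nat \<Rightarrow> nat" where s: "strict_mono s" "AE x in M. (\<lambda>k. F (r (s k)) x) \<longlonglongrightarrow> f x" by blast
    have "(\<lambda>k. expectation (\<lambda>x. indicator {x \<in> space M. norm (F (r (s k)) x - f x) \<ge> \<epsilon>} x)) \<longlonglongrightarrow> expectation (\<lambda>x. 0::real)"
    proof (rule integral_dominated_convergence[where w="\<lambda>_. 1"])
      from s(2) show "AE x in M. (\<lambda>k. indicator {x \<in> space M. norm (F (r (s k)) x - f x) \<ge> \<epsilon>} x) \<longlonglongrightarrow> (0::real)"
      proof eventually_elim
        case (elim x)
        from tendstoD[OF this \<open>\<epsilon> > 0\<close>] have "\<forall>\<^sub>F k in sequentially. indicator {x \<in> space M. norm (F (r (s k)) x - f x) \<ge> \<epsilon>} x = (0::real)"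
          by eventually_elim (auto simp: indicator_def dist_real_def)
        then show ?case by (rule tendsto_eventually)
      qed
    qed (auto simp: indicator_def)
    then have "(\<lambda>k. ?p (r (s k))) \<longlonglongrightarrow> 0" by simp
    from tendsto_lowerbound[OF this always_eventually, of \<delta>] r(2) \<open>\<delta> > 0\<close> show False by simp
  qed
qed simp_all

lemma (in prob_space) converges_in_measure_AE_subseq:
  fixes F :: "nat \<Rightarrow> 'a \<Rightarrow> real"
  assumes "converges_in_measure M F f"
  obtains r :: "nat \<Rightarrow> nat" where "strict_mono r" "AE x in M. (\<lambda>k. F (r k) x) \<longlonglongrightarrow> f x"
proof -
  have [measurable]: "F n \<in> borel_measurable M" "f \<in> borel_measurable M" for n
    using assms by (auto simp: converges_in_measure_def)
  let ?u = "\<lambda>n x. min 1 \<bar>F n x - f x\<bar>"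
  have iu: "integrable M (?u n)" for n by (rule integrable_const_bound[of _ 1]) auto
  have "(\<lambda>n. expectation (\<lambda>x. norm (?u n x))) \<longlonglongrightarrow> 0"
  proof (rule LIMSEQ_I)
    fix \<epsilon> :: real assume "\<epsilon> > 0"
    then have "(\<lambda>n. measure M {x \<in> space M. norm (F n x - f x) \<ge> \<epsilon>/2}) \<longlonglongrightarrow> 0"
      using assms half_gt_zero unfolding converges_in_measure_def by blast
    from LIMSEQ_D[OF this, of "\<epsilon>/2"] \<open>\<epsilon> > 0\<close> obtain N where
      N: "\<And>n. n \<ge> N \<Longrightarrow> measure M {x \<in> space M. norm (F n x - f x) \<ge> \<epsilon>/2} < \<epsilon>/2" by auto
    show "\<exists>N. \<forall>n\<ge>N. norm (expectation (\<lambda>x. norm (?u n x)) - 0) < \<epsilon>"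
    proof (intro exI allI impI)
      fix n assume "n \<ge> N"
      let ?I = "\<lambda>x. indicator {x \<in> space M. norm (F n x - f x) \<ge> \<epsilon>/2} x :: real"
      have Ii: "integrable M ?I" by (rule integrable_const_bound[of _ 1]) auto
      have pt: "?u n x \<le> \<epsilon>/2 + ?I x" if "x \<in> space M" for x
        using \<open>\<epsilon> > 0\<close> that unfolding min_def indicator_def by (auto simp: not_le)
      have "expectation (?u n) \<le> expectation (\<lambda>x. \<epsilon>/2 + ?I x)"
        using Ii by (intro integral_mono iu pt) auto
      also have "\<dots> = \<epsilon>/2 + measure M {x \<in> space M. norm (F n x - f x) \<ge> \<epsilon>/2}"
        using Ii by (subst Bochner_Integration.integral_add) (auto simp: prob_space simp del: integrable_indicator_iff)
      also have "\<dots> < \<epsilon>" using N[OF \<open>n \<ge> N\<close>] by simp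
      finally show "norm (expectation (\<lambda>x. norm (?u n x)) - 0) < \<epsilon>"
        by (simp add: Bochner_Integration.integral_nonneg)
    qed
  qed
  from tendsto_L1_AE_subseq[OF iu this] obtain r where r: "strict_mono r" "AE x in M. (\<lambda>n. ?u (r n) x) \<longlonglongrightarrow> 0" by blast
  from r(2) have "AE x in M. (\<lambda>k. F (r k) x) \<longlonglongrightarrow> f x"
  proof eventually_elim
    case (elim x)
    have "\<forall>\<^sub>F n in sequentially. ?u (r n) x < 1" using order_tendstoD(2)[OF elim, of 1] by simp
    then have "\<forall>\<^sub>F n in sequentially. ?u (r n) x = \<bar>F (r n) x - f x\<bar>" by eventually_elim (auto simp: min_def)
    with elim have "(\<lambda>n. \<bar>F (r n) x - f x\<bar>) \<longlonglongrightarrow> 0" by (subst (asm) tendsto_cong)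
    then show ?case by (simp add: LIM_zero_cancel tendsto_rabs_zero_iff)
  qed
  with r(1) show ?thesis by (rule that)
qed

lemma (in prob_space) L1_limits_imp_converges_in_measure:
  fixes A F :: "nat \<Rightarrow> 'a \<Rightarrow> real" and \<Phi> :: "real \<Rightarrow> real \<Rightarrow> real"
  assumes A: "\<And>n. integrable M (A n)" "integrable M A'" "(\<lambda>n. expectation (\<lambda>x. \<bar>A n x - A' x\<bar>)) \<longlonglongrightarrow> 0"
    and F: "\<And>n. integrable M (F n)" "integrable M F'" "(\<lambda>n. expectation (\<lambda>x. \<bar>F n x - F' x\<bar>)) \<longlonglongrightarrow> 0"
    and \<Phi>: "continuous_on UNIV (\<lambda>(a, b). \<Phi> a b)"
  shows "converges_in_measure M (\<lambda>n x. \<Phi> (A n x) (F n x)) (\<lambda>x. \<Phi> (A' x) (F' x))"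
proof (rule converges_in_measure_of_subsequences)
  have \<Phi>m: "(\<lambda>(a, b). \<Phi> a b) \<in> borel_measurable borel"
    using \<Phi> by (rule borel_measurable_continuous_onI)
  have m: "(\<lambda>x. \<Phi> (u x) (v x)) \<in> borel_measurable M" if "u \<in> borel_measurable M" "v \<in> borel_measurable M" for u v
    using measurable_compose[OF borel_measurable_Pair[OF that] \<Phi>m] by simp
  show "(\<lambda>x. \<Phi> (A n x) (F n x)) \<in> borel_measurable M" for n
    using A F by (intro m) auto
  show "(\<lambda>x. \<Phi> (A' x) (F' x)) \<in> borel_measurable M"
    using A F by (intro m) auto
  fix r :: "nat \<Rightarrow> nat" assume r: "strict_mono r"
  let ?u = "\<lambda>n x. \<bar>A (r n) x - A' x\<bar> + \<bar>F (r n) x - F' x\<bar>"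
  have iu: "integrable M (?u n)" for n using A F by auto
  have "(\<lambda>n. expectation (\<lambda>x. \<bar>A n x - A' x\<bar>) + expectation (\<lambda>x. \<bar>F n x - F' x\<bar>)) \<longlonglongrightarrow> 0"
    using tendsto_add[OF A(3) F(3)] by simp
  from LIMSEQ_subseq_LIMSEQ[OF this r]
  have "(\<lambda>n. expectation (\<lambda>x. \<bar>A (r n) x - A' x\<bar>) + expectation (\<lambda>x. \<bar>F (r n) x - F' x\<bar>)) \<longlonglongrightarrow> 0" by (simp add: comp_def)
  then have "(\<lambda>n. expectation (?u n)) \<longlonglongrightarrow> 0"
    using A F by (subst Bochner_Integration.integral_add) auto
  then have "(\<lambda>n. expectation (\<lambda>x. norm (?u n x))) \<longlonglongrightarrow> 0" by simp
  from tendsto_L1_AE_subseq[OF iu this] obtain s :: "nat \<Rightarrow> nat" where s: "strict_mono s" "AE x in M. (\<lambda>n. ?u (s n) x) \<longlonglongrightarrow> 0" by blast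
  from s(2) have "AE x in M. (\<lambda>k. \<Phi> (A (r (s k)) x) (F (r (s k)) x)) \<longlonglongrightarrow> \<Phi> (A' x) (F' x)"
  proof eventually_elim
    case (elim x)
    have "(\<lambda>k. \<bar>A (r (s k)) x - A' x\<bar>) \<longlonglongrightarrow> 0" "(\<lambda>k. \<bar>F (r (s k)) x - F' x\<bar>) \<longlonglongrightarrow> 0"
      by (rule tendsto_sandwich[OF _ _ tendsto_const elim]; simp)+
    then have "(\<lambda>k. A (r (s k)) x) \<longlonglongrightarrow> A' x" "(\<lambda>k. F (r (s k)) x) \<longlonglongrightarrow> F' x"
      by (simp_all add: LIM_zero_cancel tendsto_rabs_zero_iff)
    from tendsto_Pair[OF this] have "(\<lambda>k. (A (r (s k)) x, F (r (s k)) x)) \<longlonglongrightarrow> (A' x, F' x)" .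
    from continuous_on_tendsto_compose[OF \<Phi> this] show ?case by simp
  qed
  with s(1) show "\<exists>s::nat \<Rightarrow> nat. strict_mono s \<and> (AE x in M. (\<lambda>k. \<Phi> (A (r (s k)) x) (F (r (s k)) x)) \<longlonglongrightarrow> \<Phi> (A' x) (F' x))" by blast
qed

lemma Lp_fun_1_imp_integrable:
  fixes f :: "'a \<Rightarrow> real"
  assumes "Lp_fun M 1 f"
  shows "integrable M f"
proof -
  have m: "f \<in> borel_measurable M" and "integrable M (\<lambda>x. norm (f x) powr 1)"
    using assms by (auto simp: Lp_fun_def)
  then have "integrable M (\<lambda>x. norm (f x))" by simp
  then show ?thesis using m by (rule integrable_norm_cancel)
qed

lemma powr_diff_le:
  fixes a b p :: real assumes "p > 0"
  shows "\<bar>a - b\<bar> powr p \<le> 2 powr p * (\<bar>a\<bar> powr p + \<bar>b\<bar> powr p)"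
proof -
  have "\<bar>a - b\<bar> powr p \<le> (2 * max \<bar>a\<bar> \<bar>b\<bar>) powr p" using assms by (intro powr_mono2) auto
  also have "\<dots> = 2 powr p * max \<bar>a\<bar> \<bar>b\<bar> powr p" by (simp add: powr_mult)
  also have "\<dots> \<le> 2 powr p * (\<bar>a\<bar> powr p + \<bar>b\<bar> powr p)" by (intro mult_left_mono) (auto simp: max_def)
  finally show ?thesis .
qed

text \<open>Vitali's theorem, with a bound on a higher moment in the role of uniform integrability. Fatou's lemma bounds
the higher moment of the limit. With $D = |F_n - f|$, the set where $D$ is small contributes little, and elsewhere
$D^p \le t D^{2p} + 1/t$, where the last term is multiplied by a probability that tends to zero.\<close>

lemma (in prob_space) converges_in_measure_imp_Lp:
  fixes F :: "nat \<Rightarrow> 'a \<Rightarrow> real"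
  assumes conv: "converges_in_measure M F f" and p: "p \<ge> 1"
    and K: "\<And>n. integrable M (\<lambda>x. \<bar>F n x\<bar> powr (2 * p))" "\<And>n. expectation (\<lambda>x. \<bar>F n x\<bar> powr (2 * p)) \<le> K"
  shows "converges_in_Lp M p F f"
proof -
  have [measurable]: "F n \<in> borel_measurable M" "f \<in> borel_measurable M" for n
    using conv by (auto simp: converges_in_measure_def)
  obtain r :: "nat \<Rightarrow> nat" where r: "strict_mono r" "AE x in M. (\<lambda>k. F (r k) x) \<longlonglongrightarrow> f x"
    using converges_in_measure_AE_subseq[OF conv] by blast
  have K0: "0 \<le> K" using K(2)[of 0] by (rule order_trans[rotated]) (auto intro!: Bochner_Integration.integral_nonneg)
  have nK: "(\<integral>\<^sup>+x. ennreal (\<bar>F n x\<bar> powr (2 * p)) \<partial>M) \<le> ennreal K" for n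
    using K(1)[of n] K(2)[of n] by (subst nn_integral_eq_integral) (auto intro: ennreal_leI)
  have fK: "(\<integral>\<^sup>+x. ennreal (\<bar>f x\<bar> powr (2 * p)) \<partial>M) \<le> ennreal K"
  proof -
    have "(\<integral>\<^sup>+x. ennreal (\<bar>f x\<bar> powr (2 * p)) \<partial>M) = (\<integral>\<^sup>+x. liminf (\<lambda>k. ennreal (\<bar>F (r k) x\<bar> powr (2 * p))) \<partial>M)"
    proof (rule nn_integral_cong_AE)
      from r(2) show "AE x in M. ennreal (\<bar>f x\<bar> powr (2 * p)) = liminf (\<lambda>k. ennreal (\<bar>F (r k) x\<bar> powr (2 * p)))"
      proof eventually_elim
        case (elim x)
        have "(\<lambda>k. ennreal (\<bar>F (r k) x\<bar> powr (2 * p))) \<longlonglongrightarrow> ennreal (\<bar>f x\<bar> powr (2 * p))"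
          using p by (intro tendsto_ennrealI tendsto_powr' tendsto_rabs elim tendsto_const) auto
        from lim_imp_Liminf[OF _ this] show ?case by simp
      qed
    qed
    also have "\<dots> \<le> liminf (\<lambda>k. \<integral>\<^sup>+x. ennreal (\<bar>F (r k) x\<bar> powr (2 * p)) \<partial>M)"
      by (rule nn_integral_liminf) measurable
    also have "\<dots> \<le> limsup (\<lambda>k. \<integral>\<^sup>+x. ennreal (\<bar>F (r k) x\<bar> powr (2 * p)) \<partial>M)"
      by (intro Liminf_le_Limsup) auto
    also have "\<dots> \<le> ennreal K" by (intro Limsup_bounded always_eventually allI nK)
    finally show ?thesis .
  qed
  have f2: "integrable M (\<lambda>x. \<bar>f x\<bar> powr (2 * p))"
  proof (rule integrableI_bounded)
    show "(\<integral>\<^sup>+x. ennreal (norm (\<bar>f x\<bar> powr (2 * p))) \<partial>M) < \<infinity>"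
      using fK by (simp add: order_le_less_trans[OF _ ennreal_less_top])
  qed measurable
  have Ef2: "expectation (\<lambda>x. \<bar>f x\<bar> powr (2 * p)) \<le> K"
    using fK K0 f2 by (subst (asm) nn_integral_eq_integral) auto
  have low: "integrable M (\<lambda>x. \<bar>u x\<bar> powr p)" if [measurable]: "u \<in> borel_measurable M" and "integrable M (\<lambda>x. \<bar>u x\<bar> powr (2 * p))" for u
  proof (rule Bochner_Integration.integrable_bound)
    show "integrable M (\<lambda>x. 1 + \<bar>u x\<bar> powr (2 * p))" using that by simp
    have "t powr p \<le> 1 + t powr (2 * p)" if "t \<ge> 0" for t :: real
    proof (cases "t \<le> 1")
      case True
      then have "t powr p \<le> 1" using that p by (simp add: powr_le1)
      then show ?thesis by (simp add: add_increasing2)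
    next
      case False
      then have "t powr p \<le> t powr (2 * p)" using p by (intro powr_mono) auto
      then show ?thesis by simp
    qed
    then show "AE x in M. norm (\<bar>u x\<bar> powr p) \<le> norm (1 + \<bar>u x\<bar> powr (2 * p))" by (auto simp: add_nonneg_nonneg)
  qed simp
  define D where "D n x = \<bar>F n x - f x\<bar>" for n x
  have [measurable]: "D n \<in> borel_measurable M" for n unfolding D_def by measurable
  have D0: "0 \<le> D n x" for n x by (simp add: D_def)
  define L where "L = 2 powr (2 * p) * (K + K)"
  have D2: "integrable M (\<lambda>x. D n x powr (2 * p))" "expectation (\<lambda>x. D n x powr (2 * p)) \<le> L" for n
  proof -
    have i: "integrable M (\<lambda>x. 2 powr (2 * p) * (\<bar>F n x\<bar> powr (2 * p) + \<bar>f x\<bar> powr (2 * p)))"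
      using K(1) f2 by auto
    have b: "D n x powr (2 * p) \<le> 2 powr (2 * p) * (\<bar>F n x\<bar> powr (2 * p) + \<bar>f x\<bar> powr (2 * p))" for x
      unfolding D_def using p by (intro powr_diff_le) auto
    show i': "integrable M (\<lambda>x. D n x powr (2 * p))"
      by (rule Bochner_Integration.integrable_bound[OF i]) (use b in \<open>auto intro!: AE_I2 order_trans[OF b]\<close>)
    have "expectation (\<lambda>x. D n x powr (2 * p)) \<le> expectation (\<lambda>x. 2 powr (2 * p) * (\<bar>F n x\<bar> powr (2 * p) + \<bar>f x\<bar> powr (2 * p)))"
      by (intro integral_mono i i' b)
    also have "\<dots> = 2 powr (2 * p) * (expectation (\<lambda>x. \<bar>F n x\<bar> powr (2 * p)) + expectation (\<lambda>x. \<bar>f x\<bar> powr (2 * p)))"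
      using K(1) f2 by simp
    also have "\<dots> \<le> L" unfolding L_def by (intro mult_left_mono add_mono K Ef2) auto
    finally show "expectation (\<lambda>x. D n x powr (2 * p)) \<le> L" .
  qed
  have D1: "integrable M (\<lambda>x. D n x powr p)" for n
    using low[of "D n"] D2(1)[of n] D0 by simp
  have L0: "0 \<le> L" using K0 by (simp add: L_def)
  have main: "(\<lambda>n. expectation (\<lambda>x. D n x powr p)) \<longlonglongrightarrow> 0"
  proof (rule LIMSEQ_I)
    fix \<epsilon> :: real assume \<epsilon>: "\<epsilon> > 0"
    define \<eta> where "\<eta> = (\<epsilon> / 3) powr (1 / p)"
    have \<eta>: "\<eta> > 0" "\<eta> powr p = \<epsilon> / 3" using \<epsilon> p by (auto simp: \<eta>_def powr_powr)
    \<comment> \<open>this \<open>t\<close> makes the higher moment contribute at most a third of \<open>\<epsilon>\<close>\<close>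
    define t where "t = \<epsilon> / (3 * (L + 1))"
    have t: "t > 0" "t * L \<le> \<epsilon> / 3"
      using \<epsilon> L0 by (auto simp: t_def field_simps)
    have "(\<lambda>n. measure M {x \<in> space M. norm (F n x - f x) \<ge> \<eta>}) \<longlonglongrightarrow> 0"
      using conv \<eta> by (simp add: converges_in_measure_def)
    from LIMSEQ_D[OF this, of "\<epsilon> / 3 * t"] \<epsilon> t obtain N where
      N: "\<And>n. n \<ge> N \<Longrightarrow> measure M {x \<in> space M. norm (F n x - f x) \<ge> \<eta>} < \<epsilon> / 3 * t" by auto
    show "\<exists>N. \<forall>n\<ge>N. norm (expectation (\<lambda>x. D n x powr p) - 0) < \<epsilon>"
    proof (intro exI allI impI)
      fix n assume n: "n \<ge> N"
      let ?I = "\<lambda>x. indicator {x \<in> space M. norm (F n x - f x) \<ge> \<eta>} x :: real"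
      have pt: "D n x powr p \<le> \<epsilon> / 3 + (t * D n x powr (2 * p) + 1 / t * ?I x)" if "x \<in> space M" for x
      proof (cases "D n x < \<eta>")
        case True
        then have "D n x powr p \<le> \<eta> powr p" using p D0 by (intro powr_mono2) auto
        moreover have "0 \<le> t * D n x powr (2 * p) + 1 / t * ?I x" using t by auto
        ultimately show ?thesis using \<eta>(2) by linarith
      next
        case False
        then have I: "?I x = 1" using that by (simp add: D_def indicator_def)
        let ?y = "D n x powr p"
        have sq: "D n x powr (2 * p) = ?y ^ 2" by (metis mult_2 power2_eq_square powr_add)
        have "?y \<le> t * ?y ^ 2 + 1 / t"
        proof -
          have "0 \<le> (t * ?y - 1) ^ 2" by simp
          then have "2 * t * ?y \<le> t * (t * ?y ^ 2) + 1" by (simp add: power2_eq_square algebra_simps)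
          moreover have "0 \<le> t * ?y" using t by auto
          ultimately have "t * ?y \<le> t * (t * ?y ^ 2) + 1" by linarith
          also have "\<dots> = t * (t * ?y ^ 2 + 1 / t)" using t by (simp add: distrib_left)
          finally show ?thesis using t by simp
        qed
        then show ?thesis using I sq \<epsilon> by simp
      qed
      have Ii: "integrable M ?I" by (rule integrable_const_bound[of _ 1]) auto
      have i2: "integrable M (\<lambda>x. t * D n x powr (2 * p) + 1 / t * ?I x)"
        using D2(1)[of n] Ii by (intro Bochner_Integration.integrable_add integrable_mult_right)
      have "expectation (\<lambda>x. D n x powr p) \<le> expectation (\<lambda>x. \<epsilon> / 3 + (t * D n x powr (2 * p) + 1 / t * ?I x))"
        using i2 by (intro integral_mono D1 pt) auto
      also have "\<dots> = \<epsilon> / 3 + expectation (\<lambda>x. t * D n x powr (2 * p) + 1 / t * ?I x)"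
        using i2 by (subst Bochner_Integration.integral_add) (auto simp: prob_space)
      also have "expectation (\<lambda>x. t * D n x powr (2 * p) + 1 / t * ?I x) =
          t * expectation (\<lambda>x. D n x powr (2 * p)) + 1 / t * measure M {x \<in> space M. norm (F n x - f x) \<ge> \<eta>}"
        using D2(1)[of n] Ii by (subst Bochner_Integration.integral_add) (auto simp del: integrable_indicator_iff)
      also have "\<epsilon> / 3 + \<dots> < \<epsilon>"
      proof -
        have "t * expectation (\<lambda>x. D n x powr (2 * p)) \<le> \<epsilon> / 3"
          using mult_left_mono[OF D2(2)[of n], of t] t by linarith
        moreover have "1 / t * measure M {x \<in> space M. norm (F n x - f x) \<ge> \<eta>} < \<epsilon> / 3"
          using N[OF n] t by (simp add: field_simps)
        ultimately show ?thesis by linarith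
      qed
      finally show "norm (expectation (\<lambda>x. D n x powr p) - 0) < \<epsilon>"
        by (simp add: abs_of_nonneg Bochner_Integration.integral_nonneg)
    qed
  qed
  have "(\<lambda>n. expectation (\<lambda>x. D n x powr p) powr (1 / p)) \<longlonglongrightarrow> 0 powr (1 / p)"
    using p by (intro tendsto_powr' main tendsto_const) (auto intro!: always_eventually Bochner_Integration.integral_nonneg)
  then have "(\<lambda>n. Lp_norm M p (\<lambda>x. F n x - f x)) \<longlonglongrightarrow> 0"
    unfolding Lp_norm_def D_def by simp
  then show ?thesis
    unfolding converges_in_Lp_def Lp_fun_def using low[OF _ K(1)] low[OF _ f2] by simp
qed

section \<open>The renormalised quartic energy\<close>

definition modes :: "nat \<Rightarrow> int set" where
  "modes N = {n. \<bar>n\<bar> \<le> int N}"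

lemma finite_modes [simp]: "finite (modes N)"
  by (rule finite_subset[of _ "{- int N..int N}"]) (auto simp: modes_def)

lemma modes_eq: "modes N = {- int N..int N}"
  by (auto simp: modes_def)

lemma modes_mono: "N \<le> M \<Longrightarrow> modes N \<subseteq> modes M"
  by (auto simp: modes_def)

definition resonant_free_quads :: "nat \<Rightarrow> quad set" where
  "resonant_free_quads N = {(a, b, c, d). a \<in> modes N \<and> b \<in> modes N \<and> c \<in> modes N \<and> d \<in> modes N \<and>
      a + b = c + d \<and> nonresonant (a, b, c, d)}"

lemma finite_resonant_free_quads [simp]: "finite (resonant_free_quads N)"
  by (rule finite_subset[of _ "modes N \<times> modes N \<times> modes N \<times> modes N"]) (auto simp: resonant_free_quads_def)

definition quad_coeff :: "quad \<Rightarrow> real" where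
  "quad_coeff q = sqrt (wt_quad q)"

definition chaos :: "nat \<Rightarrow> (int \<Rightarrow> complex) \<Rightarrow> complex" where
  "chaos N z = (\<Sum>q\<in>resonant_free_quads N. complex_of_real (quad_coeff q) * quad_monomial z q)"

text \<open>With $u_n = z_n (1 + |n|)^{-1/2}$, the quantity \<open>quartic N z - diagonal N z\<close> is
$\|u_N\|_{L^4}^4 - 2 \|u_N\|_{L^2}^4$, and \<open>mass N z\<close> is $\|u_N\|_{L^2}^2$.\<close>

definition quartic :: "nat \<Rightarrow> (int \<Rightarrow> complex) \<Rightarrow> real" where
  "quartic N z = Re (chaos N z)"

definition diagonal :: "nat \<Rightarrow> (int \<Rightarrow> complex) \<Rightarrow> real" where
  "diagonal N z = (\<Sum>n\<in>modes N. (wt n)\<^sup>2 * cmod (z n) ^ 4)"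

definition mass :: "nat \<Rightarrow> (int \<Rightarrow> complex) \<Rightarrow> real" where
  "mass N z = (\<Sum>n\<in>modes N. wt n * (cmod (z n))\<^sup>2)"

definition mean_mass :: "nat \<Rightarrow> real" where
  "mean_mass N = (\<Sum>n\<in>modes N. wt n)"

definition wick_mass :: "nat \<Rightarrow> (int \<Rightarrow> complex) \<Rightarrow> real" where
  "wick_mass N z = mass N z - mean_mass N"

definition energy :: "nat \<Rightarrow> (int \<Rightarrow> complex) \<Rightarrow> real" where
  "energy N z = quartic N z - diagonal N z"

lemma wt_quad_nonneg [simp]: "0 \<le> wt_quad q"
  by (auto simp: wt_quad_def split: prod.split)

lemma nonresonant_iff: "nonresonant (a, b, c, d) \<longleftrightarrow> a \<noteq> c \<and> a \<noteq> d \<and> b \<noteq> c \<and> b \<noteq> d"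
  by (auto simp: nonresonant_def plus_idx_def minus_idx_def all_bool_eq)

lemma quad_monomial_eq: "quad_monomial z (a, b, c, d) = z a * z b * cnj (z c) * cnj (z d)"
  by (simp add: quad_monomial_def plus_idx_def minus_idx_def UNIV_bool algebra_simps)

text \<open>Exchanging the two pairs of indices of a quadruple conjugates its monomial.\<close>

lemma chaos_real: "chaos N z = complex_of_real (quartic N z)"
proof -
  let ?sw = "\<lambda>(a, b, c, d). (c, d, a, b) :: quad"
  have bij: "bij_betw ?sw (resonant_free_quads N) (resonant_free_quads N)"
    by (rule bij_betw_byWitness[where f'="?sw"]) (auto simp: resonant_free_quads_def nonresonant_iff)
  have "cnj (chaos N z) = (\<Sum>q\<in>resonant_free_quads N. complex_of_real (quad_coeff (?sw q)) * quad_monomial z (?sw q))"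
    unfolding chaos_def cnj_sum
    by (intro sum.cong refl) (auto simp: quad_coeff_def wt_quad_def quad_monomial_eq mult_ac)
  also have "\<dots> = chaos N z"
    unfolding chaos_def by (rule sum.reindex_bij_betw[OF bij])
  finally show ?thesis
    unfolding quartic_def by (metis Reals_cnj_iff of_real_Re)
qed

lemma resonant_free_quads_mono: "N \<le> M \<Longrightarrow> resonant_free_quads N \<subseteq> resonant_free_quads M"
  using modes_mono by (fastforce simp: resonant_free_quads_def)

lemma mass_nonneg: "0 \<le> mass N z"
  by (auto simp: mass_def intro!: sum_nonneg)

lemma diagonal_mono: "N \<le> M \<Longrightarrow> diagonal N z \<le> diagonal M z"
  unfolding diagonal_def using modes_mono by (intro sum_mono2) auto

text \<open>The rate at which the tails beyond mode \<open>N\<close> of all three chaoses decrease.\<close>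

definition decay :: "nat \<Rightarrow> real" where
  "decay N = real (Suc N) powr (- 1 / 8)"

lemma decay_pos: "0 < decay N"
  by (simp add: decay_def)

lemma decay_tendsto: "decay \<longlonglongrightarrow> 0"
  unfolding decay_def
  by (rule tendsto_neg_powr[OF _ filterlim_compose[OF filterlim_real_sequentially filterlim_Suc]]) simp

lemma diagonal_tail_coeff: "(\<Sum>n\<in>modes M - modes N. (wt n)\<^sup>2) \<le> vt_sum * decay N"
proof -
  have "(\<Sum>n\<in>modes M - modes N. (wt n)\<^sup>2) \<le> decay N * vt_sum"
    unfolding decay_def
  proof (rule sum_wt_sq_tail)
    show "finite (modes M - modes N)" by simp
  qed (auto simp: modes_def not_le)
  then show ?thesis by (simp add: mult.commute)
qed

lemma quartic_tail_coeff:
  assumes "N \<le> M"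
  shows "(\<Sum>q\<in>resonant_free_quads M - resonant_free_quads N. (quad_coeff q)\<^sup>2) \<le> 64 * vt_sum ^ 3 * decay N"
proof -
  have "(\<Sum>q\<in>resonant_free_quads M - resonant_free_quads N. (quad_coeff q)\<^sup>2) = (\<Sum>q\<in>resonant_free_quads M - resonant_free_quads N. wt_quad q)"
    by (simp add: quad_coeff_def)
  also have "\<dots> \<le> decay N * (64 * vt_sum ^ 3)"
    unfolding decay_def
  proof (rule sum_wt_quad_tail)
    show "finite (resonant_free_quads M - resonant_free_quads N)" by simp
  qed (auto simp: resonant_free_quads_def modes_def not_le)
  finally show ?thesis by (simp add: mult.commute)
qed

lemma wick_mass_diff:
  assumes "N \<le> M"
  shows "wick_mass M z - wick_mass N z = (\<Sum>n\<in>modes M - modes N. wt n * ((cmod (z n))\<^sup>2 - 1))"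
proof -
  have "wick_mass M z - wick_mass N z = (mass M z - mass N z) - (mean_mass M - mean_mass N)"
    by (simp add: wick_mass_def)
  also have "mass M z - mass N z = (\<Sum>n\<in>modes M - modes N. wt n * (cmod (z n))\<^sup>2)"
    unfolding mass_def by (rule sum_diff[symmetric, OF _ modes_mono[OF assms]]) simp
  also have "mean_mass M - mean_mass N = (\<Sum>n\<in>modes M - modes N. wt n)"
    unfolding mean_mass_def by (rule sum_diff[symmetric, OF _ modes_mono[OF assms]]) simp
  finally show ?thesis by (simp add: sum_subtractf[symmetric] right_diff_distrib)
qed

context complex_gaussians
begin

abbreviation Z :: "'a \<Rightarrow> int \<Rightarrow> complex" where
  "Z \<omega> \<equiv> \<lambda>n. g n \<omega>"

lemma g_norm_moment:
  "integrable P (\<lambda>\<omega>. (cmod (g n \<omega>))\<^sup>2 ^ k)" "expectation (\<lambda>\<omega>. (cmod (g n \<omega>))\<^sup>2 ^ k) = fact k"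
proof -
  have e: "g n \<omega> ^ k * cnj (g n \<omega>) ^ k = complex_of_real ((cmod (g n \<omega>))\<^sup>2 ^ k)" for \<omega>
    by (simp only: power_mult_distrib[symmetric] complex_norm_square[symmetric] of_real_power)
  show "integrable P (\<lambda>\<omega>. (cmod (g n \<omega>))\<^sup>2 ^ k)"
    using moment_integrable[of n k k] unfolding e complex_of_real_integrable_eq .
  show "expectation (\<lambda>\<omega>. (cmod (g n \<omega>))\<^sup>2 ^ k) = fact k"
    using moment[of n k k] unfolding e integral_complex_of_real
    by (metis (mono_tags, lifting) of_real_eq_iff of_real_fact)
qed

lemma quartic_measurable [measurable]: "(\<lambda>\<omega>. quartic N (Z \<omega>)) \<in> borel_measurable P"
  unfolding quartic_def chaos_def quad_monomial_def by measurable

lemma diagonal_measurable [measurable]: "(\<lambda>\<omega>. diagonal N (Z \<omega>)) \<in> borel_measurable P"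
  unfolding diagonal_def by measurable

lemma mass_measurable [measurable]: "(\<lambda>\<omega>. mass N (Z \<omega>)) \<in> borel_measurable P"
  unfolding mass_def by measurable

lemma wick_mass_measurable [measurable]: "(\<lambda>\<omega>. wick_mass N (Z \<omega>)) \<in> borel_measurable P"
  unfolding wick_mass_def by measurable

lemma energy_measurable [measurable]: "(\<lambda>\<omega>. energy N (Z \<omega>)) \<in> borel_measurable P"
  unfolding energy_def by measurable

lemma quartic_diff_moment:
  assumes "N \<le> M"
  shows "integrable P (\<lambda>\<omega>. (quartic M (Z \<omega>) - quartic N (Z \<omega>)) ^ m)"
    and "expectation (\<lambda>\<omega>. (quartic M (Z \<omega>) - quartic N (Z \<omega>)) ^ (2 * k)) \<le> real (4 * k) ^ (4 * k) * (64 * vt_sum ^ 3 * decay N) ^ k"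
proof -
  let ?Q = "resonant_free_quads M - resonant_free_quads N"
  have fin: "finite ?Q" by simp
  have e: "complex_of_real (quartic M (Z \<omega>) - quartic N (Z \<omega>)) = (\<Sum>q\<in>?Q. complex_of_real (quad_coeff q) * quad_monomial (Z \<omega>) q)" for \<omega>
    unfolding of_real_diff chaos_real[symmetric] unfolding chaos_def
    by (rule sum_diff[symmetric, OF _ resonant_free_quads_mono[OF assms]]) simp
  have e': "complex_of_real ((quartic M (Z \<omega>) - quartic N (Z \<omega>)) ^ m) = (\<Sum>q\<in>?Q. complex_of_real (quad_coeff q) * quad_monomial (Z \<omega>) q) ^ m" for \<omega> m
    unfolding of_real_power e ..
  show "integrable P (\<lambda>\<omega>. (quartic M (Z \<omega>) - quartic N (Z \<omega>)) ^ m)" for m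
    using quad_chaos_integrable[OF fin, of quad_coeff m] unfolding e'[symmetric] complex_of_real_integrable_eq .
  have nr: "nonresonant q" if "q \<in> ?Q" for q
    using that by (auto simp: resonant_free_quads_def)
  have c0: "0 \<le> quad_coeff q" for q by (simp add: quad_coeff_def)
  have "norm (expectation (\<lambda>\<omega>. complex_of_real ((quartic M (Z \<omega>) - quartic N (Z \<omega>)) ^ (2 * k))))
      \<le> real (2 * (2 * k)) ^ (2 * (2 * k)) * sqrt (\<Sum>q\<in>?Q. (quad_coeff q)\<^sup>2) ^ (2 * k)"
    unfolding e' by (rule quad_chaos_moment[OF fin nr c0])
  then have "expectation (\<lambda>\<omega>. (quartic M (Z \<omega>) - quartic N (Z \<omega>)) ^ (2 * k))
      \<le> real (4 * k) ^ (4 * k) * (sqrt (\<Sum>q\<in>?Q. (quad_coeff q)\<^sup>2) ^ 2) ^ k"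
    unfolding integral_complex_of_real norm_of_real power_mult by (simp add: abs_le_iff)
  also have "sqrt (\<Sum>q\<in>?Q. (quad_coeff q)\<^sup>2) ^ 2 = (\<Sum>q\<in>?Q. (quad_coeff q)\<^sup>2)"
    by (simp add: sum_nonneg)
  also have "real (4 * k) ^ (4 * k) * \<dots> ^ k \<le> real (4 * k) ^ (4 * k) * (64 * vt_sum ^ 3 * decay N) ^ k"
    by (intro mult_left_mono power_mono quartic_tail_coeff assms) (auto intro: sum_nonneg)
  finally show "expectation (\<lambda>\<omega>. (quartic M (Z \<omega>) - quartic N (Z \<omega>)) ^ (2 * k)) \<le> real (4 * k) ^ (4 * k) * (64 * vt_sum ^ 3 * decay N) ^ k" .
qed

lemma quartic_integrable: "integrable P (\<lambda>\<omega>. quartic N (Z \<omega>))"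
proof -
  have "integrable P (\<lambda>\<omega>. (\<Sum>q\<in>resonant_free_quads N. complex_of_real (quad_coeff q) * quad_monomial (Z \<omega>) q) ^ 1)"
    by (rule quad_chaos_integrable) simp
  then show ?thesis
    unfolding power_one_right chaos_def[symmetric] chaos_real complex_of_real_integrable_eq .
qed

lemma diagonal_diff_moment:
  assumes "N \<le> M"
  shows "integrable P (\<lambda>\<omega>. (diagonal M (Z \<omega>) - diagonal N (Z \<omega>)) ^ m)"
    and "expectation (\<lambda>\<omega>. (diagonal M (Z \<omega>) - diagonal N (Z \<omega>)) ^ m) \<le> real (2 * m) ^ (2 * m) * (vt_sum * decay N) ^ m"
proof -
  have e: "diagonal M z - diagonal N z = (\<Sum>n\<in>modes M - modes N. (wt n)\<^sup>2 * cmod (z n) ^ 4)" for z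
    unfolding diagonal_def by (rule sum_diff[symmetric, OF _ modes_mono[OF assms]]) simp
  show "integrable P (\<lambda>\<omega>. (diagonal M (Z \<omega>) - diagonal N (Z \<omega>)) ^ m)"
    unfolding e by (rule quartic_sum_moment) auto
  have "expectation (\<lambda>\<omega>. (diagonal M (Z \<omega>) - diagonal N (Z \<omega>)) ^ m) \<le> real (2 * m) ^ (2 * m) * (\<Sum>n\<in>modes M - modes N. (wt n)\<^sup>2) ^ m"
    unfolding e by (rule quartic_sum_moment) auto
  also have "\<dots> \<le> real (2 * m) ^ (2 * m) * (vt_sum * decay N) ^ m"
  proof (intro mult_left_mono power_mono)
    show "(\<Sum>n\<in>modes M - modes N. (wt n)\<^sup>2) \<le> vt_sum * decay N"
      by (rule diagonal_tail_coeff)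
  qed (auto intro: sum_nonneg)
  finally show "expectation (\<lambda>\<omega>. (diagonal M (Z \<omega>) - diagonal N (Z \<omega>)) ^ m) \<le> real (2 * m) ^ (2 * m) * (vt_sum * decay N) ^ m" .
qed

lemma diagonal_integrable: "integrable P (\<lambda>\<omega>. diagonal N (Z \<omega>))"
  using quartic_sum_moment(1)[of "modes N" "\<lambda>n. (wt n)\<^sup>2" 1] by (simp add: diagonal_def)

lemma mass_integrable: "integrable P (\<lambda>\<omega>. mass N (Z \<omega>))"
  unfolding mass_def using g_norm_moment(1)[of _ 1] by auto

lemma expectation_mass: "expectation (\<lambda>\<omega>. mass N (Z \<omega>)) = mean_mass N"
  unfolding mass_def mean_mass_def
  using g_norm_moment[of _ 1] by (subst Bochner_Integration.integral_sum) auto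

lemma wick_mass_integrable: "integrable P (\<lambda>\<omega>. wick_mass N (Z \<omega>))"
  unfolding wick_mass_def using mass_integrable by auto

lemma centred_covariance:
  "integrable P (\<lambda>\<omega>. ((cmod (g n \<omega>))\<^sup>2 - 1) * ((cmod (g m \<omega>))\<^sup>2 - 1))"
  "expectation (\<lambda>\<omega>. ((cmod (g n \<omega>))\<^sup>2 - 1) * ((cmod (g m \<omega>))\<^sup>2 - 1)) = (if n = m then 1 else 0)"
proof -
  let ?X = "\<lambda>n \<omega>. (cmod (g n \<omega>))\<^sup>2 - 1"
  have i1: "integrable P (?X n)" for n using g_norm_moment(1)[of n 1] by auto
  have e1: "expectation (?X n) = 0" for n
    using g_norm_moment[of n 1] by (simp add: prob_space)
  have sq: "?X n \<omega> * ?X n \<omega> = (cmod (g n \<omega>))\<^sup>2 ^ 2 - 2 * (cmod (g n \<omega>))\<^sup>2 ^ 1 + 1" for n \<omega>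
    by (simp add: power2_eq_square algebra_simps)
  have "integrable P (\<lambda>\<omega>. ?X n \<omega> * ?X m \<omega>) \<and> expectation (\<lambda>\<omega>. ?X n \<omega> * ?X m \<omega>) = (if n = m then 1 else 0)"
  proof (cases "n = m")
    case True
    have i: "integrable P (\<lambda>\<omega>. (cmod (g m \<omega>))\<^sup>2 ^ 2 - 2 * (cmod (g m \<omega>))\<^sup>2 ^ 1)"
      by (intro Bochner_Integration.integrable_diff integrable_mult_right g_norm_moment)
    have "expectation (\<lambda>\<omega>. ?X m \<omega> * ?X m \<omega>) = 1"
      unfolding sq using i
      by (subst Bochner_Integration.integral_add, simp, simp, subst Bochner_Integration.integral_diff)
         (auto simp only: g_norm_moment integral_mult_right_zero prob_space integrable_mult_right lebesgue_integral_const, simp_all add: g_norm_moment[of _ 1, simplified] g_norm_moment prob_space)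
    moreover have "integrable P (\<lambda>\<omega>. ?X m \<omega> * ?X m \<omega>)"
      unfolding sq using i by (rule Bochner_Integration.integrable_add) simp
    ultimately show ?thesis using True by simp
  next
    case False
    have ind: "indep_vars (\<lambda>_. borel) ?X {n, m}"
      by (rule indep_vars_compose2[OF indep_vars_subset[OF indep], where Y="\<lambda>_ z. (cmod z)\<^sup>2 - 1"]) auto
    have "(\<lambda>\<omega>. ?X n \<omega> * ?X m \<omega>) = (\<lambda>\<omega>. \<Prod>i\<in>{n, m}. ?X i \<omega>)" using False by simp
    then show ?thesis
      using False indep_vars_lebesgue_integral[OF _ ind i1] indep_vars_integrable[OF _ ind i1] e1 by simp
  qed
  then show "integrable P (\<lambda>\<omega>. ?X n \<omega> * ?X m \<omega>)" "expectation (\<lambda>\<omega>. ?X n \<omega> * ?X m \<omega>) = (if n = m then 1 else 0)" by auto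
qed

lemma wick_mass_diff_L2:
  assumes "N \<le> M"
  shows "integrable P (\<lambda>\<omega>. (wick_mass M (Z \<omega>) - wick_mass N (Z \<omega>))\<^sup>2)"
    and "expectation (\<lambda>\<omega>. (wick_mass M (Z \<omega>) - wick_mass N (Z \<omega>))\<^sup>2) \<le> vt_sum * decay N"
proof -
  let ?X = "\<lambda>n \<omega>. (cmod (g n \<omega>))\<^sup>2 - 1" and ?B = "modes M - modes N"
  have e: "(wick_mass M (Z \<omega>) - wick_mass N (Z \<omega>))\<^sup>2 = (\<Sum>n\<in>?B. \<Sum>m\<in>?B. wt n * wt m * (?X n \<omega> * ?X m \<omega>))" for \<omega>
    unfolding wick_mass_diff[OF assms] power2_eq_square sum_product by (simp add: mult_ac)
  show "integrable P (\<lambda>\<omega>. (wick_mass M (Z \<omega>) - wick_mass N (Z \<omega>))\<^sup>2)"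
    unfolding e by (intro Bochner_Integration.integrable_sum integrable_mult_right centred_covariance)
  have "expectation (\<lambda>\<omega>. (wick_mass M (Z \<omega>) - wick_mass N (Z \<omega>))\<^sup>2) = (\<Sum>n\<in>?B. \<Sum>m\<in>?B. wt n * wt m * (if n = m then 1 else 0))"
    unfolding e
    by (subst Bochner_Integration.integral_sum, intro Bochner_Integration.integrable_sum integrable_mult_right centred_covariance,
        intro sum.cong refl, subst Bochner_Integration.integral_sum, intro integrable_mult_right centred_covariance)
       (simp only: integral_mult_right_zero centred_covariance)
  also have "\<dots> = (\<Sum>n\<in>?B. (wt n)\<^sup>2)"
    by (intro sum.cong refl) (simp add: sum.delta power2_eq_square if_distrib[where f="\<lambda>x. _ * x"] cong: if_cong)
  also have "\<dots> \<le> vt_sum * decay N"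
    by (rule diagonal_tail_coeff)
  finally show "expectation (\<lambda>\<omega>. (wick_mass M (Z \<omega>) - wick_mass N (Z \<omega>))\<^sup>2) \<le> vt_sum * decay N" .
qed

lemma wick_mass_L1_limit:
  obtains A where "integrable P A" "(\<lambda>N. expectation (\<lambda>\<omega>. \<bar>wick_mass N (Z \<omega>) - A \<omega>\<bar>)) \<longlonglongrightarrow> 0"
proof (rule L1_Cauchy_imp_limit)
  show "(\<lambda>N. sqrt (vt_sum * decay N)) \<longlonglongrightarrow> 0"
    using tendsto_real_sqrt[OF tendsto_mult_right_zero[OF decay_tendsto, of vt_sum]] by simp
  show "expectation (\<lambda>\<omega>. \<bar>wick_mass M (Z \<omega>) - wick_mass N (Z \<omega>)\<bar>) \<le> sqrt (vt_sum * decay N)" if "N \<le> M" for M N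
    using expectation_abs_le_sqrt[OF _ wick_mass_diff_L2(1)[OF that]] real_sqrt_le_mono[OF wick_mass_diff_L2(2)[OF that]]
    by (rule order_trans) simp_all
qed (rule wick_mass_integrable, rule that)

lemma energy_integrable: "integrable P (\<lambda>\<omega>. energy N (Z \<omega>))"
  unfolding energy_def by (intro Bochner_Integration.integrable_diff quartic_integrable diagonal_integrable)

lemma energy_L1_limit:
  obtains F where "integrable P F" "(\<lambda>N. expectation (\<lambda>\<omega>. \<bar>energy N (Z \<omega>) - F \<omega>\<bar>)) \<longlonglongrightarrow> 0"
proof (rule L1_Cauchy_imp_limit)
  let ?e = "\<lambda>N. sqrt (256 * (64 * vt_sum ^ 3 * decay N)) + 4 * (vt_sum * decay N)"
  show "?e \<longlonglongrightarrow> 0"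
  proof -
    have "(\<lambda>N. 256 * (64 * vt_sum ^ 3 * decay N)) \<longlonglongrightarrow> 0" "(\<lambda>N. 4 * (vt_sum * decay N)) \<longlonglongrightarrow> 0"
      by (intro tendsto_mult_right_zero decay_tendsto)+
    from tendsto_add[OF tendsto_real_sqrt[OF this(1)] this(2)] show ?thesis by simp
  qed
  show "expectation (\<lambda>\<omega>. \<bar>energy M (Z \<omega>) - energy N (Z \<omega>)\<bar>) \<le> ?e N" if NM: "N \<le> M" for M N
  proof -
    let ?q = "\<lambda>\<omega>. quartic M (Z \<omega>) - quartic N (Z \<omega>)" and ?d = "\<lambda>\<omega>. diagonal M (Z \<omega>) - diagonal N (Z \<omega>)"
    have iq: "integrable P ?q" by (intro Bochner_Integration.integrable_diff quartic_integrable)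
    have id: "integrable P ?d" by (intro Bochner_Integration.integrable_diff diagonal_integrable)
    have "expectation (\<lambda>\<omega>. \<bar>energy M (Z \<omega>) - energy N (Z \<omega>)\<bar>) \<le> expectation (\<lambda>\<omega>. \<bar>?q \<omega>\<bar> + ?d \<omega>)"
    proof (rule integral_mono)
      show "integrable P (\<lambda>\<omega>. \<bar>energy M (Z \<omega>) - energy N (Z \<omega>)\<bar>)"
        using energy_integrable[of M] energy_integrable[of N] by simp
      show "integrable P (\<lambda>\<omega>. \<bar>?q \<omega>\<bar> + ?d \<omega>)" by (intro Bochner_Integration.integrable_add integrable_abs iq id)
      show "\<bar>energy M (Z \<omega>) - energy N (Z \<omega>)\<bar> \<le> \<bar>?q \<omega>\<bar> + ?d \<omega>" for \<omega>
        using diagonal_mono[OF NM, of "Z \<omega>"] unfolding energy_def by linarith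
    qed
    also have "\<dots> = expectation (\<lambda>\<omega>. \<bar>?q \<omega>\<bar>) + expectation ?d"
      by (intro Bochner_Integration.integral_add integrable_abs iq id)
    also have "expectation (\<lambda>\<omega>. \<bar>?q \<omega>\<bar>) \<le> sqrt (256 * (64 * vt_sum ^ 3 * decay N))"
    proof (rule order_trans[OF expectation_abs_le_sqrt real_sqrt_le_mono])
      show "expectation (\<lambda>\<omega>. (?q \<omega>)\<^sup>2) \<le> 256 * (64 * vt_sum ^ 3 * decay N)"
        using quartic_diff_moment(2)[OF NM, of 1] by simp
    qed (auto intro: quartic_diff_moment(1)[OF NM])
    also have "expectation ?d \<le> 4 * (vt_sum * decay N)"
      using diagonal_diff_moment(2)[OF NM, of 1] by simp
    finally show ?thesis by simp
  qed
qed (rule energy_integrable, rule that)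

end

section \<open>Lebesgue norms of trigonometric polynomials\<close>

definition circle_mode :: "int \<Rightarrow> real \<Rightarrow> complex" where
  "circle_mode n x = exp (\<i> * of_int n * of_real x)"

lemma circle_measure_density: "circle_measure = density lborel (\<lambda>x. ennreal (indicator {0..<2 * pi} x / (2 * pi)))"
proof -
  have "emeasure lborel {0..<2 * pi} = ennreal (2 * pi)" by simp
  moreover have "indicator {0..<2 * pi} x / ennreal (2 * pi) = ennreal (indicator {0..<2 * pi} x / (2 * pi))" for x :: real
    by (auto simp: indicator_def divide_ennreal ennreal_1[symmetric] simp del: ennreal_1)
  ultimately show ?thesis
    unfolding circle_measure_def uniform_measure_def by simp
qed

lemma prob_space_circle: "prob_space circle_measure"
  unfolding circle_measure_def by (rule prob_space_uniform_measure) auto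

lemma sets_circle [simp, measurable_cong]: "sets circle_measure = sets borel"
  by (simp add: circle_measure_density)

lemma circle_mode_measurable [measurable]: "circle_mode n \<in> borel_measurable borel"
  unfolding circle_mode_def by (intro borel_measurable_continuous_onI continuous_intros)

lemma norm_circle_mode: "norm (circle_mode n x) = 1"
  by (simp add: circle_mode_def norm_exp_eq_Re)

lemma circle_mode_mult: "circle_mode n x * circle_mode m x = circle_mode (n + m) x"
  by (simp add: circle_mode_def exp_add[symmetric] algebra_simps)

lemma circle_mode_cnj: "cnj (circle_mode n x) = circle_mode (- n) x"
  by (simp add: circle_mode_def exp_cnj)

lemma integrable_circle_mode: "integrable circle_measure (circle_mode n)"
proof -
  interpret prob_space circle_measure by (rule prob_space_circle)
  show ?thesis by (rule integrable_const_bound[of _ 1]) (auto simp: norm_circle_mode)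
qed

lemma integral_circle_mode: "(LINT x|circle_measure. circle_mode n x) = (if n = 0 then 1 else 0)"
proof (cases "n = 0")
  case True
  interpret prob_space circle_measure by (rule prob_space_circle)
  show ?thesis using True by (simp add: circle_mode_def prob_space)
next
  case False
  define F where "F x = circle_mode n x / (\<i> * of_int n)" for x
  have "(LINT x|circle_measure. circle_mode n x) = (LINT x|lborel. (indicator {0..<2 * pi} x / (2 * pi)) *\<^sub>R circle_mode n x)"
    unfolding circle_measure_density by (rule integral_density) auto
  also have "\<dots> = (LINT x|lborel. (1 / (2 * pi)) *\<^sub>R (indicator {0..2 * pi} x *\<^sub>R circle_mode n x))"
    using AE_lborel_singleton[of "2 * pi"]
    by (intro integral_cong_AE) (auto simp: indicator_def elim!: eventually_mono)
  also have "\<dots> = (1 / (2 * pi)) *\<^sub>R (LINT x|lborel. indicator {0..2 * pi} x *\<^sub>R circle_mode n x)"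
    by (rule integral_scaleR_right) 
  also have "(LINT x|lborel. indicator {0..2 * pi} x *\<^sub>R circle_mode n x) = F (2 * pi) - F 0"
  proof (rule integral_FTC_Icc)
    show "continuous_on {0..2 * pi} (circle_mode n)" unfolding circle_mode_def by (intro continuous_intros)
    fix x :: real
    have "((\<lambda>z. exp (\<i> * of_int n * z) / (\<i> * of_int n)) has_field_derivative exp (\<i> * of_int n * of_real x)) (at (of_real x))"
      using False by (auto intro!: derivative_eq_intros)
    from has_vector_derivative_real_field[OF this]
    show "(F has_vector_derivative circle_mode n x) (at x within {0..2 * pi})"
      by (simp add: F_def[abs_def] circle_mode_def)
  qed simp
  also have "F (2 * pi) = F 0"
  proof -
    have "circle_mode n (2 * pi) = exp (2 * of_int n * of_real pi * \<i>)" by (simp add: circle_mode_def algebra_simps)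
    also have "\<dots> = 1" unfolding exp_eq_1 by (auto intro!: exI[of _ n])
    finally show ?thesis by (simp add: F_def) (simp add: circle_mode_def)
  qed
  finally show ?thesis using False by simp
qed

lemma fourier_proj_eq: "fourier_proj N u x = (\<Sum>n\<in>modes N. u n * circle_mode n x)"
  by (simp add: fourier_proj_def modes_def circle_mode_def)

lemma fourier_proj_measurable [measurable]: "fourier_proj N u \<in> borel_measurable borel"
  unfolding fourier_proj_eq[abs_def] by measurable

lemma norm_fourier_proj_sq:
  "complex_of_real ((cmod (fourier_proj N u x))\<^sup>2) = (\<Sum>(n, m)\<in>modes N \<times> modes N. u n * cnj (u m) * circle_mode (n - m) x)"
proof -
  have "complex_of_real ((cmod (fourier_proj N u x))\<^sup>2) = (\<Sum>n\<in>modes N. u n * circle_mode n x) * (\<Sum>m\<in>modes N. cnj (u m * circle_mode m x))"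
    by (simp only: complex_norm_square fourier_proj_eq cnj_sum)
  also have "\<dots> = (\<Sum>(n, m)\<in>modes N \<times> modes N. (u n * circle_mode n x) * cnj (u m * circle_mode m x))"
    by (simp only: sum_product sum.cartesian_product)
  also have "\<dots> = (\<Sum>(n, m)\<in>modes N \<times> modes N. u n * cnj (u m) * circle_mode (n - m) x)"
  proof (intro sum.cong refl, clarify)
    fix n m
    have "(u n * circle_mode n x) * cnj (u m * circle_mode m x) = u n * cnj (u m) * (circle_mode n x * circle_mode (- m) x)"
      by (simp add: circle_mode_cnj)
    then show "(u n * circle_mode n x) * cnj (u m * circle_mode m x) = u n * cnj (u m) * circle_mode (n - m) x"
      by (simp add: circle_mode_mult)
  qed
  finally show ?thesis .
qed

lemma integral_norm_sq:
  "(LINT x|circle_measure. (cmod (fourier_proj N u x))\<^sup>2) = (\<Sum>n\<in>modes N. (cmod (u n))\<^sup>2)"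
proof -
  have "complex_of_real (LINT x|circle_measure. (cmod (fourier_proj N u x))\<^sup>2) = (LINT x|circle_measure. complex_of_real ((cmod (fourier_proj N u x))\<^sup>2))"
    by (rule integral_complex_of_real[symmetric])
  also have "\<dots> = (\<Sum>(n, m)\<in>modes N \<times> modes N. u n * cnj (u m) * (if n = m then 1 else 0))"
    unfolding norm_fourier_proj_sq split_def
    by (subst Bochner_Integration.integral_sum) (auto intro!: integrable_mult_right integrable_circle_mode simp: integral_circle_mode)
  also have "\<dots> = (\<Sum>n\<in>modes N. \<Sum>m\<in>modes N. u n * cnj (u m) * (if n = m then 1 else 0))"
    by (rule sum.cartesian_product[symmetric])
  also have "\<dots> = (\<Sum>n\<in>modes N. u n * cnj (u n))"
    by (intro sum.cong refl) (simp add: if_distrib[where f="\<lambda>x. _ * x"] cong: if_cong)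
  also have "\<dots> = complex_of_real (\<Sum>n\<in>modes N. (cmod (u n))\<^sup>2)"
    by (simp only: complex_norm_square[symmetric] of_real_sum)
  finally show ?thesis by (simp only: of_real_eq_iff)
qed

definition quad_term :: "(int \<Rightarrow> complex) \<Rightarrow> quad \<Rightarrow> complex" where
  "quad_term u = (\<lambda>(a, b, c, d). u a * u b * cnj (u c) * cnj (u d))"

definition balanced_quads :: "nat \<Rightarrow> quad set" where
  "balanced_quads N = {(a, b, c, d). a \<in> modes N \<and> b \<in> modes N \<and> c \<in> modes N \<and> d \<in> modes N \<and> a + b = c + d}"

lemma integral_norm_fourth:
  "complex_of_real (LINT x|circle_measure. cmod (fourier_proj N u x) ^ 4) = (\<Sum>q\<in>balanced_quads N. quad_term u q)"
proof -
  let ?B = "modes N \<times> modes N"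
  have e: "complex_of_real (cmod (fourier_proj N u x) ^ 4) =
     (\<Sum>p\<in>?B \<times> ?B. u (fst (fst p)) * cnj (u (snd (fst p))) * (u (fst (snd p)) * cnj (u (snd (snd p)))) * circle_mode ((fst (fst p) - snd (fst p)) + (fst (snd p) - snd (snd p))) x)" for x
  proof -
    have "complex_of_real (cmod (fourier_proj N u x) ^ 4) = complex_of_real ((cmod (fourier_proj N u x))\<^sup>2) * complex_of_real ((cmod (fourier_proj N u x))\<^sup>2)"
      by (simp add: power_add[symmetric])
    also have "\<dots> = (\<Sum>p\<in>?B \<times> ?B. (u (fst (fst p)) * cnj (u (snd (fst p))) * circle_mode (fst (fst p) - snd (fst p)) x)
         * (u (fst (snd p)) * cnj (u (snd (snd p))) * circle_mode (fst (snd p) - snd (snd p)) x))"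
      unfolding norm_fourier_proj_sq sum_product sum.cartesian_product by (simp only: split_def)
    finally show ?thesis by (simp only: circle_mode_mult[symmetric] mult_ac)
  qed
  have "complex_of_real (LINT x|circle_measure. cmod (fourier_proj N u x) ^ 4) = (LINT x|circle_measure. complex_of_real (cmod (fourier_proj N u x) ^ 4))"
    by (rule integral_complex_of_real[symmetric])
  also have "\<dots> = (\<Sum>p\<in>?B \<times> ?B. u (fst (fst p)) * cnj (u (snd (fst p))) * (u (fst (snd p)) * cnj (u (snd (snd p)))) *
      (if (fst (fst p) - snd (fst p)) + (fst (snd p) - snd (snd p)) = 0 then 1 else 0))"
    unfolding e
    by (subst Bochner_Integration.integral_sum, intro integrable_mult_right integrable_circle_mode)
       (simp only: integral_mult_right_zero integral_circle_mode)
  also have "\<dots> = (\<Sum>p | p \<in> ?B \<times> ?B \<and> (fst (fst p) - snd (fst p)) + (fst (snd p) - snd (snd p)) = 0.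
      u (fst (fst p)) * cnj (u (snd (fst p))) * (u (fst (snd p)) * cnj (u (snd (snd p)))))"
    by (subst sum.inter_filter) (auto intro!: sum.cong)
  also have "\<dots> = (\<Sum>q\<in>balanced_quads N. quad_term u q)"
    by (rule sum.reindex_bij_witness[where i="\<lambda>(a, b, c, d). ((a, c), (b, d))" and j="\<lambda>((a, c), (b, d)). (a, b, c, d)"])
       (auto simp: balanced_quads_def quad_term_def)
  finally show ?thesis .
qed

text \<open>If an index on one side of $a + b = c + d$ equals one on the other side, then the quadruple is \<open>(a, b, a, b)\<close>
or \<open>(a, b, b, a)\<close>. Each of the two families sums to the square of the mass, and their intersection, the
quadruples \<open>(a, a, a, a)\<close>, is counted twice.\<close>

lemma balanced_sum_eq:
  assumes u: "\<And>n. u n = complex_of_real (sqrt (wt n)) * z n"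
  shows "(\<Sum>q\<in>balanced_quads N. quad_term u q) = complex_of_real (quartic N z + 2 * (mass N z)\<^sup>2 - diagonal N z)"
proof -
  let ?R1 = "(\<lambda>(a, b). (a, b, a, b)) ` (modes N \<times> modes N) :: quad set"
  let ?R2 = "(\<lambda>(a, b). (a, b, b, a)) ` (modes N \<times> modes N) :: quad set"
  let ?t = "quad_term u"
  have uu: "u n * cnj (u n) = complex_of_real (wt n * (cmod (z n))\<^sup>2)" for n
  proof -
    have "u n * cnj (u n) = complex_of_real (sqrt (wt n) * sqrt (wt n)) * (z n * cnj (z n))"
      by (simp only: u complex_cnj_mult complex_cnj_complex_of_real of_real_mult mult_ac)
    also have "\<dots> = complex_of_real (wt n * (cmod (z n))\<^sup>2)"
      by (simp only: complex_norm_square[symmetric] of_real_mult[symmetric]) simp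
    finally show ?thesis .
  qed
  have B: "balanced_quads N = resonant_free_quads N \<union> (?R1 \<union> ?R2)"
    by (auto simp: balanced_quads_def resonant_free_quads_def nonresonant_iff image_iff)
  have disj: "resonant_free_quads N \<inter> (?R1 \<union> ?R2) = {}"
    by (auto simp: resonant_free_quads_def nonresonant_iff)
  have fin: "finite (?R1)" "finite ?R2" by auto
  have "sum ?t (balanced_quads N) = sum ?t (resonant_free_quads N) + sum ?t (?R1 \<union> ?R2)"
    unfolding B using disj by (intro sum.union_disjoint) auto
  moreover have "sum ?t (resonant_free_quads N) = complex_of_real (quartic N z)"
    unfolding chaos_real[symmetric] chaos_def
    by (intro sum.cong refl) (auto simp: quad_term_def u quad_monomial_eq quad_coeff_def wt_quad_def real_sqrt_mult mult_ac)
  moreover have "sum ?t (?R1 \<union> ?R2) + sum ?t (?R1 \<inter> ?R2) = sum ?t ?R1 + sum ?t ?R2"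
    by (rule sum.union_inter) auto
  moreover have "sum ?t ?R1 = complex_of_real ((mass N z)\<^sup>2)"
  proof -
    have "sum ?t ?R1 = (\<Sum>(a, b)\<in>modes N \<times> modes N. (u a * cnj (u a)) * (u b * cnj (u b)))"
      by (subst sum.reindex) (auto simp: inj_on_def quad_term_def mult_ac intro!: sum.cong)
    also have "\<dots> = (\<Sum>a\<in>modes N. u a * cnj (u a)) * (\<Sum>b\<in>modes N. u b * cnj (u b))"
      by (simp only: sum_product sum.cartesian_product)
    finally show ?thesis unfolding uu mass_def power2_eq_square by simp
  qed
  moreover have "sum ?t ?R2 = complex_of_real ((mass N z)\<^sup>2)"
  proof -
    have "sum ?t ?R2 = (\<Sum>(a, b)\<in>modes N \<times> modes N. (u a * cnj (u a)) * (u b * cnj (u b)))"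
      by (subst sum.reindex) (auto simp: inj_on_def quad_term_def mult_ac intro!: sum.cong)
    also have "\<dots> = (\<Sum>a\<in>modes N. u a * cnj (u a)) * (\<Sum>b\<in>modes N. u b * cnj (u b))"
      by (simp only: sum_product sum.cartesian_product)
    finally show ?thesis unfolding uu mass_def power2_eq_square by simp
  qed
  moreover have "sum ?t (?R1 \<inter> ?R2) = complex_of_real (diagonal N z)"
  proof -
    have "?R1 \<inter> ?R2 = (\<lambda>a. (a, a, a, a)) ` modes N" by auto
    then have "sum ?t (?R1 \<inter> ?R2) = (\<Sum>a\<in>modes N. (u a * cnj (u a)) * (u a * cnj (u a)))"
      by (simp only:, subst sum.reindex) (auto simp: inj_on_def quad_term_def mult_ac intro!: sum.cong)
    also have "\<dots> = (\<Sum>a\<in>modes N. complex_of_real ((wt a)\<^sup>2 * cmod (z a) ^ 4))"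
      unfolding uu of_real_mult[symmetric] by (intro sum.cong refl arg_cong[where f=complex_of_real]) (simp add: power2_eq_square power4_eq_xxxx)
    finally show ?thesis unfolding diagonal_def by simp
  qed
  ultimately show ?thesis by simp algebra
qed

lemma Lp_norm_2_sq:
  "(Lp_norm circle_measure 2 (fourier_proj N u))\<^sup>2 = (\<Sum>n\<in>modes N. (cmod (u n))\<^sup>2)"
proof -
  have "(Lp_norm circle_measure 2 (fourier_proj N u))\<^sup>2 = (((\<Sum>n\<in>modes N. (cmod (u n))\<^sup>2)) powr (1 / 2))\<^sup>2"
    unfolding Lp_norm_def by (simp add: integral_norm_sq)
  also have "\<dots> = (\<Sum>n\<in>modes N. (cmod (u n))\<^sup>2)"
    by (simp add: powr_half_sqrt sum_nonneg)
  finally show ?thesis .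
qed

lemma Lp_norm_4_fourth:
  "Lp_norm circle_measure 4 (fourier_proj N u) ^ 4 = (LINT x|circle_measure. cmod (fourier_proj N u x) ^ 4)"
proof -
  let ?I = "LINT x|circle_measure. cmod (fourier_proj N u x) ^ 4"
  have I: "0 \<le> ?I" by (intro Bochner_Integration.integral_nonneg) auto
  have "Lp_norm circle_measure 4 (fourier_proj N u) ^ 4 = (?I powr (1 / 4)) ^ 4"
    unfolding Lp_norm_def by simp
  also have "\<dots> = ?I" 
  proof (cases "?I = 0")
    case False
    then have "(?I powr (1 / 4)) ^ 4 = (?I powr (1 / 4)) powr (real 4)"
      using I by (intro powr_realpow[symmetric]) simp
    then show ?thesis using I False by (simp add: powr_powr)
  qed simp
  finally show ?thesis .
qed

text \<open>The lower bound on the energy is Jensen's inequality $\|u\|_{L^2} \le \|u\|_{L^4}$ on the circle, whose measure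
is normalised.\<close>

lemma
  assumes u: "\<And>n. u n = complex_of_real (sqrt (wt n)) * z n"
  shows mass_eq_norm: "(Lp_norm circle_measure 2 (fourier_proj N u))\<^sup>2 = mass N z"
    and energy_eq_norms: "Lp_norm circle_measure 4 (fourier_proj N u) ^ 4 - 2 * Lp_norm circle_measure 2 (fourier_proj N u) ^ 4 = energy N z"
    and energy_ge: "- (mass N z)\<^sup>2 \<le> energy N z"
proof -
  show m: "(Lp_norm circle_measure 2 (fourier_proj N u))\<^sup>2 = mass N z"
    unfolding Lp_norm_2_sq mass_def by (intro sum.cong refl) (simp add: u norm_mult power_mult_distrib)
  have f: "(LINT x|circle_measure. cmod (fourier_proj N u x) ^ 4) = energy N z + 2 * (mass N z)\<^sup>2"
    using integral_norm_fourth[of N u] unfolding balanced_sum_eq[OF u] of_real_eq_iff energy_def by simp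
  have "Lp_norm circle_measure 2 (fourier_proj N u) ^ 4 = (mass N z)\<^sup>2"
    unfolding m[symmetric] by simp
  then show "Lp_norm circle_measure 4 (fourier_proj N u) ^ 4 - 2 * Lp_norm circle_measure 2 (fourier_proj N u) ^ 4 = energy N z"
    unfolding Lp_norm_4_fourth f by simp
  have "(mass N z)\<^sup>2 \<le> (LINT x|circle_measure. cmod (fourier_proj N u x) ^ 4)"
  proof -
    interpret prob_space circle_measure by (rule prob_space_circle)
    let ?X = "\<lambda>x. (cmod (fourier_proj N u x))\<^sup>2"
    have b: "cmod (fourier_proj N u x) \<le> (\<Sum>n\<in>modes N. cmod (u n))" for x
      unfolding fourier_proj_eq by (rule sum_norm_le) (simp add: norm_mult norm_circle_mode)
    have i: "integrable circle_measure (\<lambda>x. cmod (fourier_proj N u x) ^ k)" for k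
      by (rule integrable_const_bound[of _ "(\<Sum>n\<in>modes N. cmod (u n)) ^ k"]) (auto intro!: power_mono b)
    have i2: "integrable circle_measure (\<lambda>x. (?X x)\<^sup>2)" using i[of 4] by simp
    have "0 \<le> variance ?X" by (rule variance_positive)
    also have "variance ?X = expectation (\<lambda>x. (?X x)\<^sup>2) - (expectation ?X)\<^sup>2"
      by (rule variance_eq[OF i i2])
    finally have "(expectation ?X)\<^sup>2 \<le> expectation (\<lambda>x. (?X x)\<^sup>2)" by simp
    also have "expectation ?X = mass N z" using m unfolding Lp_norm_2_sq integral_norm_sq .
    finally show ?thesis by simp
  qed
  with f show "- (mass N z)\<^sup>2 \<le> energy N z" by simp
qed

section \<open>Nelson's estimate\<close>

lemma mean_mass_double: "mean_mass (2 * N) \<le> mean_mass N + 2"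
proof -
  have "mean_mass (2 * N) - mean_mass N = (\<Sum>n\<in>modes (2 * N) - modes N. wt n)"
    unfolding mean_mass_def by (rule sum_diff[symmetric, OF _ modes_mono]) auto
  also have "\<dots> \<le> (\<Sum>n\<in>modes (2 * N) - modes N. 1 / (1 + real N))"
    by (intro sum_mono) (auto simp: wt_def modes_def intro!: divide_left_mono)
  also have "\<dots> = real (card (modes (2 * N) - modes N)) / (1 + real N)" by simp
  also have "card (modes (2 * N) - modes N) = 2 * N"
    by (subst card_Diff_subset) (auto intro: modes_mono[THEN subsetD] simp: modes_eq)
  also have "real (2 * N) / (1 + real N) \<le> 2" by (simp add: field_simps)
  finally show ?thesis by simp
qed

lemma mean_mass_dyadic: "mean_mass (2 ^ j) \<le> 2 * real j + 2"
proof (induction j)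
  case 0
  have "modes 1 = {-1, 0, 1}" by (auto simp: modes_def)
  then show ?case by (simp add: mean_mass_def wt_def)
next
  case (Suc j)
  then show ?case using mean_mass_double[of "2 ^ j"] by simp
qed

lemma mean_mass_mono: "N \<le> M \<Longrightarrow> mean_mass N \<le> mean_mass M"
  unfolding mean_mass_def using modes_mono by (intro sum_mono2) auto

lemma mean_mass_nonneg: "0 \<le> mean_mass N"
  unfolding mean_mass_def by (intro sum_nonneg) auto

lemma exp_minus_le_quadratic:
  fixes x :: real
  assumes "0 \<le> x"
  shows "exp (- x) \<le> 1 - x + x\<^sup>2 / 2"
proof -
  let ?f = "\<lambda>x::real. 1 - x + x\<^sup>2 / 2 - exp (- x)"
  have "?f 0 \<le> ?f x"
  proof (rule DERIV_nonneg_imp_nondecreasing[OF assms])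
    fix y :: real assume "0 \<le> y" "y \<le> x"
    have "(?f has_real_derivative (-1 + y + exp (- y))) (at y)"
      by (auto intro!: derivative_eq_intros)
    moreover have "0 \<le> -1 + y + exp (- y)" using exp_ge_add_one_self[of "- y"] by simp
    ultimately show "\<exists>d. (?f has_real_derivative d) (at y) \<and> 0 \<le> d" by blast
  qed
  then show ?thesis by simp
qed

text \<open>If the renormalised mass at mode $2^j$ is at most \<open>R + 1\<close>, then the mass is less than \<open>2 * j + R + 4\<close>,
because its mean is at most \<open>2 * j + 2\<close>. So an energy at mode $2^j$ lies above minus half of the level.\<close>

definition level :: "real \<Rightarrow> nat \<Rightarrow> real" where
  "level R j = 2 * (2 * real j + R + 4)\<^sup>2"

lemma energy_ge_mass: "- (mass N z)\<^sup>2 \<le> energy N z"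
  by (rule energy_ge[where u="\<lambda>n. complex_of_real (sqrt (wt n)) * z n"]) simp

lemma energy_ge_of_wick_mass:
  assumes "0 \<le> R" "wick_mass N z \<le> R + 1" "N \<le> 2 ^ j"
  shows "- (level R j / 2) < energy N z"
proof -
  have "mass N z \<le> R + 1 + mean_mass (2 ^ j)"
    using assms mean_mass_mono[OF assms(3)] by (simp add: wick_mass_def)
  also have "\<dots> < 2 * real j + R + 4" using mean_mass_dyadic[of j] by simp
  finally have "(mass N z)\<^sup>2 < (2 * real j + R + 4)\<^sup>2"
    using mass_nonneg by (intro power_strict_mono) auto
  then show ?thesis using energy_ge_mass[of N z] by (simp add: level_def)
qed

context complex_gaussians
begin

text \<open>The quadratic bound on the exponential reduces this to the second and fourth absolute moments, which are $1$ and $2$.\<close>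

lemma laplace_bound:
  assumes "0 \<le> s"
  shows "integrable P (\<lambda>\<omega>. exp (- s * (cmod (g n \<omega>))\<^sup>2))"
    and "expectation (\<lambda>\<omega>. exp (- s * (cmod (g n \<omega>))\<^sup>2)) \<le> exp (- s + s\<^sup>2)"
proof -
  show i: "integrable P (\<lambda>\<omega>. exp (- s * (cmod (g n \<omega>))\<^sup>2))"
    by (rule integrable_const_bound[of _ 1]) (use assms in auto)
  let ?X = "\<lambda>\<omega>. (cmod (g n \<omega>))\<^sup>2"
  have i2: "integrable P (\<lambda>\<omega>. 1 - s * ?X \<omega> ^ 1 + s\<^sup>2 / 2 * ?X \<omega> ^ 2)"
    by (intro Bochner_Integration.integrable_add Bochner_Integration.integrable_diff integrable_mult_right g_norm_moment) simp
  have "expectation (\<lambda>\<omega>. exp (- s * ?X \<omega>)) \<le> expectation (\<lambda>\<omega>. 1 - s * ?X \<omega> ^ 1 + s\<^sup>2 / 2 * ?X \<omega> ^ 2)"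
  proof (rule integral_mono[OF i i2])
    fix \<omega>
    have "exp (- (s * ?X \<omega>)) \<le> 1 - s * ?X \<omega> + (s * ?X \<omega>)\<^sup>2 / 2" using assms by (intro exp_minus_le_quadratic) auto
    then show "exp (- s * ?X \<omega>) \<le> 1 - s * ?X \<omega> ^ 1 + s\<^sup>2 / 2 * ?X \<omega> ^ 2" by (simp add: power_mult_distrib)
  qed
  also have "\<dots> = (1 - s * fact 1) + s\<^sup>2 / 2 * fact 2"
  proof -
    have "expectation (\<lambda>\<omega>. 1 - s * ?X \<omega> ^ 1 + s\<^sup>2 / 2 * ?X \<omega> ^ 2) = expectation (\<lambda>\<omega>. 1 - s * ?X \<omega> ^ 1) + expectation (\<lambda>\<omega>. s\<^sup>2 / 2 * ?X \<omega> ^ 2)"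
      by (intro Bochner_Integration.integral_add Bochner_Integration.integrable_diff integrable_mult_right g_norm_moment) simp
    also have "expectation (\<lambda>\<omega>. 1 - s * ?X \<omega> ^ 1) = expectation (\<lambda>\<omega>. 1) - expectation (\<lambda>\<omega>. s * ?X \<omega> ^ 1)"
      by (intro Bochner_Integration.integral_diff integrable_mult_right g_norm_moment) simp
    finally show ?thesis by (simp only: integral_mult_right_zero g_norm_moment lebesgue_integral_const prob_space scaleR_one)
  qed
  also have "\<dots> = 1 + (- s + s\<^sup>2)" by (simp add: fact_numeral)
  also have "\<dots> \<le> exp (- s + s\<^sup>2)" by (rule exp_ge_add_one_self)
  finally show "expectation (\<lambda>\<omega>. exp (- s * ?X \<omega>)) \<le> exp (- s + s\<^sup>2)" .
qed

text \<open>Chernoff's bound. Only a drop is estimated: the squares $|g_n|^2$ are bounded from below, so the lower tail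
is Gaussian, while the upper tail is merely exponential.\<close>

lemma wick_mass_drop:
  assumes "N \<le> M" "0 \<le> t"
  shows "prob {\<omega> \<in> space P. 1 \<le> wick_mass N (Z \<omega>) - wick_mass M (Z \<omega>)} \<le> exp (- t + t\<^sup>2 * (vt_sum * decay N))"
proof -
  let ?B = "modes M - modes N"
  let ?X = "\<lambda>n \<omega>. exp (t * wt n) * exp (- (t * wt n) * (cmod (g n \<omega>))\<^sup>2)"
  let ?Y = "\<lambda>\<omega>. wick_mass N (Z \<omega>) - wick_mass M (Z \<omega>)"
  have Y: "exp (t * ?Y \<omega>) = (\<Prod>n\<in>?B. ?X n \<omega>)" for \<omega>
  proof -
    have "?Y \<omega> = (\<Sum>n\<in>?B. wt n * (1 - (cmod (g n \<omega>))\<^sup>2))"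
      using wick_mass_diff[OF assms(1), of "Z \<omega>"] by (simp add: sum_negf[symmetric] algebra_simps)
    then show ?thesis
      by (simp add: sum_distrib_left exp_sum exp_add[symmetric] algebra_simps)
  qed
  have ind: "indep_vars (\<lambda>_. borel) ?X ?B"
    by (rule indep_vars_compose2[OF indep_vars_subset[OF indep], where Y="\<lambda>n z. exp (t * wt n) * exp (- (t * wt n) * (cmod z)\<^sup>2)"]) auto
  have tw: "0 \<le> t * wt n" for n using assms by simp
  have iX: "integrable P (?X n)" for n by (intro integrable_mult_right laplace_bound tw)
  have iY: "integrable P (\<lambda>\<omega>. exp (t * ?Y \<omega>))"
    unfolding Y by (rule indep_vars_integrable[OF _ ind iX]) auto
  have "expectation (\<lambda>\<omega>. exp (t * ?Y \<omega>)) = (\<Prod>n\<in>?B. expectation (?X n))"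
    unfolding Y by (rule indep_vars_lebesgue_integral[OF _ ind iX]) auto
  also have "\<dots> \<le> (\<Prod>n\<in>?B. exp (t\<^sup>2 * (wt n)\<^sup>2))"
  proof (intro prod_mono conjI)
    fix n
    have "expectation (?X n) = exp (t * wt n) * expectation (\<lambda>\<omega>. exp (- (t * wt n) * (cmod (g n \<omega>))\<^sup>2))" by simp
    also have "\<dots> \<le> exp (t * wt n) * exp (- (t * wt n) + (t * wt n)\<^sup>2)"
      by (intro mult_left_mono laplace_bound tw) auto
    also have "\<dots> = exp (t\<^sup>2 * (wt n)\<^sup>2)" by (simp add: exp_add[symmetric] power_mult_distrib)
    finally show "expectation (?X n) \<le> exp (t\<^sup>2 * (wt n)\<^sup>2)" .
  qed (auto intro!: Bochner_Integration.integral_nonneg)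
  also have "\<dots> = exp (t\<^sup>2 * (\<Sum>n\<in>?B. (wt n)\<^sup>2))" by (simp add: exp_sum[symmetric] sum_distrib_left)
  also have "\<dots> \<le> exp (t\<^sup>2 * (vt_sum * decay N))" using diagonal_tail_coeff by (simp add: mult_left_mono)
  finally have E: "expectation (\<lambda>\<omega>. exp (t * ?Y \<omega>)) \<le> exp (t\<^sup>2 * (vt_sum * decay N))" .
  have "prob {\<omega> \<in> space P. 1 \<le> ?Y \<omega>} = expectation (indicator {\<omega> \<in> space P. 1 \<le> ?Y \<omega>})" by simp
  also have "\<dots> \<le> expectation (\<lambda>\<omega>. exp (- t) * exp (t * ?Y \<omega>))"
  proof (rule integral_mono)
    show "integrable P (indicator {\<omega> \<in> space P. 1 \<le> ?Y \<omega>} :: _ \<Rightarrow> real)" by (rule integrable_const_bound[of _ 1]) auto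
    show "integrable P (\<lambda>\<omega>. exp (- t) * exp (t * ?Y \<omega>))" by (intro integrable_mult_right iY)
    show "indicator {\<omega> \<in> space P. 1 \<le> ?Y \<omega>} \<omega> \<le> exp (- t) * exp (t * ?Y \<omega>)" for \<omega>
      using assms(2) mult_left_mono[of 1 "?Y \<omega>" t] by (auto simp: indicator_def exp_add[symmetric] not_le simp del: mult_1_right)
  qed
  also have "\<dots> \<le> exp (- t) * exp (t\<^sup>2 * (vt_sum * decay N))" using E by simp
  finally show ?thesis by (simp only: exp_add)
qed

text \<open>If the energy at \<open>N\<close> is below minus the level but half of that is out of reach at $2^j$, then between the two modes
the quartic or the diagonal part has changed by at least one, or else the renormalised
mass has dropped by at least one.\<close>

lemma energy_tail:
  assumes R: "0 \<le> R" and t: "0 \<le> t"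
  shows "prob {\<omega> \<in> space P. energy N (Z \<omega>) \<le> - level R j \<and> wick_mass N (Z \<omega>) \<le> R}
     \<le> real (4 * k) ^ (4 * k) * (64 * vt_sum ^ 3 * decay (2 ^ j)) ^ k + real (2 * k) ^ (2 * k) * (vt_sum * decay (2 ^ j)) ^ k
       + exp (- t + t\<^sup>2 * (vt_sum * decay (2 ^ j)))" (is "prob ?E \<le> ?p1 + ?p2 + ?p3")
proof -
  have level1: "4 \<le> level R j"
  proof -
    have "2 * 4\<^sup>2 \<le> level R j" unfolding level_def using R by (intro mult_left_mono power_mono) auto
    then show ?thesis by simp
  qed
  have d: "0 \<le> decay n" for n using decay_pos[of n] by simp
  have p: "0 \<le> ?p1" "0 \<le> ?p2" "0 \<le> ?p3" using vt_sum_nonneg d by auto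
  show ?thesis
  proof (cases "N \<le> 2 ^ j")
    case True
    have "?E = {}"
    proof (intro equals0I)
      fix \<omega> assume "\<omega> \<in> ?E"
      then have "energy N (Z \<omega>) \<le> - level R j" "wick_mass N (Z \<omega>) \<le> R + 1" by auto
      then show False using energy_ge_of_wick_mass[OF R _ True, of "Z \<omega>"] level1 by linarith
    qed
    then have "prob ?E = 0" by (simp only: measure_empty)
    then show ?thesis using p by linarith
  next
    case False
    define N0 :: nat where "N0 = 2 ^ j"
    have N0: "N0 \<le> N" using False by (simp add: N0_def)
    let ?q = "\<lambda>\<omega>. quartic N (Z \<omega>) - quartic N0 (Z \<omega>)" and ?d = "\<lambda>\<omega>. diagonal N (Z \<omega>) - diagonal N0 (Z \<omega>)"
    let ?E1 = "{\<omega> \<in> space P. 1 \<le> \<bar>?q \<omega>\<bar>}" and ?E2 = "{\<omega> \<in> space P. 1 \<le> ?d \<omega>}"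
      and ?E3 = "{\<omega> \<in> space P. 1 \<le> wick_mass N0 (Z \<omega>) - wick_mass N (Z \<omega>)}"
    have "?E \<subseteq> ?E1 \<union> ?E2 \<union> ?E3"
    proof
      fix \<omega> assume w: "\<omega> \<in> ?E"
      show "\<omega> \<in> ?E1 \<union> ?E2 \<union> ?E3"
      proof (rule ccontr)
        assume "\<omega> \<notin> ?E1 \<union> ?E2 \<union> ?E3"
        then have n: "\<bar>?q \<omega>\<bar> < 1" "?d \<omega> < 1" "wick_mass N0 (Z \<omega>) < wick_mass N (Z \<omega>) + 1" using w by auto
        then have "wick_mass N0 (Z \<omega>) \<le> R + 1" using w by auto
        then have "- (level R j / 2) < energy N0 (Z \<omega>)" by (rule energy_ge_of_wick_mass[OF R]) (simp add: N0_def)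
        then show False using n w level1 by (auto simp: energy_def)
      qed
    qed
    then have "prob ?E \<le> prob (?E1 \<union> ?E2 \<union> ?E3)" by (intro finite_measure_mono) auto
    also have "\<dots> \<le> prob (?E1 \<union> ?E2) + prob ?E3" by (rule measure_Un_le) auto
    also have "prob (?E1 \<union> ?E2) \<le> prob ?E1 + prob ?E2" by (rule measure_Un_le) auto
    also have "prob ?E1 \<le> ?p1"
    proof -
      have "prob ?E1 \<le> expectation (\<lambda>\<omega>. \<bar>?q \<omega>\<bar> ^ (2 * k))"
        using quartic_diff_moment(1)[OF N0, of "2 * k"] by (intro markov_power) (auto simp: power_even_abs)
      also have "\<dots> \<le> ?p1" using quartic_diff_moment(2)[OF N0, of k] by (simp add: power_even_abs N0_def)
      finally show ?thesis .
    qed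
    also have "prob ?E2 \<le> ?p2"
    proof -
      have "prob ?E2 \<le> expectation (\<lambda>\<omega>. ?d \<omega> ^ k)"
        using diagonal_diff_moment(1)[OF N0] diagonal_mono[OF N0] by (intro markov_power) auto
      also have "\<dots> \<le> ?p2" using diagonal_diff_moment(2)[OF N0, of k] by (simp add: N0_def)
      finally show ?thesis .
    qed
    also have "prob ?E3 \<le> ?p3" using wick_mass_drop[OF N0 t] by (simp add: N0_def)
    finally show ?thesis by simp
  qed
qed

end

text \<open>The logarithm of the general term is $(8 q - L \ln 2 / 8) j^2 + O(j \log j)$, where $8 q j^2$ is the leading part of
\<open>q * level R (Suc j)\<close>; the hypothesis on \<open>L\<close> makes the coefficient of $j^2$ at most $-1$.\<close>

lemma tail_series_summable:
  fixes q R :: real and L :: nat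
  assumes q: "0 \<le> q" "0 \<le> R" and c: "1 \<le> c" and L: "1 \<le> L" "8 * (8 * q + 1) \<le> real L * ln 2"
  shows "summable (\<lambda>j. exp (q * level R (Suc j)) * (real (4 * (L * j)) ^ (4 * (L * j)) * (c * 2 powr (- real j / 8)) ^ (L * j)))" (is "summable ?a")
proof -
  let ?E = "\<lambda>j. q * level R (Suc j) + 4 * real L * real j * ln (4 * real L * real j) + real L * real j * ln c - real L * (real j)\<^sup>2 * ln 2 / 8"
  have aE: "?a j = exp (?E j)" if "j \<ge> 1" for j
  proof -
    have p: "0 < real (4 * (L * j))" using that L by simp
    have "real (4 * (L * j)) ^ (4 * (L * j)) = exp (4 * real L * real j * ln (4 * real L * real j))"
      using p by (simp only: exp_of_nat_mult[symmetric] of_nat_mult of_nat_numeral exp_ln_iff) 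
        (metis (no_types, opaque_lifting) exp_ln exp_of_nat_mult of_nat_mult of_nat_numeral mult.assoc)
    moreover have "(c * 2 powr (- real j / 8)) ^ (L * j) = exp (real L * real j * ln c - real L * (real j)\<^sup>2 * ln 2 / 8)"
    proof -
      have "c * 2 powr (- real j / 8) = exp (ln c - real j * ln 2 / 8)"
      proof -
        have "c * 2 powr (- real j / 8) = exp (ln c) * exp (- real j / 8 * ln 2)"
          using c by (simp only: powr_def exp_ln) simp
        then show ?thesis by (simp only: exp_add[symmetric]) simp
      qed
      then have "(c * 2 powr (- real j / 8)) ^ (L * j) = exp (real (L * j) * (ln c - real j * ln 2 / 8))"
        by (simp only: exp_of_nat_mult)
      then show ?thesis by (simp add: algebra_simps power2_eq_square)
    qed
    ultimately show ?thesis by (simp add: exp_add[symmetric] algebra_simps)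
  qed
  have lim: "(\<lambda>j. 2 * q * (2 + (R + 6) * (1 / real j))\<^sup>2 + 4 * real L * (ln (4 * real L) * (1 / real j) + ln (real j) / real j) + real L * ln c * (1 / real j) - real L * ln 2 / 8)
     \<longlonglongrightarrow> 2 * q * (2 + (R + 6) * 0)\<^sup>2 + 4 * real L * (ln (4 * real L) * 0 + 0) + real L * ln c * 0 - real L * ln 2 / 8"
    by (intro tendsto_intros lim_1_over_n lim_ln_over_n)
  moreover have "2 * q * (2 + (R + 6) * 0)\<^sup>2 + 4 * real L * (ln (4 * real L) * 0 + 0) + real L * ln c * 0 - real L * ln 2 / 8 < - (1/2)"
    using L(2) by simp
  ultimately have ev: "\<forall>\<^sub>F j in sequentially. 2 * q * (2 + (R + 6) * (1 / real j))\<^sup>2 + 4 * real L * (ln (4 * real L) * (1 / real j) + ln (real j) / real j) + real L * ln c * (1 / real j) - real L * ln 2 / 8 < - (1/2)"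
    by (rule order_tendstoD(2))
  have "\<forall>\<^sub>F j in sequentially. norm (?a j) \<le> exp (- 1) ^ j"
    using ev eventually_ge_at_top[of 2]
  proof eventually_elim
    case (elim j)
    let ?x = "2 * q * (2 + (R + 6) * (1 / real j))\<^sup>2 + 4 * real L * (ln (4 * real L) * (1 / real j) + ln (real j) / real j) + real L * ln c * (1 / real j) - real L * ln 2 / 8"
    have j: "real j > 0" "real j \<ge> 2" using elim by auto
    have "?E j = (real j)\<^sup>2 * ?x"
    proof -
      have "q * level R (Suc j) = (real j)\<^sup>2 * (2 * q * (2 + (R + 6) * (1 / real j))\<^sup>2)"
      proof -
        have "2 * real (Suc j) + R + 4 = real j * (2 + (R + 6) * (1 / real j))" using j by (simp add: field_simps)
        then show ?thesis unfolding level_def by (simp add: power_mult_distrib)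
      qed
      moreover have "ln (4 * real L * real j) = ln (4 * real L) + ln (real j)" using j L by (simp add: ln_mult)
      then have "4 * real L * real j * ln (4 * real L * real j) = (real j)\<^sup>2 * (4 * real L * (ln (4 * real L) * (1 / real j) + ln (real j) / real j))"
        using j by (simp add: field_simps power2_eq_square)
      moreover have "real L * real j * ln c = (real j)\<^sup>2 * (real L * ln c * (1 / real j))"
        using j by (simp add: field_simps power2_eq_square)
      moreover have "real L * (real j)\<^sup>2 * ln 2 / 8 = (real j)\<^sup>2 * (real L * ln 2 / 8)" by simp
      ultimately show ?thesis by (simp only: distrib_left right_diff_distrib)
    qed
    also have "\<dots> \<le> (real j)\<^sup>2 * (- (1/2))" using elim by (intro mult_left_mono) auto
    also have "\<dots> \<le> - real j" using j mult_right_mono[of 2 "real j" "real j"] by (simp add: power2_eq_square)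
    finally have "?E j \<le> - real j" .
    then have "exp (?E j) \<le> exp (- real j)" by simp
    also have "exp (- real j) = exp (-1) ^ j" by (simp add: exp_of_nat_mult[symmetric])
    finally show ?case using aE[of j] elim by simp
  qed
  then show ?thesis
    by (rule summable_comparison_test_ev) (auto intro!: summable_geometric)
qed

lemma tail_series_summable':
  fixes q R :: real
  assumes q: "0 \<le> q" "0 \<le> R"
  shows "summable (\<lambda>j. exp (q * level R (Suc j)) * exp (- (2 powr (real j / 16))))" (is "summable ?a")
proof -
  define C where "C = 2 * q * (R + 8)\<^sup>2 + 1"
  have C: "C \<ge> 1" using q by (simp add: C_def)
  define y where "y = 2 powr (- 1 / 32 :: real)"
  have "y < 2 powr 0" unfolding y_def by (rule powr_less_mono) auto
  then have y: "norm y < 1" "0 < y" by (auto simp: y_def)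
  have l: "(\<lambda>j. (real j * y ^ j)\<^sup>2) \<longlonglongrightarrow> 0"
    using tendsto_power[OF powser_times_n_limit_0[OF y(1)], of 2] by simp
  have "\<forall>\<^sub>F j in sequentially. (real j * y ^ j)\<^sup>2 < 1 / C"
    by (rule order_tendstoD(2)[OF l]) (use C in simp)
  then have "\<forall>\<^sub>F j in sequentially. norm (?a j) \<le> exp (- 1) ^ j"
    using eventually_ge_at_top[of 1]
  proof eventually_elim
    case (elim j)
    have j: "real j \<ge> 1" using elim by simp
    have "(y ^ j)\<^sup>2 = 2 powr (- real j / 16)"
    proof -
      have "(y ^ j)\<^sup>2 = y ^ (2 * j)" by (simp add: power_mult[symmetric] mult.commute)
      also have "\<dots> = y powr real (2 * j)" by (rule powr_realpow[OF y(2), symmetric])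
      also have "\<dots> = 2 powr (- real j / 16)" unfolding y_def powr_powr by simp
      finally show ?thesis .
    qed
    then have "(real j)\<^sup>2 * 2 powr (- real j / 16) < 1 / C" using elim by (simp add: power_mult_distrib)
    then have "C * (real j)\<^sup>2 \<le> 2 powr (real j / 16)"
      using C by (simp add: powr_minus field_simps)
    moreover have "q * level R (Suc j) + real j \<le> C * (real j)\<^sup>2"
    proof -
      have Rj: "R + 6 \<le> (R + 6) * real j" using mult_left_mono[OF j, of "R + 6"] q by simp
      have "2 * real (Suc j) + R + 4 \<le> (R + 8) * real j"
        using Rj by (simp add: algebra_simps)
      then have "(2 * real (Suc j) + R + 4)\<^sup>2 \<le> ((R + 8) * real j)\<^sup>2" using q by (intro power_mono) auto
      then have "q * level R (Suc j) \<le> q * (2 * ((R + 8) * real j)\<^sup>2)"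
        unfolding level_def using q by (intro mult_left_mono) auto
      moreover have "real j \<le> (real j)\<^sup>2" using mult_left_mono[OF j, of "real j"] by (simp add: power2_eq_square)
      moreover have "C * (real j)\<^sup>2 = q * (2 * ((R + 8) * real j)\<^sup>2) + (real j)\<^sup>2"
        unfolding C_def power_mult_distrib by (simp add: distrib_right)
      ultimately show ?thesis by linarith
    qed
    ultimately have "q * level R (Suc j) - 2 powr (real j / 16) \<le> - real j" by linarith
    then have "exp (q * level R (Suc j) - 2 powr (real j / 16)) \<le> exp (- real j)" by simp
    also have "exp (- real j) = exp (-1) ^ j" by (simp add: exp_of_nat_mult[symmetric])
    finally show ?case by (simp add: exp_diff exp_minus field_simps)
  qed
  then show ?thesis
    by (rule summable_comparison_test_ev) (auto intro!: summable_geometric)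
qed


lemma decay_dyadic: "decay (2 ^ j) \<le> 2 powr (- real j / 8)"
proof -
  have "decay (2 ^ j) \<le> (2 ^ j) powr (- 1 / 8)"
    unfolding decay_def by (intro powr_mono2') auto
  also have "(2 ^ j :: real) = 2 powr real j" by (rule powr_realpow[symmetric]) simp
  finally show ?thesis unfolding powr_powr by simp
qed

lemma level_ge: "0 \<le> R \<Longrightarrow> real j \<le> level R j"
proof -
  assume R: "0 \<le> R"
  have 1: "1 \<le> 2 * real j + R + 4" using R by simp
  have "real j \<le> 2 * real j + R + 4" using R by simp
  also have "\<dots> \<le> (2 * real j + R + 4)\<^sup>2" using mult_left_mono[OF 1, of "2 * real j + R + 4"] R by (simp add: power2_eq_square)
  finally show "real j \<le> level R j" unfolding level_def using zero_le_power2[of "2 * real j + R + 4"] by linarith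
qed

context complex_gaussians
begin

text \<open>The exponential is cut at the levels: an energy between \<open>- level R (Suc j)\<close> and \<open>- level R j\<close> contributes
at most \<open>exp (q * level R (Suc j))\<close>, with the probability from \<open>energy_tail\<close>, and the resulting
series does not depend on \<open>N\<close>.\<close>

lemma nelson:
  assumes q: "0 \<le> q" and R: "0 \<le> R"
  obtains K where "\<And>N. integrable P (\<lambda>\<omega>. if wick_mass N (Z \<omega>) \<le> R then exp (- q * energy N (Z \<omega>)) else 0)"
    and "\<And>N. expectation (\<lambda>\<omega>. if wick_mass N (Z \<omega>) \<le> R then exp (- q * energy N (Z \<omega>)) else 0) \<le> K"
proof -
  define c where "c = max 1 (max (64 * vt_sum ^ 3) vt_sum)"
  have c: "1 \<le> c" "64 * vt_sum ^ 3 \<le> c" "vt_sum \<le> c" by (auto simp: c_def)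
  obtain L0 :: nat where L0: "8 * (8 * q + 1) / ln 2 \<le> real L0" using real_arch_simple by blast
  \<comment> \<open>moments of order \<open>L * j\<close> at level \<open>j\<close> outweigh the growth of \<open>exp (q * level R (Suc j))\<close>\<close>
  define L where "L = Suc L0"
  have L: "1 \<le> L" "8 * (8 * q + 1) \<le> real L * ln 2"
  proof -
    have "8 * (8 * q + 1) \<le> real L0 * ln 2" using L0 by (simp add: field_simps)
    also have "\<dots> \<le> real L * ln 2" by (intro mult_right_mono) (auto simp: L_def)
    finally show "8 * (8 * q + 1) \<le> real L * ln 2" .
  qed (simp add: L_def)
  define a where "a j = real (4 * (L * j)) ^ (4 * (L * j)) * (c * 2 powr (- real j / 8)) ^ (L * j)" for j
  define b where "b j = exp (- (2 powr (real j / 16)))" for j :: nat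
  have a0: "0 \<le> a j" for j unfolding a_def using c by auto
  define p where "p j = 2 * a j + exp vt_sum * b j" for j
  have p0: "0 \<le> p j" for j using a0[of j] by (simp add: p_def b_def)
  have sm: "summable (\<lambda>j. exp (q * level R (Suc j)) * p j)"
  proof -
    have "summable (\<lambda>j. 2 * (exp (q * level R (Suc j)) * a j) + exp vt_sum * (exp (q * level R (Suc j)) * b j))"
      unfolding a_def b_def
      by (intro summable_add summable_mult tail_series_summable tail_series_summable' q R c L)
    then show ?thesis by (simp add: p_def algebra_simps)
  qed
  let ?E = "\<lambda>N j. {\<omega> \<in> space P. energy N (Z \<omega>) \<le> - level R j \<and> wick_mass N (Z \<omega>) \<le> R}"
  have tail: "prob (?E N j) \<le> p j" for N j
  proof -
    define k where "k = L * j"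
    \<comment> \<open>the largest \<open>t\<close>, up to constants, for which the quadratic term of Chernoff's bound stays bounded\<close>
    define t where "t = 2 powr (real j / 16)"
    have d: "0 \<le> decay n" for n using decay_pos[of n] by simp
    have "prob (?E N j) \<le> real (4 * k) ^ (4 * k) * (64 * vt_sum ^ 3 * decay (2 ^ j)) ^ k + real (2 * k) ^ (2 * k) * (vt_sum * decay (2 ^ j)) ^ k
       + exp (- t + t\<^sup>2 * (vt_sum * decay (2 ^ j)))"
      by (rule energy_tail[OF R]) (simp add: t_def)
    also have "real (4 * k) ^ (4 * k) * (64 * vt_sum ^ 3 * decay (2 ^ j)) ^ k \<le> a j"
      unfolding a_def k_def[symmetric] using vt_sum_nonneg c d decay_dyadic
      by (intro mult_left_mono power_mono mult_mono) auto
    also have "real (2 * k) ^ (2 * k) * (vt_sum * decay (2 ^ j)) ^ k \<le> a j"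
      unfolding a_def k_def[symmetric]
    proof (intro mult_mono power_mono)
      show "real (2 * k) ^ (2 * k) \<le> real (4 * k) ^ (4 * k)"
      proof (cases "k = 0")
        case False
        have "real (2 * k) ^ (2 * k) \<le> real (4 * k) ^ (2 * k)" by (intro power_mono) auto
        also have "\<dots> \<le> real (4 * k) ^ (4 * k)" using False by (intro power_increasing) auto
        finally show ?thesis .
      qed simp
    qed (use vt_sum_nonneg c d decay_dyadic in auto)
    also have "exp (- t + t\<^sup>2 * (vt_sum * decay (2 ^ j))) \<le> exp vt_sum * b j"
    proof -
      have "t\<^sup>2 * (vt_sum * decay (2 ^ j)) \<le> t\<^sup>2 * (vt_sum * 2 powr (- real j / 8))"
        using vt_sum_nonneg decay_dyadic by (intro mult_left_mono) auto
      also have "\<dots> = vt_sum"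
        unfolding t_def by (simp add: power2_eq_square powr_add[symmetric])
      finally have "exp (- t + t\<^sup>2 * (vt_sum * decay (2 ^ j))) \<le> exp (vt_sum + - t)" by simp
      then show ?thesis unfolding b_def t_def exp_add .
    qed
    finally show ?thesis by (simp add: p_def)
  qed
  define K where "K = exp (q * level R 0) + (\<Sum>j. exp (q * level R (Suc j)) * p j)"
  have K0: "0 \<le> K" unfolding K_def using sm p0 by (intro add_nonneg_nonneg suminf_nonneg) auto
  let ?f = "\<lambda>N \<omega>. if wick_mass N (Z \<omega>) \<le> R then exp (- q * energy N (Z \<omega>)) else 0"
  have nn: "(\<integral>\<^sup>+\<omega>. ennreal (?f N \<omega>) \<partial>P) \<le> ennreal K" for N
  proof -
    have pt: "ennreal (?f N \<omega>) \<le> ennreal (exp (q * level R 0)) + (\<Sum>j. ennreal (exp (q * level R (Suc j))) * indicator (?E N j) \<omega>)"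
      if w: "\<omega> \<in> space P" for \<omega>
    proof (cases "wick_mass N (Z \<omega>) \<le> R \<and> energy N (Z \<omega>) \<le> - level R 0")
      case False
      have "?f N \<omega> \<le> exp (q * level R 0)"
      proof (cases "wick_mass N (Z \<omega>) \<le> R")
        case True
        then have "- energy N (Z \<omega>) \<le> level R 0" using False by simp
        from mult_left_mono[OF this q] show ?thesis using True by simp
      qed simp
      then have "ennreal (?f N \<omega>) \<le> ennreal (exp (q * level R 0))" by (rule ennreal_leI)
      then show ?thesis by (rule order_trans) simp
    next
      case True
      \<comment> \<open>the last level that the energy of \<open>\<omega>\<close> has passed\<close>
      define j where "j = Max {j. level R j \<le> - energy N (Z \<omega>)}"
      have fin: "finite {j. level R j \<le> - energy N (Z \<omega>)}"
      proof (rule finite_subset)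
        show "{j. level R j \<le> - energy N (Z \<omega>)} \<subseteq> {.. nat \<lceil>- energy N (Z \<omega>)\<rceil>}"
        proof
          fix j assume "j \<in> {j. level R j \<le> - energy N (Z \<omega>)}"
          then have "real j \<le> - energy N (Z \<omega>)" using level_ge[OF R, of j] by simp
          then show "j \<in> {.. nat \<lceil>- energy N (Z \<omega>)\<rceil>}" by (simp add: le_nat_iff) linarith
        qed
      qed simp
      have "level R 0 \<le> - energy N (Z \<omega>)" using True by simp
      then have "j \<in> {j. level R j \<le> - energy N (Z \<omega>)}"
        unfolding j_def by (intro Max_in fin) blast
      then have j1: "energy N (Z \<omega>) \<le> - level R j" by simp
      have "Suc j \<notin> {j. level R j \<le> - energy N (Z \<omega>)}"
        using Max_ge[OF fin, of "Suc j"] by (auto simp: j_def[symmetric])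
      then have "- energy N (Z \<omega>) \<le> level R (Suc j)" by simp
      from mult_left_mono[OF this q] have "?f N \<omega> \<le> exp (q * level R (Suc j))" using True by simp
      then have "ennreal (?f N \<omega>) \<le> ennreal (exp (q * level R (Suc j))) * indicator (?E N j) \<omega>"
        using j1 True w by (simp add: ennreal_leI)
      also have "\<dots> \<le> (\<Sum>j. ennreal (exp (q * level R (Suc j))) * indicator (?E N j) \<omega>)"
        using sum_le_suminf[of "\<lambda>j. ennreal (exp (q * level R (Suc j))) * indicator (?E N j) \<omega>" "{j}"]
        by (simp only: sum.insert finite.intros empty_iff not_False_eq_True sum.empty add_0_right) simp
      finally show ?thesis by (rule order_trans) simp
    qed
    have "(\<integral>\<^sup>+\<omega>. ennreal (?f N \<omega>) \<partial>P) \<le> (\<integral>\<^sup>+\<omega>. ennreal (exp (q * level R 0)) + (\<Sum>j. ennreal (exp (q * level R (Suc j))) * indicator (?E N j) \<omega>) \<partial>P)"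
      by (rule nn_integral_mono) (rule pt)
    also have "\<dots> = ennreal (exp (q * level R 0)) + (\<Sum>j. ennreal (exp (q * level R (Suc j))) * emeasure P (?E N j))"
      by (subst nn_integral_add, simp, measurable, subst nn_integral_suminf, measurable)
         (simp add: nn_integral_cmult emeasure_space_1)
    also have "\<dots> \<le> ennreal (exp (q * level R 0)) + (\<Sum>j. ennreal (exp (q * level R (Suc j)) * p j))"
    proof (intro add_left_mono suminf_le allI)
      fix j
      have "ennreal (exp (q * level R (Suc j))) * emeasure P (?E N j) = ennreal (exp (q * level R (Suc j)) * prob (?E N j))"
        by (simp add: emeasure_eq_measure ennreal_mult)
      also have "\<dots> \<le> ennreal (exp (q * level R (Suc j)) * p j)"
        by (intro ennreal_leI mult_left_mono tail) auto
      finally show "ennreal (exp (q * level R (Suc j))) * emeasure P (?E N j) \<le> ennreal (exp (q * level R (Suc j)) * p j)" .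
    qed auto
    also have "\<dots> = ennreal K"
      unfolding K_def using sm p0
      by (subst suminf_ennreal2) (auto simp: ennreal_plus[symmetric] suminf_nonneg simp del: ennreal_plus)
    finally show ?thesis .
  qed
  have m: "?f N \<in> borel_measurable P" for N by measurable
  have i: "integrable P (?f N)" for N
  proof (rule integrableI_bounded[OF m])
    have "(\<integral>\<^sup>+\<omega>. ennreal (norm (?f N \<omega>)) \<partial>P) = (\<integral>\<^sup>+\<omega>. ennreal (?f N \<omega>) \<partial>P)" by (intro nn_integral_cong) auto
    also have "\<dots> \<le> ennreal K" by (rule nn)
    also have "\<dots> < \<infinity>" by simp
    finally show "(\<integral>\<^sup>+\<omega>. ennreal (norm (?f N \<omega>)) \<partial>P) < \<infinity>" .
  qed
  moreover have "expectation (?f N) \<le> K" for N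
    using nn[of N] K0 i[of N] by (subst (asm) nn_integral_eq_integral) auto
  ultimately show ?thesis by (rule that)
qed

end

section \<open>Small balls of the renormalised mass\<close>

text \<open>The divergence of the mean mass is what allows the renormalised mass to take every real value,
however negative: the mass itself is nonnegative.\<close>

lemma mean_mass_double_ge:
  assumes "1 \<le> N"
  shows "mean_mass N + 2 / 3 \<le> mean_mass (2 * N)"
proof -
  have card: "card (modes (2 * N) - modes N) = 2 * N"
    by (subst card_Diff_subset) (auto intro: modes_mono[THEN subsetD] simp: modes_eq)
  have "2 / 3 \<le> real (2 * N) / (1 + real (2 * N))"
    using assms by (subst pos_le_divide_eq) auto
  also have "\<dots> = real (card (modes (2 * N) - modes N)) * (1 / (1 + real (2 * N)))"
    unfolding card by simp
  also have "\<dots> = (\<Sum>n\<in>modes (2 * N) - modes N. 1 / (1 + real (2 * N)))" by simp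
  also have "\<dots> \<le> (\<Sum>n\<in>modes (2 * N) - modes N. wt n)"
    unfolding wt_def by (intro sum_mono divide_left_mono) (auto simp: modes_def)
  also have "\<dots> = mean_mass (2 * N) - mean_mass N"
    unfolding mean_mass_def by (rule sum_diff[OF _ modes_mono]) auto
  finally show ?thesis by simp
qed

lemma mean_mass_ge: "2 / 3 * real j \<le> mean_mass (2 ^ j)"
proof (induction j)
  case 0
  then show ?case by (simp add: mean_mass_nonneg)
next
  case (Suc j)
  then show ?case using mean_mass_double_ge[of "2 ^ j"] by simp
qed

context complex_gaussians
begin

text \<open>An event of positive probability: mode \<open>0\<close> carries almost all of the required mass, and the other modes
nearly vanish.\<close>

lemma wick_mass_small_ball:
  assumes t: "0 < x0 + mean_mass K" and \<delta>: "0 < \<delta>"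
  shows "0 < prob {\<omega> \<in> space P. \<bar>wick_mass K (Z \<omega>) - x0\<bar> < \<delta>}"
proof -
  define t where "t = x0 + mean_mass K"
  \<comment> \<open>there are \<open>2 * K + 1\<close> modes, and together the small ones may use up half of \<open>\<delta>\<close>\<close>
  define \<epsilon> where "\<epsilon> = \<delta> / (2 * (2 * real K + 1))"
  have \<epsilon>: "0 < \<epsilon>" "(2 * real K + 1) * \<epsilon> = \<delta> / 2" using \<delta> by (auto simp: \<epsilon>_def field_simps)
  define U where "U n = (if n = 0 then {z::complex. \<bar>(cmod z)\<^sup>2 - t\<bar> < \<delta> / 2} else {z. (cmod z)\<^sup>2 < \<epsilon>})" for n :: int
  have op: "open (U n)" for n
    unfolding U_def by (auto intro!: open_Collect_less continuous_intros)
  have ne: "U n \<noteq> {}" for n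
  proof -
    have "complex_of_real (sqrt t) \<in> U 0" using t \<delta> by (simp add: U_def t_def)
    moreover have "0 \<in> U n" if "n \<noteq> 0" using that \<epsilon> by (simp add: U_def)
    ultimately show ?thesis by (cases "n = 0") auto
  qed
  have fin: "finite (modes K)" by simp
  have m0: "0 \<in> modes K" by (simp add: modes_def)
  have "0 < (\<Prod>n\<in>modes K. prob (g n -` U n \<inter> space P))"
    by (intro prod_pos ballI open_pos op ne)
  also have "\<dots> = prob (\<Inter>n\<in>modes K. g n -` U n \<inter> space P)"
    using m0 op by (intro indep_varsD[OF indep, symmetric]) auto
  also have "\<dots> \<le> prob {\<omega> \<in> space P. \<bar>wick_mass K (Z \<omega>) - x0\<bar> < \<delta>}"
  proof (intro finite_measure_mono)
    show "(\<Inter>n\<in>modes K. g n -` U n \<inter> space P) \<subseteq> {\<omega> \<in> space P. \<bar>wick_mass K (Z \<omega>) - x0\<bar> < \<delta>}"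
    proof
      fix \<omega> assume w: "\<omega> \<in> (\<Inter>n\<in>modes K. g n -` U n \<inter> space P)"
      have wU: "g n \<omega> \<in> U n" "\<omega> \<in> space P" if "n \<in> modes K" for n using w that by blast+
      have "wick_mass K (Z \<omega>) - x0 = mass K (Z \<omega>) - t" by (simp add: wick_mass_def t_def)
      also have "mass K (Z \<omega>) = (cmod (g 0 \<omega>))\<^sup>2 + (\<Sum>n\<in>modes K - {0}. wt n * (cmod (g n \<omega>))\<^sup>2)"
        unfolding mass_def using fin m0 by (simp add: sum.remove[of _ 0] wt_def)
      finally have e: "wick_mass K (Z \<omega>) - x0 = ((cmod (g 0 \<omega>))\<^sup>2 - t) + (\<Sum>n\<in>modes K - {0}. wt n * (cmod (g n \<omega>))\<^sup>2)" by simp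
      have g0: "\<bar>(cmod (g 0 \<omega>))\<^sup>2 - t\<bar> < \<delta> / 2" using wU(1)[OF m0] by (simp add: U_def)
      have "(\<Sum>n\<in>modes K - {0}. wt n * (cmod (g n \<omega>))\<^sup>2) \<le> (\<Sum>n\<in>modes K - {0}. 1 * \<epsilon>)"
      proof (intro sum_mono mult_mono)
        fix n assume n: "n \<in> modes K - {0}"
        then have "g n \<omega> \<in> U n" using wU by simp
        then show "(cmod (g n \<omega>))\<^sup>2 \<le> \<epsilon>" using n by (simp add: U_def)
      qed auto
      also have "\<dots> \<le> (2 * real K + 1) * \<epsilon>"
      proof -
        have "card (modes K - {0}) \<le> card (modes K)" by (intro card_mono) auto
        also have "\<dots> = 2 * K + 1" by (simp add: modes_eq)
        finally have "real (card (modes K - {0})) \<le> 2 * real K + 1" by linarith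
        from mult_right_mono[OF this less_imp_le[OF \<epsilon>(1)]] show ?thesis by (simp only: sum_constant mult_1_left)
      qed
      finally have "(\<Sum>n\<in>modes K - {0}. wt n * (cmod (g n \<omega>))\<^sup>2) \<le> \<delta> / 2" using \<epsilon> by simp
      moreover have "0 \<le> (\<Sum>n\<in>modes K - {0}. wt n * (cmod (g n \<omega>))\<^sup>2)" by (intro sum_nonneg) auto
      moreover have "\<omega> \<in> space P" using wU(2)[OF m0] .
      moreover have "\<bar>wick_mass K (Z \<omega>) - x0\<bar> < \<delta>"
        using e g0 calculation by linarith
      ultimately show "\<omega> \<in> {\<omega> \<in> space P. \<bar>wick_mass K (Z \<omega>) - x0\<bar> < \<delta>}" by simp
    qed
  qed measurable
  finally show ?thesis .
qed

lemma wick_mass_indep: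
  assumes "K \<le> N"
  shows "indep_var borel (\<lambda>\<omega>. wick_mass K (Z \<omega>)) borel (\<lambda>\<omega>. wick_mass N (Z \<omega>) - wick_mass K (Z \<omega>))"
proof -
  let ?A = "modes K" and ?B = "modes N - modes K"
  have ind: "indep_var (PiM ?A (\<lambda>_. borel)) (\<lambda>\<omega>. restrict (\<lambda>i. g i \<omega>) ?A) (PiM ?B (\<lambda>_. borel)) (\<lambda>\<omega>. restrict (\<lambda>i. g i \<omega>) ?B)"
    by (rule indep_var_restrict[OF indep]) auto
  have m: "(\<lambda>f. cmod (f n)) \<in> borel_measurable (PiM I (\<lambda>_. borel))" if "n \<in> I" for n :: int and I
    using that by measurable
  have "(\<lambda>f. (\<Sum>n\<in>?A. wt n * (cmod (f n))\<^sup>2) - mean_mass K) \<in> borel_measurable (PiM ?A (\<lambda>_. borel))"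
    by (intro borel_measurable_diff borel_measurable_sum borel_measurable_times borel_measurable_power
        m borel_measurable_const)
  moreover have "(\<lambda>f. \<Sum>n\<in>?B. wt n * ((cmod (f n))\<^sup>2 - 1)) \<in> borel_measurable (PiM ?B (\<lambda>_. borel))"
    by (intro borel_measurable_diff borel_measurable_sum borel_measurable_times borel_measurable_power
        m borel_measurable_const)
  ultimately have "indep_var borel ((\<lambda>f. (\<Sum>n\<in>?A. wt n * (cmod (f n))\<^sup>2) - mean_mass K) \<circ> (\<lambda>\<omega>. restrict (\<lambda>i. g i \<omega>) ?A))
     borel ((\<lambda>f. \<Sum>n\<in>?B. wt n * ((cmod (f n))\<^sup>2 - 1)) \<circ> (\<lambda>\<omega>. restrict (\<lambda>i. g i \<omega>) ?B))"
    by (rule indep_var_compose[OF ind])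
  moreover have "(\<lambda>f. (\<Sum>n\<in>?A. wt n * (cmod (f n))\<^sup>2) - mean_mass K) \<circ> (\<lambda>\<omega>. restrict (\<lambda>i. g i \<omega>) ?A) = (\<lambda>\<omega>. wick_mass K (Z \<omega>))"
    by (auto simp: fun_eq_iff wick_mass_def mass_def)
  moreover have "(\<lambda>f. \<Sum>n\<in>?B. wt n * ((cmod (f n))\<^sup>2 - 1)) \<circ> (\<lambda>\<omega>. restrict (\<lambda>i. g i \<omega>) ?B) = (\<lambda>\<omega>. wick_mass N (Z \<omega>) - wick_mass K (Z \<omega>))"
    using wick_mass_diff[OF assms] by (auto simp: fun_eq_iff)
  ultimately show ?thesis by simp
qed

text \<open>Choose \<open>K\<close> so large that \<open>x0\<close> is within reach of the first modes and that the other modes contribute less than \<open>\<delta>\<close> with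
probability at least $1/2$, whatever \<open>N\<close> is. The two contributions are independent.\<close>

lemma wick_mass_near_prob:
  assumes \<delta>: "0 < \<delta>"
  obtains c K where "0 < c" "\<And>N. K \<le> N \<Longrightarrow> c \<le> prob {\<omega> \<in> space P. \<bar>wick_mass N (Z \<omega>) - x0\<bar> < 2 * \<delta>}"
proof -
  have "\<forall>\<^sub>F j in sequentially. vt_sum * decay (2 ^ j) < \<delta>\<^sup>2 / 2"
  proof (rule order_tendstoD(2))
    show "(\<lambda>j. vt_sum * decay (2 ^ j)) \<longlonglongrightarrow> vt_sum * 0"
      by (intro tendsto_intros filterlim_compose[OF decay_tendsto]) (auto intro!: filterlim_subseq simp: strict_mono_def)
  qed (use \<delta> in simp)
  moreover have "\<forall>\<^sub>F j in sequentially. nat \<lceil>- 2 * x0\<rceil> + 1 \<le> j" by (rule eventually_ge_at_top)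
  ultimately have "\<forall>\<^sub>F j in sequentially. vt_sum * decay (2 ^ j) < \<delta>\<^sup>2 / 2 \<and> nat \<lceil>- 2 * x0\<rceil> + 1 \<le> j" by (rule eventually_conj)
  then obtain j where j: "vt_sum * decay (2 ^ j) < \<delta>\<^sup>2 / 2" "nat \<lceil>- 2 * x0\<rceil> + 1 \<le> j"
    using eventually_happens'[OF sequentially_bot] by blast
  define K :: nat where "K = 2 ^ j"
  have "0 < x0 + mean_mass K"
  proof -
    have "- 2 * x0 < real j" "0 < real j" using j(2) by linarith+
    then have "- x0 < 2 / 3 * real j" by linarith
    then show ?thesis using mean_mass_ge[of j] by (simp add: K_def)
  qed
  from wick_mass_small_ball[OF this \<delta>] have p: "0 < prob {\<omega> \<in> space P. \<bar>wick_mass K (Z \<omega>) - x0\<bar> < \<delta>}" (is "0 < ?p") .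
  \<comment> \<open>the first modes and the remaining ones are independent, so the two probabilities multiply\<close>
  show ?thesis
  proof (rule that[of "?p * (1/2)" K])
    show "0 < ?p * (1/2)" using p by simp
    fix N assume KN: "K \<le> N"
    let ?D = "\<lambda>\<omega>. wick_mass N (Z \<omega>) - wick_mass K (Z \<omega>)"
    have "prob {\<omega> \<in> space P. \<delta> \<le> \<bar>?D \<omega>\<bar>} \<le> 1 / 2"
    proof -
      have "prob {\<omega> \<in> space P. \<delta> \<le> \<bar>?D \<omega>\<bar>} = expectation (indicator {\<omega> \<in> space P. \<delta> \<le> \<bar>?D \<omega>\<bar>})" by simp
      also have "\<dots> \<le> expectation (\<lambda>\<omega>. (1 / \<delta>\<^sup>2) * (?D \<omega>)\<^sup>2)"
      proof (rule integral_mono)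
        show "integrable P (indicator {\<omega> \<in> space P. \<delta> \<le> \<bar>?D \<omega>\<bar>} :: _ \<Rightarrow> real)" by (rule integrable_const_bound[of _ 1]) auto
        show "integrable P (\<lambda>\<omega>. (1 / \<delta>\<^sup>2) * (?D \<omega>)\<^sup>2)" by (intro integrable_mult_right wick_mass_diff_L2 KN)
        show "indicator {\<omega> \<in> space P. \<delta> \<le> \<bar>?D \<omega>\<bar>} \<omega> \<le> (1 / \<delta>\<^sup>2) * (?D \<omega>)\<^sup>2" for \<omega>
        proof (cases "\<delta> \<le> \<bar>?D \<omega>\<bar>")
          case True
          then have "\<delta>\<^sup>2 \<le> (?D \<omega>)\<^sup>2" using \<delta> abs_le_square_iff[of \<delta> "?D \<omega>"] by simp
          then show ?thesis using \<delta> by (auto simp: indicator_def)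
        qed simp
      qed
      also have "\<dots> \<le> 1 / \<delta>\<^sup>2 * (\<delta>\<^sup>2 / 2)"
        using wick_mass_diff_L2(2)[OF KN] j(1) by (simp only: integral_mult_right_zero, intro mult_left_mono) (auto simp: K_def)
      also have "\<dots> = 1 / 2" using \<delta> by simp
      finally show ?thesis .
    qed
    moreover have "prob {\<omega> \<in> space P. \<not> \<delta> \<le> \<bar>?D \<omega>\<bar>} = 1 - prob {\<omega> \<in> space P. \<delta> \<le> \<bar>?D \<omega>\<bar>}"
      by (rule prob_neg) measurable
    ultimately have half: "1 / 2 \<le> prob {\<omega> \<in> space P. \<bar>?D \<omega>\<bar> < \<delta>}" by (simp add: not_le)
    have "?p * (1/2) \<le> ?p * prob {\<omega> \<in> space P. \<bar>?D \<omega>\<bar> < \<delta>}" using half by (intro mult_left_mono) auto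
    also have "\<dots> = prob {\<omega> \<in> space P. \<bar>wick_mass K (Z \<omega>) - x0\<bar> < \<delta> \<and> \<bar>?D \<omega>\<bar> < \<delta>}"
      using prob_indep_random_variable[OF wick_mass_indep[OF KN], of "{x. \<bar>x - x0\<bar> < \<delta>}" "{x. \<bar>x\<bar> < \<delta>}"] by simp
    also have "\<dots> \<le> prob {\<omega> \<in> space P. \<bar>wick_mass N (Z \<omega>) - x0\<bar> < 2 * \<delta>}"
      by (intro finite_measure_mono) auto
    finally show "?p * (1/2) \<le> prob {\<omega> \<in> space P. \<bar>wick_mass N (Z \<omega>) - x0\<bar> < 2 * \<delta>}" .
  qed
qed

lemma energy_L1_bounded:
  obtains B where "\<And>N. expectation (\<lambda>\<omega>. \<bar>energy N (Z \<omega>)\<bar>) \<le> B"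
proof -
  obtain F where F: "integrable P F" "(\<lambda>N. expectation (\<lambda>\<omega>. \<bar>energy N (Z \<omega>) - F \<omega>\<bar>)) \<longlonglongrightarrow> 0"
    using energy_L1_limit .
  from convergent_imp_Bseq[OF convergentI[OF F(2)]] obtain B where
    B: "\<And>N. \<bar>expectation (\<lambda>\<omega>. \<bar>energy N (Z \<omega>) - F \<omega>\<bar>)\<bar> \<le> B" by (auto simp: Bseq_def)
  show ?thesis
  proof (rule that)
    fix N
    have "expectation (\<lambda>\<omega>. \<bar>energy N (Z \<omega>)\<bar>) \<le> expectation (\<lambda>\<omega>. \<bar>energy N (Z \<omega>) - F \<omega>\<bar> + \<bar>F \<omega>\<bar>)"
      using F(1) energy_integrable[of N] by (intro integral_mono) auto
    also have "\<dots> = expectation (\<lambda>\<omega>. \<bar>energy N (Z \<omega>) - F \<omega>\<bar>) + expectation (\<lambda>\<omega>. \<bar>F \<omega>\<bar>)"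
      using F(1) energy_integrable[of N] by (intro Bochner_Integration.integral_add) auto
    also have "\<dots> \<le> B + expectation (\<lambda>\<omega>. \<bar>F \<omega>\<bar>)" using B[of N] by simp
    finally show "expectation (\<lambda>\<omega>. \<bar>energy N (Z \<omega>)\<bar>) \<le> B + expectation (\<lambda>\<omega>. \<bar>F \<omega>\<bar>)" .
  qed
qed

definition weight :: "(real \<Rightarrow> real) \<Rightarrow> nat \<Rightarrow> 'a \<Rightarrow> real" where
  "weight \<kappa> N \<omega> = \<kappa> (wick_mass N (Z \<omega>)) * exp (- energy N (Z \<omega>))"

end

section \<open>Convergence of the normalised weights\<close>

text \<open>The bound \<open>R\<close> on the support of the cutoff keeps the renormalised mass below \<open>R\<close>, which is where
Nelson's estimate controls the weight.\<close>

locale cutoff_gaussians = complex_gaussians P g for P :: "'a measure" and g +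
  fixes \<kappa> :: "real \<Rightarrow> real" and R :: real
  assumes \<kappa>_cont: "continuous_on UNIV \<kappa>"
    and \<kappa>_nonneg: "\<And>x. 0 \<le> \<kappa> x" and \<kappa>_le_1: "\<And>x. \<kappa> x \<le> 1"
    and R_nonneg: "0 \<le> R" and \<kappa>_support: "\<And>x. R < x \<Longrightarrow> \<kappa> x = 0"
    and \<kappa>_nontrivial: "\<exists>x. \<kappa> x \<noteq> 0"
begin

lemma \<kappa>_measurable [measurable]: "\<kappa> \<in> borel_measurable borel"
  using \<kappa>_cont by (rule borel_measurable_continuous_onI)

lemma weight_measurable [measurable]: "weight \<kappa> N \<in> borel_measurable P"
  unfolding weight_def[abs_def] by measurable

lemma weight_nonneg: "0 \<le> weight \<kappa> N \<omega>"
  by (simp add: weight_def \<kappa>_nonneg)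

lemma weight_Lp:
  assumes q: "0 < q"
  obtains K where "\<And>N. integrable P (\<lambda>\<omega>. weight \<kappa> N \<omega> powr q)" "\<And>N. expectation (\<lambda>\<omega>. weight \<kappa> N \<omega> powr q) \<le> K"
proof -
  let ?f = "\<lambda>N \<omega>. if wick_mass N (Z \<omega>) \<le> R then exp (- q * energy N (Z \<omega>)) else 0"
  obtain K where K: "\<And>N. integrable P (?f N)" "\<And>N. expectation (?f N) \<le> K"
    using nelson[OF less_imp_le[OF q] R_nonneg] by blast
  have le: "weight \<kappa> N \<omega> powr q \<le> ?f N \<omega>" for N \<omega>
  proof (cases "wick_mass N (Z \<omega>) \<le> R")
    case True
    have "weight \<kappa> N \<omega> powr q \<le> (1 * exp (- energy N (Z \<omega>))) powr q"
      unfolding weight_def using q \<kappa>_nonneg \<kappa>_le_1 by (intro powr_mono2 mult_right_mono) auto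
    also have "\<dots> = exp (- q * energy N (Z \<omega>))" by (simp add: powr_def)
    finally show ?thesis using True by simp
  qed (simp add: weight_def \<kappa>_support)
  have i: "integrable P (\<lambda>\<omega>. weight \<kappa> N \<omega> powr q)" for N
    by (rule Bochner_Integration.integrable_bound[OF K(1)[of N]]) (use le[of N] in \<open>auto intro!: AE_I2\<close>)
  show ?thesis
    by (rule that[OF i order_trans[OF integral_mono[OF i K(1) le] K(2)]])
qed

lemma weight_limit:
  obtains Y where "converges_in_measure P (weight \<kappa>) Y"
proof -
  obtain A where A: "integrable P A" "(\<lambda>N. expectation (\<lambda>\<omega>. \<bar>wick_mass N (Z \<omega>) - A \<omega>\<bar>)) \<longlonglongrightarrow> 0"
    using wick_mass_L1_limit .
  obtain F where F: "integrable P F" "(\<lambda>N. expectation (\<lambda>\<omega>. \<bar>energy N (Z \<omega>) - F \<omega>\<bar>)) \<longlonglongrightarrow> 0"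
    using energy_L1_limit .
  have "continuous_on UNIV (\<lambda>(a, b). \<kappa> a * exp (- b))"
    unfolding split_def by (intro continuous_intros continuous_on_compose2[OF \<kappa>_cont]) auto
  from L1_limits_imp_converges_in_measure[OF wick_mass_integrable A energy_integrable F this]
  have "converges_in_measure P (weight \<kappa>) (\<lambda>\<omega>. \<kappa> (A \<omega>) * exp (- F \<omega>))"
    unfolding weight_def[abs_def] .
  then show ?thesis by (rule that)
qed

text \<open>With a probability bounded from below the cutoff is at least \<open>\<eta>\<close>. As the energies are bounded in $L^1$,
Markov's inequality keeps them below a fixed \<open>L\<close> except on half of that event.\<close>

lemma partition_function_ge:
  obtains c where "0 < c" "\<forall>\<^sub>F N in sequentially. c \<le> expectation (weight \<kappa> N)"
proof -
  obtain x0 where x0: "\<kappa> x0 > 0" using \<kappa>_nontrivial \<kappa>_nonneg by (metis less_eq_real_def)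
  define \<eta> where "\<eta> = \<kappa> x0 / 2"
  have \<eta>: "0 < \<eta>" "\<eta> < \<kappa> x0" using x0 by (auto simp: \<eta>_def)
  have "isCont \<kappa> x0" using \<kappa>_cont by (simp add: continuous_on_eq_continuous_at)
  then obtain d where d: "d > 0" "\<And>x. \<bar>x - x0\<bar> < d \<Longrightarrow> \<bar>\<kappa> x - \<kappa> x0\<bar> < \<kappa> x0 - \<eta>"
    using \<eta> unfolding continuous_at_real_range real_norm_def by (metis diff_gt_0_iff_gt)
  have "0 < d / 2" using d(1) by simp
  then obtain c K where c: "0 < c" and cK: "\<And>N. K \<le> N \<Longrightarrow> c \<le> prob {\<omega> \<in> space P. \<bar>wick_mass N (Z \<omega>) - x0\<bar> < 2 * (d / 2)}"
    using wick_mass_near_prob[of "d / 2" x0 thesis] by blast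
  obtain B where B: "\<And>N. expectation (\<lambda>\<omega>. \<bar>energy N (Z \<omega>)\<bar>) \<le> B" by (rule energy_L1_bounded) blast
  have "0 \<le> expectation (\<lambda>\<omega>. \<bar>energy 0 (Z \<omega>)\<bar>)" by (intro Bochner_Integration.integral_nonneg) simp
  then have B0: "0 \<le> B" using B[of 0] by linarith
  define L where "L = 2 * (B + 1) / c"
  have L: "0 < L" "B / L \<le> c / 2" using B0 c by (auto simp: L_def field_simps)
  have K1: "integrable P (\<lambda>\<omega>. weight \<kappa> N \<omega> powr 1)" for N by (rule weight_Lp[of 1]) auto
  have iw: "integrable P (weight \<kappa> N)" for N using K1[of N] by (simp add: weight_nonneg)
  show ?thesis
  proof (rule that[of "\<eta> * exp (- L) * (c / 2)"])
    show "0 < \<eta> * exp (- L) * (c / 2)" using \<eta> c by simp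
    show "\<forall>\<^sub>F N in sequentially. \<eta> * exp (- L) * (c / 2) \<le> expectation (weight \<kappa> N)"
      using eventually_ge_at_top[of K]
    proof eventually_elim
      case (elim N)
      let ?G = "{\<omega> \<in> space P. \<bar>wick_mass N (Z \<omega>) - x0\<bar> < d}" and ?H = "{\<omega> \<in> space P. L \<le> \<bar>energy N (Z \<omega>)\<bar>}"
      have G: "c \<le> prob ?G" using cK[OF elim] by simp
      have "prob ?H \<le> B / L"
      proof -
        have "prob ?H = expectation (indicator ?H)" by simp
        also have "\<dots> \<le> expectation (\<lambda>\<omega>. (1 / L) * \<bar>energy N (Z \<omega>)\<bar>)"
        proof (rule integral_mono)
          show "integrable P (indicator ?H :: _ \<Rightarrow> real)" by (rule integrable_const_bound[of _ 1]) auto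
          show "integrable P (\<lambda>\<omega>. (1 / L) * \<bar>energy N (Z \<omega>)\<bar>)" by (intro integrable_mult_right integrable_abs energy_integrable)
          show "indicator ?H \<omega> \<le> (1 / L) * \<bar>energy N (Z \<omega>)\<bar>" for \<omega> using L(1) by (auto simp: indicator_def)
        qed
        also have "\<dots> \<le> (1 / L) * B" using L(1) B[of N] by (simp only: integral_mult_right_zero, intro mult_left_mono) auto
        finally show ?thesis by simp
      qed
      then have H: "prob ?H \<le> c / 2" using L(2) by linarith
      have "prob ?G \<le> prob ((?G - ?H) \<union> ?H)" by (intro finite_measure_mono) auto
      also have "\<dots> \<le> prob (?G - ?H) + prob ?H" by (rule measure_Un_le) auto
      finally have GH: "c / 2 \<le> prob (?G - ?H)" using G H by linarith
      have "\<eta> * exp (- L) * (c / 2) \<le> \<eta> * exp (- L) * prob (?G - ?H)" using \<eta> GH by (intro mult_left_mono) auto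
      also have "\<dots> = expectation (\<lambda>\<omega>. \<eta> * exp (- L) * indicator (?G - ?H) \<omega>)" by simp
      also have "\<dots> \<le> expectation (weight \<kappa> N)"
      proof (rule integral_mono)
        show "integrable P (\<lambda>\<omega>. \<eta> * exp (- L) * indicator (?G - ?H) \<omega>)"
          by (intro integrable_mult_right integrable_const_bound[of _ 1]) auto
        show "\<eta> * exp (- L) * indicator (?G - ?H) \<omega> \<le> weight \<kappa> N \<omega>" for \<omega>
        proof (cases "\<omega> \<in> ?G - ?H")
          case True
          then have "\<bar>\<kappa> (wick_mass N (Z \<omega>)) - \<kappa> x0\<bar> < \<kappa> x0 - \<eta>" "energy N (Z \<omega>) \<le> L" using d(2) by auto
          then have "\<eta> \<le> \<kappa> (wick_mass N (Z \<omega>))" "exp (- L) \<le> exp (- energy N (Z \<omega>))" by auto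
          then have "\<eta> * exp (- L) \<le> \<kappa> (wick_mass N (Z \<omega>)) * exp (- energy N (Z \<omega>))"
            using \<kappa>_nonneg by (intro mult_mono) auto
          then show ?thesis using True by (simp add: weight_def)
        qed (simp add: weight_nonneg)
      qed (rule iw)
      finally show ?case .
    qed
  qed
qed

text \<open>The limit of the normalising constants exists because the integrals of the weights converge to a
positive number. Any limit in measure then inherits from the sequence the sign, by passing to an almost everywhere convergent subsequence,
and the total mass and the $L^p$ bounds, by Vitali's theorem.\<close>

lemma gibbs_density_converges:
  fixes \<beta> :: "nat \<Rightarrow> real" and T :: "nat \<Rightarrow> 'a \<Rightarrow> real"
  assumes T: "\<And>N \<omega>. T N \<omega> = \<beta> N * weight \<kappa> N \<omega>"
    and norm: "\<forall>\<^sub>F N in sequentially. \<beta> N > 0 \<and> prob_space (density P (\<lambda>\<omega>. ennreal (T N \<omega>)))"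
  shows "\<exists>\<Theta>. converges_in_measure P T \<Theta>"
    and "\<And>\<Theta>. converges_in_measure P T \<Theta> \<Longrightarrow>
       (AE \<omega> in P. 0 \<le> \<Theta> \<omega>) \<and> prob_space (density P (\<lambda>\<omega>. ennreal (\<Theta> \<omega>))) \<and>
       (\<forall>p\<ge>1. Lp_fun P p \<Theta> \<and> converges_in_Lp P p T \<Theta>)"
proof -
  have T_eq: "T N = (\<lambda>\<omega>. \<beta> N * weight \<kappa> N \<omega>)" for N by (simp add: fun_eq_iff T)
  have [measurable]: "T N \<in> borel_measurable P" for N unfolding T_eq by measurable
  have K1: "integrable P (\<lambda>\<omega>. weight \<kappa> N \<omega> powr 1)" for N by (rule weight_Lp[of 1]) auto
  have iw: "integrable P (weight \<kappa> N)" for N using K1[of N] by (simp add: weight_nonneg)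
  have iT: "integrable P (T N)" for N unfolding T_eq by (intro integrable_mult_right iw)
  have ET: "\<forall>\<^sub>F N in sequentially. \<beta> N > 0 \<and> expectation (T N) = 1"
    using norm
  proof eventually_elim
    case (elim N)
    have T0: "0 \<le> T N \<omega>" for \<omega> using elim by (simp add: T weight_nonneg)
    interpret D: prob_space "density P (\<lambda>\<omega>. ennreal (T N \<omega>))" using elim by simp
    have "1 = (\<integral>\<^sup>+\<omega>. ennreal (T N \<omega>) \<partial>P)"
      using D.emeasure_space_1 by (simp add: emeasure_density nn_integral_set_ennreal[symmetric] cong: nn_integral_cong_simp)
    also have "\<dots> = ennreal (expectation (T N))" using iT T0 by (intro nn_integral_eq_integral) auto
    finally show ?case using elim by (simp add: Bochner_Integration.integral_nonneg T0)
  qed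
  obtain Y where Y: "converges_in_measure P (weight \<kappa>) Y" using weight_limit .
  have wLp: "converges_in_Lp P p (weight \<kappa>) Y" if "p \<ge> 1" for p
  proof -
    have "0 < 2 * p" using that by simp
    then obtain K where "\<And>N. integrable P (\<lambda>\<omega>. weight \<kappa> N \<omega> powr (2 * p))" "\<And>N. expectation (\<lambda>\<omega>. weight \<kappa> N \<omega> powr (2 * p)) \<le> K"
      by (rule weight_Lp) blast
    then show ?thesis using weight_nonneg by (intro converges_in_measure_imp_Lp[OF Y that, of K]) auto
  qed
  have conv1: "(\<lambda>N. expectation (F N)) \<longlonglongrightarrow> expectation f" if "converges_in_Lp P 1 F f" for F :: "nat \<Rightarrow> 'a \<Rightarrow> real" and f
  proof -
    have i: "integrable P (F N)" "integrable P f" for N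
      using that by (auto simp: converges_in_Lp_def intro: Lp_fun_1_imp_integrable)
    have lim: "(\<lambda>N. expectation (\<lambda>\<omega>. \<bar>F N \<omega> - f \<omega>\<bar>)) \<longlonglongrightarrow> 0"
      using that by (simp add: converges_in_Lp_def Lp_norm_def Bochner_Integration.integral_nonneg)
    have le: "norm (expectation (F N) - expectation f) \<le> expectation (\<lambda>\<omega>. \<bar>F N \<omega> - f \<omega>\<bar>)" for N
      using i integral_norm_bound[of P "\<lambda>\<omega>. F N \<omega> - f \<omega>"] by simp
    have "(\<lambda>N. expectation (F N) - expectation f) \<longlonglongrightarrow> 0"
      by (rule Lim_null_comparison[OF always_eventually lim]) (rule allI, rule le)
    then show ?thesis by (rule LIM_zero_cancel)
  qed
  define m where "m = expectation Y"
  have Em: "(\<lambda>N. expectation (weight \<kappa> N)) \<longlonglongrightarrow> m"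
    unfolding m_def using wLp[of 1] by (intro conv1) simp
  obtain c where c: "0 < c" "\<forall>\<^sub>F N in sequentially. c \<le> expectation (weight \<kappa> N)" using partition_function_ge .
  have m: "0 < m" using tendsto_lowerbound[OF Em c(2)] c(1) by simp
  have \<beta>: "\<beta> \<longlonglongrightarrow> 1 / m"
  proof -
    have "\<forall>\<^sub>F N in sequentially. 1 / expectation (weight \<kappa> N) = \<beta> N"
      using ET
    proof eventually_elim
      case (elim N)
      then have "\<beta> N * expectation (weight \<kappa> N) = 1" by (simp add: T_eq)
      then show ?case by (metis nonzero_mult_div_cancel_right mult_zero_right zero_neq_one)
    qed
    moreover have "(\<lambda>N. 1 / expectation (weight \<kappa> N)) \<longlonglongrightarrow> 1 / m" using m by (intro tendsto_intros Em) auto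
    ultimately show ?thesis using tendsto_cong by fast
  qed
  from convergent_imp_Bseq[OF convergentI[OF \<beta>]] obtain b where b: "\<And>N. \<bar>\<beta> N\<bar> \<le> b" by (auto simp: Bseq_def)
  have Ym [measurable]: "Y \<in> borel_measurable P" using Y by (simp add: converges_in_measure_def)
  have "converges_in_measure P T (\<lambda>\<omega>. 1 / m * Y \<omega>)"
  proof (rule converges_in_measure_of_subsequences)
    fix r :: "nat \<Rightarrow> nat" assume r: "strict_mono r"
    have "converges_in_measure P (\<lambda>k. weight \<kappa> (r k)) Y"
      using Y LIMSEQ_subseq_LIMSEQ[OF _ r] unfolding converges_in_measure_def comp_def by fast
    then obtain s :: "nat \<Rightarrow> nat" where s: "strict_mono s" "AE \<omega> in P. (\<lambda>k. weight \<kappa> (r (s k)) \<omega>) \<longlonglongrightarrow> Y \<omega>"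
      using converges_in_measure_AE_subseq by blast
    have bs: "(\<lambda>k. \<beta> (r (s k))) \<longlonglongrightarrow> 1 / m"
      using LIMSEQ_subseq_LIMSEQ[OF \<beta> strict_mono_o[OF r s(1)]] by (simp add: comp_def)
    from s(2) have "AE \<omega> in P. (\<lambda>k. T (r (s k)) \<omega>) \<longlonglongrightarrow> 1 / m * Y \<omega>"
      unfolding T by eventually_elim (rule tendsto_mult[OF bs])
    with s(1) show "\<exists>s::nat \<Rightarrow> nat. strict_mono s \<and> (AE \<omega> in P. (\<lambda>k. T (r (s k)) \<omega>) \<longlonglongrightarrow> 1 / m * Y \<omega>)" by blast
  qed simp_all
  then show "\<exists>\<Theta>. converges_in_measure P T \<Theta>" by blast
  fix \<Theta> assume \<Theta>: "converges_in_measure P T \<Theta>"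
  have [measurable]: "\<Theta> \<in> borel_measurable P" using \<Theta> by (simp add: converges_in_measure_def)
  have Lp: "converges_in_Lp P p T \<Theta>" if p: "p \<ge> 1" for p
  proof -
    have "0 < 2 * p" using p by simp
    then obtain K where K: "\<And>N. integrable P (\<lambda>\<omega>. weight \<kappa> N \<omega> powr (2 * p))" "\<And>N. expectation (\<lambda>\<omega>. weight \<kappa> N \<omega> powr (2 * p)) \<le> K"
      by (rule weight_Lp) blast
    have e: "\<bar>T N \<omega>\<bar> powr (2 * p) = \<bar>\<beta> N\<bar> powr (2 * p) * weight \<kappa> N \<omega> powr (2 * p)" for N \<omega>
      by (simp add: T abs_mult powr_mult weight_nonneg)
    show ?thesis
    proof (rule converges_in_measure_imp_Lp[OF \<Theta> p])
      show "integrable P (\<lambda>\<omega>. \<bar>T N \<omega>\<bar> powr (2 * p))" for N unfolding e by (intro integrable_mult_right K)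
      fix N
      have "expectation (\<lambda>\<omega>. \<bar>T N \<omega>\<bar> powr (2 * p)) = \<bar>\<beta> N\<bar> powr (2 * p) * expectation (\<lambda>\<omega>. weight \<kappa> N \<omega> powr (2 * p))"
        unfolding e by simp
      also have "\<dots> \<le> b powr (2 * p) * K"
        using b[of N] p K(2)[of N] by (intro mult_mono powr_mono2) (auto intro!: Bochner_Integration.integral_nonneg)
      finally show "expectation (\<lambda>\<omega>. \<bar>T N \<omega>\<bar> powr (2 * p)) \<le> b powr (2 * p) * K" .
    qed
  qed
  have i\<Theta>: "integrable P \<Theta>"
    using Lp[of 1] by (auto simp: converges_in_Lp_def intro: Lp_fun_1_imp_integrable)
  have pos: "AE \<omega> in P. 0 \<le> \<Theta> \<omega>"
  proof -
    obtain r :: "nat \<Rightarrow> nat" where r: "strict_mono r" "AE \<omega> in P. (\<lambda>k. T (r k) \<omega>) \<longlonglongrightarrow> \<Theta> \<omega>"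
      using converges_in_measure_AE_subseq[OF \<Theta>] by blast
    have "\<forall>\<^sub>F N in sequentially. \<beta> N > 0" using ET by eventually_elim simp
    then have ev: "\<forall>\<^sub>F k in sequentially. \<beta> (r k) > 0" by (rule eventually_subseq[OF r(1)])
    from r(2) show ?thesis
    proof eventually_elim
      case (elim \<omega>)
      have "\<forall>\<^sub>F k in sequentially. 0 \<le> T (r k) \<omega>" using ev by eventually_elim (simp add: T weight_nonneg)
      from tendsto_lowerbound[OF elim this] show ?case by simp
    qed
  qed
  have "expectation \<Theta> = 1"
  proof (rule LIMSEQ_unique)
    show "(\<lambda>N. expectation (T N)) \<longlonglongrightarrow> expectation \<Theta>" using Lp[of 1] by (intro conv1) simp
    show "(\<lambda>N. expectation (T N)) \<longlonglongrightarrow> 1" using ET by (intro tendsto_eventually) (auto elim: eventually_mono)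
  qed
  then have "(\<integral>\<^sup>+\<omega>. ennreal (\<Theta> \<omega>) \<partial>P) = 1"
    using i\<Theta> pos by (subst nn_integral_eq_integral) auto
  then have "prob_space (density P (\<lambda>\<omega>. ennreal (\<Theta> \<omega>)))"
    by (intro prob_spaceI) (simp add: emeasure_density cong: nn_integral_cong_simp)
  then show "(AE \<omega> in P. 0 \<le> \<Theta> \<omega>) \<and> prob_space (density P (\<lambda>\<omega>. ennreal (\<Theta> \<omega>))) \<and>
       (\<forall>p\<ge>1. Lp_fun P p \<Theta> \<and> converges_in_Lp P p T \<Theta>)"
    using pos Lp by (auto simp: converges_in_Lp_def)
qed

end

section \<open>The space $X^0$ as a measurable space\<close>

definition sobolev_term :: "real \<Rightarrow> (int \<Rightarrow> complex) \<Rightarrow> int \<Rightarrow> real" where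
  "sobolev_term s u n = (1 + (real_of_int n)\<^sup>2) powr s * (cmod (u n))\<^sup>2"

lemma sobolev_term_nonneg [simp]: "0 \<le> sobolev_term s u n"
  by (simp add: sobolev_term_def)

lemma in_sobolev_iff: "in_sobolev s u \<longleftrightarrow> sobolev_term s u summable_on UNIV"
  by (simp add: in_sobolev_def sobolev_term_def[abs_def])

lemma sobolev_norm_eq: "sobolev_norm s u = sqrt (\<Sum>\<^sub>\<infinity>n. sobolev_term s u n)"
  by (simp add: sobolev_norm_def sobolev_term_def)

lemma sobolev_norm_sq: "(sobolev_norm s u)\<^sup>2 = (\<Sum>\<^sub>\<infinity>n. sobolev_term s u n)"
  by (simp add: sobolev_norm_eq infsum_nonneg)

lemma sobolev_norm_nonneg: "0 \<le> sobolev_norm s u"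
  by (simp add: sobolev_norm_eq infsum_nonneg)

lemma sum_sobolev_term_le_norm:
  assumes "in_sobolev s u" "finite F"
  shows "(\<Sum>n\<in>F. sobolev_term s u n) \<le> (sobolev_norm s u)\<^sup>2"
  unfolding sobolev_norm_sq using assms by (intro finite_sum_le_infsum) (auto simp: in_sobolev_iff)

lemma sobolev_norm_leI:
  assumes "0 \<le> C" "\<And>F. finite F \<Longrightarrow> (\<Sum>n\<in>F. sobolev_term s u n) \<le> C\<^sup>2"
  shows "in_sobolev s u" "sobolev_norm s u \<le> C"
proof -
  show i: "in_sobolev s u"
    unfolding in_sobolev_iff
    by (rule nonneg_bdd_above_summable_on) (auto intro!: bdd_aboveI[of _ "C\<^sup>2"] assms)
  have "(\<Sum>\<^sub>\<infinity>n. sobolev_term s u n) \<le> C\<^sup>2"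
    using i assms by (intro infsum_le_finite_sums) (auto simp: in_sobolev_iff)
  then show "sobolev_norm s u \<le> C"
    unfolding sobolev_norm_eq using assms(1) by (metis real_sqrt_le_iff real_sqrt_unique)
qed

lemma sobolev_norm_triangle:
  assumes "in_sobolev s u" "in_sobolev s v"
  shows "in_sobolev s (\<lambda>n. u n + v n)" "sobolev_norm s (\<lambda>n. u n + v n) \<le> sobolev_norm s u + sobolev_norm s v"
proof -
  define r where "r u n = sqrt ((1 + (real_of_int n)\<^sup>2) powr s) * cmod (u n)" for u :: "int \<Rightarrow> complex" and n
  have r: "(r u n)\<^sup>2 = sobolev_term s u n" "0 \<le> r u n" for u n
    by (auto simp: r_def sobolev_term_def power_mult_distrib)
  have b: "(\<Sum>n\<in>F. sobolev_term s (\<lambda>n. u n + v n) n) \<le> (sobolev_norm s u + sobolev_norm s v)\<^sup>2" if F: "finite F" for F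
  proof -
    have "sqrt (\<Sum>n\<in>F. sobolev_term s (\<lambda>n. u n + v n) n) = L2_set (r (\<lambda>n. u n + v n)) F"
      unfolding L2_set_def r ..
    also have "\<dots> \<le> L2_set (\<lambda>n. r u n + r v n) F"
    proof (rule L2_set_mono)
      fix n
      show "r (\<lambda>n. u n + v n) n \<le> r u n + r v n"
        unfolding r_def distrib_left[symmetric] by (intro mult_left_mono norm_triangle_ineq) auto
    qed (rule r)
    also have "\<dots> \<le> L2_set (r u) F + L2_set (r v) F" by (rule L2_set_triangle_ineq)
    also have "\<dots> \<le> sobolev_norm s u + sobolev_norm s v"
      unfolding L2_set_def r
      by (intro add_mono real_le_lsqrt sum_sobolev_term_le_norm assms F sum_nonneg sobolev_norm_nonneg)
    finally show ?thesis by (rule sqrt_le_D)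
  qed
  show "in_sobolev s (\<lambda>n. u n + v n)" "sobolev_norm s (\<lambda>n. u n + v n) \<le> sobolev_norm s u + sobolev_norm s v"
    by (rule sobolev_norm_leI[OF _ b]; simp add: sobolev_norm_nonneg)+
qed

lemma sobolev_term_uminus: "sobolev_term s (\<lambda>n. u n - v n) = sobolev_term s (\<lambda>n. v n - u n)"
  by (simp add: sobolev_term_def[abs_def] norm_minus_commute)

lemma sobolev_norm_minus: "sobolev_norm s (\<lambda>n. u n - v n) = sobolev_norm s (\<lambda>n. v n - u n)"
  by (simp only: sobolev_norm_eq sobolev_term_uminus[of s u v])

lemma in_sobolev_diff:
  assumes "in_sobolev s u" "in_sobolev s v"
  shows "in_sobolev s (\<lambda>n. u n - v n)"
proof -
  have "in_sobolev s (\<lambda>n. - v n)" using assms(2) by (simp add: in_sobolev_def)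
  from sobolev_norm_triangle(1)[OF assms(1) this] show ?thesis by simp
qed

lemma sobolev_term_mono: "s \<le> t \<Longrightarrow> sobolev_term s u n \<le> sobolev_term t u n"
  unfolding sobolev_term_def by (intro mult_right_mono powr_mono) auto

lemma sobolev_mono:
  assumes "s \<le> t" "in_sobolev t u"
  shows "in_sobolev s u" "sobolev_norm s u \<le> sobolev_norm t u"
proof -
  have "(\<Sum>n\<in>F. sobolev_term s u n) \<le> (sobolev_norm t u)\<^sup>2" if "finite F" for F
    by (rule order_trans[OF sum_mono[OF sobolev_term_mono[OF assms(1)]] sum_sobolev_term_le_norm[OF assms(2) that]])
  from sobolev_norm_leI[OF sobolev_norm_nonneg this]
  show "in_sobolev s u" "sobolev_norm s u \<le> sobolev_norm t u" by auto
qed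

lemma finite_subset_modes:
  assumes "finite F"
  obtains N where "F \<subseteq> modes N"
proof
  have "nat \<bar>n\<bar> \<le> (\<Sum>n\<in>F. nat \<bar>n\<bar>)" if "n \<in> F" for n
    using member_le_sum[of n F "\<lambda>n. nat \<bar>n\<bar>"] that assms by simp
  then show "F \<subseteq> modes (\<Sum>n\<in>F. nat \<bar>n\<bar>)" by (force simp: modes_def nat_le_iff)
qed

text \<open>Written with countably many finite sums, membership is a measurable condition on the coefficients.\<close>

lemma in_sobolev_iff_bounded:
  "in_sobolev s u \<longleftrightarrow> (\<exists>B::nat. \<forall>N. (\<Sum>n\<in>modes N. sobolev_term s u n) \<le> real B)"
proof
  assume u: "in_sobolev s u"
  obtain B :: nat where "(sobolev_norm s u)\<^sup>2 \<le> real B" using real_arch_simple by blast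
  then have "\<forall>N. (\<Sum>n\<in>modes N. sobolev_term s u n) \<le> real B"
    using sum_sobolev_term_le_norm[OF u finite_modes] by (meson order_trans)
  then show "\<exists>B::nat. \<forall>N. (\<Sum>n\<in>modes N. sobolev_term s u n) \<le> real B" by blast
next
  assume "\<exists>B::nat. \<forall>N. (\<Sum>n\<in>modes N. sobolev_term s u n) \<le> real B"
  then obtain B :: nat where B: "\<And>N. (\<Sum>n\<in>modes N. sobolev_term s u n) \<le> real B" by blast
  show "in_sobolev s u"
  proof (rule sobolev_norm_leI(1))
    fix F :: "int set" assume "finite F"
    then obtain N where "F \<subseteq> modes N" by (rule finite_subset_modes)
    then have "(\<Sum>n\<in>F. sobolev_term s u n) \<le> (\<Sum>n\<in>modes N. sobolev_term s u n)" by (intro sum_mono2) auto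
    also have "\<dots> \<le> (sqrt (real B))\<^sup>2" using B by simp
    finally show "(\<Sum>n\<in>F. sobolev_term s u n) \<le> (sqrt (real B))\<^sup>2" .
  qed simp
qed

lemma X0_iff: "u \<in> X0 \<longleftrightarrow> (\<forall>k::nat. in_sobolev (- (1 / real (Suc k))) u)"
proof
  assume u: "\<forall>k::nat. in_sobolev (- (1 / real (Suc k))) u"
  show "u \<in> X0" unfolding X0_def
  proof (intro CollectI allI impI)
    fix \<sigma> :: real assume "\<sigma> > 0"
    then obtain k where "1 / real (Suc k) < \<sigma>" using reals_Archimedean by (auto simp: inverse_eq_divide)
    then show "in_sobolev (- \<sigma>) u" using u by (intro sobolev_mono(1)[of "- \<sigma>" "- (1 / real (Suc k))"]) auto
  qed
qed (simp add: X0_def)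

definition X0_ball :: "(int \<Rightarrow> complex) \<Rightarrow> real \<Rightarrow> real \<Rightarrow> (int \<Rightarrow> complex) set" where
  "X0_ball u \<sigma> \<epsilon> = {v \<in> X0. sobolev_norm (- \<sigma>) (\<lambda>n. v n - u n) < \<epsilon>}"

lemma X0_topology_eq: "X0_topology = topology_generated_by {X0_ball u \<sigma> \<epsilon> | u \<sigma> \<epsilon>. u \<in> X0 \<and> \<sigma> > 0 \<and> \<epsilon> > 0}"
  by (simp add: X0_topology_def X0_ball_def)

lemma X0_D: "u \<in> X0 \<Longrightarrow> \<sigma> > 0 \<Longrightarrow> in_sobolev (- \<sigma>) u"
  by (simp add: X0_def)

lemma zero_in_X0: "(\<lambda>_. 0) \<in> X0"
  by (simp add: X0_def in_sobolev_def)

lemma sobolev_norm_zero [simp]: "sobolev_norm s (\<lambda>_. 0) = 0"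
  by (simp add: sobolev_norm_def)

lemma centre_in_X0_ball: "u \<in> X0 \<Longrightarrow> 0 < \<epsilon> \<Longrightarrow> u \<in> X0_ball u \<sigma> \<epsilon>"
  by (simp add: X0_ball_def)

lemma X0_dist_triangle:
  assumes "u \<in> X0" "v \<in> X0" "w \<in> X0" "0 < \<sigma>"
  shows "sobolev_norm (- \<sigma>) (\<lambda>n. u n - w n) \<le> sobolev_norm (- \<sigma>) (\<lambda>n. u n - v n) + sobolev_norm (- \<sigma>) (\<lambda>n. v n - w n)"
  using sobolev_norm_triangle(2)[OF in_sobolev_diff[OF X0_D[OF assms(1,4)] X0_D[OF assms(2,4)]]
      in_sobolev_diff[OF X0_D[OF assms(2,4)] X0_D[OF assms(3,4)]]] by simp

lemma openin_X0_ball: "u \<in> X0 \<Longrightarrow> 0 < \<sigma> \<Longrightarrow> 0 < \<epsilon> \<Longrightarrow> openin X0_topology (X0_ball u \<sigma> \<epsilon>)"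
  unfolding X0_topology_eq by (rule topology_generated_by_Basis) blast

lemma openin_X0_subset: "openin X0_topology U \<Longrightarrow> U \<subseteq> X0"
  using openin_subset[of X0_topology U] unfolding X0_topology_eq topology_generated_by_topspace
  by (auto simp: X0_ball_def)

text \<open>The norms increase with the exponent, so a single index \<open>k\<close> can serve for both the exponent and the
radius, and finitely many conditions reduce to the one with the largest index.\<close>

lemma openin_X0_contains_ball:
  assumes "openin X0_topology U" "u \<in> U"
  shows "\<exists>k::nat. X0_ball u (1 / real (Suc k)) (1 / real (Suc k)) \<subseteq> U"
proof -
  let ?B = "\<lambda>u k. X0_ball u (1 / real (Suc k)) (1 / real (Suc k))"
  have mono: "?B u k' \<subseteq> ?B u k" if "k \<le> k'" "u \<in> X0" for u and k k' :: nat
  proof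
    fix v assume v: "v \<in> ?B u k'"
    have le: "1 / real (Suc k') \<le> 1 / real (Suc k)" using that by (simp add: frac_le)
    have "in_sobolev (- (1 / real (Suc k'))) (\<lambda>n. v n - u n)"
      using v that(2) by (intro in_sobolev_diff X0_D) (auto simp: X0_ball_def)
    from sobolev_mono(2)[OF _ this, of "- (1 / real (Suc k))"] le v
    show "v \<in> ?B u k" by (auto simp: X0_ball_def)
  qed
  have "generate_topology_on {X0_ball u \<sigma> \<epsilon> | u \<sigma> \<epsilon>. u \<in> X0 \<and> \<sigma> > 0 \<and> \<epsilon> > 0} U"
    using assms(1) unfolding X0_topology_eq openin_topology_generated_by_iff .
  then have "\<forall>u\<in>U. u \<in> X0 \<longrightarrow> (\<exists>k. ?B u k \<subseteq> U)"
  proof (induction rule: generate_topology_on.induct)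
    case Empty
    show ?case by simp
  next
    case (Int a b)
    show ?case
    proof (intro ballI impI)
      fix u assume u: "u \<in> a \<inter> b" "u \<in> X0"
      obtain k where k: "?B u k \<subseteq> a" using Int.IH(1) u by blast
      obtain k' where k': "?B u k' \<subseteq> b" using Int.IH(2) u by blast
      have "?B u (max k k') \<subseteq> a" by (rule order_trans[OF mono[OF _ u(2)] k]) simp
      moreover have "?B u (max k k') \<subseteq> b" by (rule order_trans[OF mono[OF _ u(2)] k']) simp
      ultimately have "?B u (max k k') \<subseteq> a \<inter> b" by blast
      then show "\<exists>k. ?B u k \<subseteq> a \<inter> b" by blast
    qed
  next
    case (UN K)
    then show ?case by (meson Union_iff Union_upper subset_trans)
  next
    case (Basis s)
    then obtain w \<sigma> \<epsilon> where s: "s = X0_ball w \<sigma> \<epsilon>" "w \<in> X0" "0 < \<sigma>" "0 < \<epsilon>" by blast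
    show ?case
    proof (intro ballI impI)
      fix u assume u: "u \<in> s" "u \<in> X0"
      define \<delta> where "\<delta> = \<epsilon> - sobolev_norm (- \<sigma>) (\<lambda>n. u n - w n)"
      have "\<delta> > 0" using u s by (simp add: \<delta>_def X0_ball_def)
      then obtain k where k: "1 / real (Suc k) < min \<delta> \<sigma>"
        using reals_Archimedean[of "min \<delta> \<sigma>"] s(3) by (auto simp: inverse_eq_divide)
      have "?B u k \<subseteq> s"
      proof
        fix v assume v: "v \<in> ?B u k"
        then have vX: "v \<in> X0" by (simp add: X0_ball_def)
        have "sobolev_norm (- \<sigma>) (\<lambda>n. v n - u n) \<le> sobolev_norm (- (1 / real (Suc k))) (\<lambda>n. v n - u n)"
          using k by (intro sobolev_mono(2) in_sobolev_diff X0_D vX u(2)) auto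
        also have "\<dots> < \<delta>" using v k by (simp add: X0_ball_def)
        finally have "sobolev_norm (- \<sigma>) (\<lambda>n. v n - w n) < \<epsilon>"
          using X0_dist_triangle[OF vX u(2) s(2,3)] by (simp add: \<delta>_def)
        then show "v \<in> s" using vX s(1) by (simp add: X0_ball_def)
      qed
      then show "\<exists>k. ?B u k \<subseteq> s" by blast
    qed
  qed
  then show ?thesis using assms openin_X0_subset by blast
qed

lemma space_X0_borel [simp]: "space X0_borel = X0"
  unfolding X0_borel_def using openin_X0_subset by (intro space_measure_of) blast

lemma sets_X0_borel: "sets X0_borel = sigma_sets X0 {U. openin X0_topology U}"
  unfolding X0_borel_def using openin_X0_subset by (intro sets_measure_of) blast

text \<open>A coordinate is continuous: it is bounded by a constant times the $H^{-1}$ norm.\<close>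

lemma coordinate_measurable: "(\<lambda>u. u n) \<in> borel_measurable X0_borel"
proof (rule borel_measurableI)
  fix S :: "complex set" assume S: "open S"
  let ?V = "(\<lambda>u. u n) -` S \<inter> X0"
  have "openin X0_topology ?V"
  proof (subst openin_subopen, intro ballI)
    fix u assume u: "u \<in> ?V"
    then obtain e where e: "e > 0" "ball (u n) e \<subseteq> S" using S openE by blast
    define c where "c = (1 + (real_of_int n)\<^sup>2) powr (- 1)"
    have "0 < 1 + (real_of_int n)\<^sup>2" by (simp add: add_pos_nonneg)
    then have c: "0 < c" by (simp add: c_def)
    have "X0_ball u 1 (sqrt c * e) \<subseteq> ?V"
    proof
      fix v assume v: "v \<in> X0_ball u 1 (sqrt c * e)"
      then have vX: "v \<in> X0" by (simp add: X0_ball_def)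
      have "in_sobolev (- 1) (\<lambda>n. v n - u n)" using vX u by (intro in_sobolev_diff X0_D) auto
      from sum_sobolev_term_le_norm[OF this, of "{n}"]
      have "c * (cmod (v n - u n))\<^sup>2 \<le> (sobolev_norm (- 1) (\<lambda>n. v n - u n))\<^sup>2" by (simp add: sobolev_term_def c_def)
      also have "\<dots> < (sqrt c * e)\<^sup>2" using v by (intro power_strict_mono sobolev_norm_nonneg) (auto simp: X0_ball_def)
      also have "\<dots> = c * e\<^sup>2" using c by (simp add: power_mult_distrib)
      finally have "(cmod (v n - u n))\<^sup>2 < e\<^sup>2" using c by simp
      then have "cmod (v n - u n) < e" using e by (simp add: power_less_imp_less_base)
      then have "v n \<in> ball (u n) e" by (simp add: dist_norm norm_minus_commute)
      then show "v \<in> ?V" using e vX by auto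
    qed
    moreover have "openin X0_topology (X0_ball u 1 (sqrt c * e))" using u e c by (intro openin_X0_ball) auto
    moreover have "u \<in> X0_ball u 1 (sqrt c * e)" using u e c by (intro centre_in_X0_ball) auto
    ultimately show "\<exists>T. openin X0_topology T \<and> u \<in> T \<and> T \<subseteq> ?V" by blast
  qed
  then show "(\<lambda>u. u n) -` S \<inter> space X0_borel \<in> sets X0_borel"
    unfolding sets_X0_borel by (auto intro: sigma_sets.Basic)
qed

text \<open>The finitely supported sequences with values in a countable dense set are dense for every norm. Finite lists
of pairs encode them, which makes their countability evident.\<close>

lemma X0_dense:
  obtains D where "countable D" "D \<subseteq> X0"
    "\<And>u \<sigma> \<epsilon>. u \<in> X0 \<Longrightarrow> 0 < \<sigma> \<Longrightarrow> 0 < \<epsilon> \<Longrightarrow> \<exists>d\<in>D. sobolev_norm (- \<sigma>) (\<lambda>n. u n - d n) < \<epsilon>"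
proof -
  obtain Q :: "complex set" where Q: "countable Q" "\<And>X. open X \<Longrightarrow> X \<noteq> {} \<Longrightarrow> \<exists>d\<in>Q. d \<in> X"
    using countable_dense_setE by metis
  define dec where "dec xs n = (case map_of xs n of Some c \<Rightarrow> c | None \<Rightarrow> 0)" for xs :: "(int \<times> complex) list" and n
  define D where "D = dec ` lists (UNIV \<times> Q)"
  have "countable D" unfolding D_def using Q(1) by auto
  moreover have "D \<subseteq> X0"
  proof
    fix d assume "d \<in> D"
    then obtain xs where xs: "d = dec xs" by (auto simp: D_def)
    have "d n = 0" if "n \<notin> fst ` set xs" for n
      using that unfolding xs dec_def by (simp add: map_of_eq_None_iff[THEN iffD2])
    then have "sobolev_term s d n = 0" if "n \<notin> fst ` set xs" for n s using that by (simp add: sobolev_term_def)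
    then have "sobolev_term s d summable_on UNIV" for s
      using summable_on_cong_neutral[of UNIV "fst ` set xs" "sobolev_term s d" "sobolev_term s d"] by auto
    then show "d \<in> X0" by (simp add: X0_def in_sobolev_iff)
  qed
  moreover have "\<exists>d\<in>D. sobolev_norm (- \<sigma>) (\<lambda>n. u n - d n) < \<epsilon>" if u: "u \<in> X0" "0 < \<sigma>" "0 < \<epsilon>" for u \<sigma> \<epsilon>
  proof -
    let ?s = "- \<sigma>"
    have sm: "sobolev_term ?s u summable_on UNIV" using X0_D[OF u(1,2)] by (simp add: in_sobolev_iff)
    \<comment> \<open>one \<open>\<eta>\<close> for the modes in \<open>F\<close> and one for the tail; the sum stays below the square of \<open>\<epsilon>\<close>\<close>
    define \<eta> where "\<eta> = \<epsilon>\<^sup>2 / 4"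
    have \<eta>: "0 < \<eta>" using u by (simp add: \<eta>_def)
    have "(sum (sobolev_term ?s u) \<longlongrightarrow> infsum (sobolev_term ?s u) UNIV) (finite_subsets_at_top UNIV)"
      using has_sum_infsum[OF sm] by (simp add: has_sum_def)
    from order_tendstoD(1)[OF this, of "infsum (sobolev_term ?s u) UNIV - \<eta>"] \<eta>
    have "\<forall>\<^sub>F F in finite_subsets_at_top UNIV. infsum (sobolev_term ?s u) UNIV - \<eta> < sum (sobolev_term ?s u) F" by simp
    then obtain F where F: "finite F" "infsum (sobolev_term ?s u) UNIV - \<eta> < sum (sobolev_term ?s u) F"
      unfolding eventually_finite_subsets_at_top by blast
    define w where "w n = (1 + (real_of_int n)\<^sup>2) powr ?s" for n
    have w: "0 < w n" for n
    proof -
      have "0 < 1 + (real_of_int n)\<^sup>2" by (simp add: add_pos_nonneg)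
      then show ?thesis by (simp add: w_def)
    qed
    have "\<exists>c\<in>Q. w n * (cmod (u n - c))\<^sup>2 < \<eta> / (card F + 1)" for n
    proof -
      define r where "r = sqrt (\<eta> / (card F + 1) / w n)"
      have r: "0 < r" "w n * r\<^sup>2 = \<eta> / (card F + 1)" using \<eta> w[of n] by (auto simp: r_def)
      obtain c where c: "c \<in> Q" "c \<in> ball (u n) r" using Q(2)[of "ball (u n) r"] r by auto
      then have "cmod (u n - c) < r" by (simp add: dist_norm)
      then have "(cmod (u n - c))\<^sup>2 < r\<^sup>2" by (intro power_strict_mono) auto
      then have "w n * (cmod (u n - c))\<^sup>2 < w n * r\<^sup>2" using w by simp
      then show ?thesis using c r by auto
    qed
    then obtain c where c: "\<And>n. c n \<in> Q" "\<And>n. w n * (cmod (u n - c n))\<^sup>2 < \<eta> / (card F + 1)" by metis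
    define d where "d = dec (map (\<lambda>n. (n, c n)) (sorted_list_of_set F))"
    have d: "d n = (if n \<in> F then c n else 0)" for n
      unfolding d_def dec_def using F(1) by (simp add: map_of_map_restrict restrict_map_def)
    have "d \<in> D" unfolding D_def d_def using c by (intro imageI) auto
    moreover have "sobolev_norm ?s (\<lambda>n. u n - d n) \<le> sqrt (2 * \<eta>)"
    proof (rule sobolev_norm_leI(2))
      fix G :: "int set" assume G: "finite G"
      have "(\<Sum>n\<in>G. sobolev_term ?s (\<lambda>n. u n - d n) n) = (\<Sum>n\<in>G \<inter> F. sobolev_term ?s (\<lambda>n. u n - d n) n) + (\<Sum>n\<in>G - F. sobolev_term ?s (\<lambda>n. u n - d n) n)"
        using G by (subst sum.Int_Diff[of G _ F]) auto
      also have "(\<Sum>n\<in>G \<inter> F. sobolev_term ?s (\<lambda>n. u n - d n) n) \<le> (\<Sum>n\<in>G \<inter> F. \<eta> / (card F + 1))"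
        by (intro sum_mono) (use c(2) in \<open>auto simp: sobolev_term_def d w_def less_imp_le\<close>)
      also have "(\<Sum>n\<in>G \<inter> F. \<eta> / (card F + 1)) \<le> \<eta>"
      proof -
        have "card (G \<inter> F) \<le> card F" using F by (intro card_mono) auto
        then have "real (card (G \<inter> F)) \<le> real (card F + 1)" by linarith
        then have "real (card (G \<inter> F)) * (\<eta> / (card F + 1)) \<le> real (card F + 1) * (\<eta> / (card F + 1))"
          using \<eta> by (intro mult_right_mono) auto
        then show ?thesis by simp
      qed
      also have "(\<Sum>n\<in>G - F. sobolev_term ?s (\<lambda>n. u n - d n) n) = (\<Sum>n\<in>G - F. sobolev_term ?s u n)"
        by (intro sum.cong) (auto simp: sobolev_term_def d)
      also have "(\<Sum>n\<in>G - F. sobolev_term ?s u n) \<le> \<eta>"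
      proof -
        have "(\<Sum>n\<in>G - F. sobolev_term ?s u n) + (\<Sum>n\<in>F. sobolev_term ?s u n) = (\<Sum>n\<in>(G - F) \<union> F. sobolev_term ?s u n)"
          using G F by (subst sum.union_disjoint) auto
        also have "\<dots> \<le> infsum (sobolev_term ?s u) UNIV" using sm G F by (intro finite_sum_le_infsum) auto
        finally show ?thesis using F(2) by linarith
      qed
      finally show "(\<Sum>n\<in>G. sobolev_term ?s (\<lambda>n. u n - d n) n) \<le> (sqrt (2 * \<eta>))\<^sup>2" using \<eta> by simp
    qed (use \<eta> in simp)
    moreover have "sqrt (2 * \<eta>) < \<epsilon>"
      using u(3) by (intro real_less_lsqrt) (auto simp: \<eta>_def)
    ultimately show ?thesis by force
  qed
  ultimately show ?thesis by (rule that)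
qed

lemma infsum_measurable:
  fixes f :: "'w \<Rightarrow> int \<Rightarrow> real"
  assumes [measurable]: "\<And>n. (\<lambda>\<omega>. f \<omega> n) \<in> borel_measurable M" and s: "\<And>\<omega>. \<omega> \<in> space M \<Longrightarrow> f \<omega> summable_on UNIV"
  shows "(\<lambda>\<omega>. \<Sum>\<^sub>\<infinity>n. f \<omega> n) \<in> borel_measurable M"
proof (rule borel_measurable_LIMSEQ_real)
  have fl: "filterlim modes (finite_subsets_at_top UNIV) sequentially"
    unfolding filterlim_finite_subsets_at_top
  proof (intro allI impI)
    fix X :: "int set" assume "finite X \<and> X \<subseteq> UNIV"
    then have "finite X" by simp
    then obtain N0 where N0: "X \<subseteq> modes N0" by (rule finite_subset_modes)
    show "\<forall>\<^sub>F N in sequentially. finite (modes N) \<and> X \<subseteq> modes N \<and> modes N \<subseteq> UNIV"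
      using eventually_ge_at_top[of N0]
    proof eventually_elim
      case (elim N)
      then show ?case using N0 modes_mono[of N0 N] by auto
    qed
  qed
  show "(\<lambda>N. \<Sum>n\<in>modes N. f \<omega> n) \<longlonglongrightarrow> (\<Sum>\<^sub>\<infinity>n. f \<omega> n)" if "\<omega> \<in> space M" for \<omega>
    using filterlim_compose[OF _ fl] has_sum_infsum[OF s[OF that]] by (simp add: has_sum_def)
qed measurable

text \<open>Measurable coordinates suffice, because an open set is a countable union of balls with centres in the countable dense set,
and the distance to a centre is a countable sum of functions of the coordinates.\<close>

lemma measurable_X0_borelI:
  assumes \<Phi>: "\<And>\<omega>. \<omega> \<in> space M \<Longrightarrow> \<Phi> \<omega> \<in> X0"
    and [measurable]: "\<And>n. (\<lambda>\<omega>. \<Phi> \<omega> n) \<in> borel_measurable M"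
  shows "\<Phi> \<in> measurable M X0_borel"
  unfolding X0_borel_def
proof (rule measurable_measure_of)
  show "{U. openin X0_topology U} \<subseteq> Pow X0" using openin_X0_subset by blast
  show "\<Phi> \<in> space M \<rightarrow> X0" using \<Phi> by auto
  fix U assume "U \<in> {U. openin X0_topology U}"
  then have U: "openin X0_topology U" by simp
  obtain D where D: "countable D" "D \<subseteq> X0"
    "\<And>u \<sigma> \<epsilon>. u \<in> X0 \<Longrightarrow> 0 < \<sigma> \<Longrightarrow> 0 < \<epsilon> \<Longrightarrow> \<exists>d\<in>D. sobolev_norm (- \<sigma>) (\<lambda>n. u n - d n) < \<epsilon>"
    using X0_dense by blast
  \<comment> \<open>half the radius: a ball about \<open>u\<close> contains every such ball that reaches \<open>u\<close>\<close>
  let ?B = "\<lambda>(d, k). X0_ball d (1 / real (Suc k)) (1 / (2 * real (Suc k)))"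
  let ?J = "{p \<in> D \<times> UNIV. ?B p \<subseteq> U}"
  have "U = (\<Union>p\<in>?J. ?B p)"
  proof (intro equalityI subsetI)
    fix u assume u: "u \<in> U"
    then have uX: "u \<in> X0" using openin_X0_subset[OF U] by blast
    obtain k where k: "X0_ball u (1 / real (Suc k)) (1 / real (Suc k)) \<subseteq> U"
      using openin_X0_contains_ball[OF U u] by blast
    obtain d where d: "d \<in> D" "sobolev_norm (- (1 / real (Suc k))) (\<lambda>n. u n - d n) < 1 / (2 * real (Suc k))"
      using D(3)[OF uX, of "1 / real (Suc k)" "1 / (2 * real (Suc k))"] by auto
    have dX: "d \<in> X0" using d D by auto
    have "?B (d, k) \<subseteq> U"
    proof
      fix v assume v: "v \<in> ?B (d, k)"
      then have vX: "v \<in> X0" by (simp add: X0_ball_def)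
      have "sobolev_norm (- (1 / real (Suc k))) (\<lambda>n. v n - u n) \<le>
        sobolev_norm (- (1 / real (Suc k))) (\<lambda>n. v n - d n) + sobolev_norm (- (1 / real (Suc k))) (\<lambda>n. d n - u n)"
        by (rule X0_dist_triangle[OF vX dX uX]) simp
      also have "\<dots> < 1 / (2 * real (Suc k)) + 1 / (2 * real (Suc k))"
        using v d(2) sobolev_norm_minus[of _ d u] by (intro add_strict_mono) (auto simp: X0_ball_def)
      also have "\<dots> = 1 / real (Suc k)" by (simp add: field_simps)
      finally show "v \<in> U" using k vX by (auto simp: X0_ball_def)
    qed
    moreover have "u \<in> ?B (d, k)" using uX d by (simp add: X0_ball_def)
    ultimately show "u \<in> (\<Union>p\<in>?J. ?B p)" using d(1) by blast
  qed blast
  then have e: "\<Phi> -` U \<inter> space M = (\<Union>p\<in>?J. \<Phi> -` ?B p \<inter> space M)" by blast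
  show "\<Phi> -` U \<inter> space M \<in> sets M"
    unfolding e
  proof (rule sets.countable_UN'')
    show "countable ?J" using D(1) by (intro countable_subset[of ?J "D \<times> UNIV"]) auto
    fix p assume "p \<in> ?J"
    then obtain d k where p: "p = (d, k)" "d \<in> X0" using D by auto
    let ?s = "- (1 / real (Suc k))"
    have [measurable]: "(\<lambda>\<omega>. \<Sum>\<^sub>\<infinity>n. sobolev_term ?s (\<lambda>n. \<Phi> \<omega> n - d n) n) \<in> borel_measurable M"
    proof (rule infsum_measurable)
      show "(\<lambda>\<omega>. sobolev_term ?s (\<lambda>n. \<Phi> \<omega> n - d n) n) \<in> borel_measurable M" for n
        unfolding sobolev_term_def by measurable
      show "sobolev_term ?s (\<lambda>n. \<Phi> \<omega> n - d n) summable_on UNIV" if "\<omega> \<in> space M" for \<omega>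
        unfolding in_sobolev_iff[symmetric] using \<Phi>[OF that] p by (intro in_sobolev_diff X0_D) auto
    qed
    have [measurable]: "(\<lambda>\<omega>. sobolev_norm ?s (\<lambda>n. \<Phi> \<omega> n - d n)) \<in> borel_measurable M"
      unfolding sobolev_norm_eq by measurable
    have "\<Phi> -` ?B p \<inter> space M = {\<omega> \<in> space M. sobolev_norm ?s (\<lambda>n. \<Phi> \<omega> n - d n) < 1 / (2 * real (Suc k))}"
      using \<Phi> by (auto simp: p X0_ball_def)
    then show "\<Phi> -` ?B p \<inter> space M \<in> sets M" by (simp only:) measurable
  qed
qed


section \<open>The Gaussian measure on $X^0$\<close>

lemma sobolev_weight_le:
  assumes "0 < \<sigma>"
  shows "(1 + (real_of_int n)\<^sup>2) powr (- \<sigma>) * wt n \<le> 2 powr \<sigma> * wt n powr (1 + 2 * \<sigma>)"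
proof -
  let ?x = "1 + \<bar>real_of_int n\<bar>"
  have x: "0 < ?x" by simp
  have "?x\<^sup>2 / 2 \<le> 1 + (real_of_int n)\<^sup>2"
  proof -
    have "0 \<le> (1 - \<bar>real_of_int n\<bar>)\<^sup>2" by simp
    then show ?thesis by (simp add: power2_eq_square algebra_simps)
  qed
  then have "(1 + (real_of_int n)\<^sup>2) powr (- \<sigma>) \<le> (?x\<^sup>2 / 2) powr (- \<sigma>)"
    using assms x by (intro powr_mono2') auto
  also have "\<dots> = 2 powr \<sigma> * wt n powr (2 * \<sigma>)"
  proof -
    have "?x\<^sup>2 / 2 = (2 * (wt n)\<^sup>2) powr (- 1)" using x by (simp add: wt_def powr_minus field_simps)
    then have "(?x\<^sup>2 / 2) powr (- \<sigma>) = (2 * (wt n)\<^sup>2) powr \<sigma>" by (simp only: powr_powr) simp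
    also have "\<dots> = 2 powr \<sigma> * ((wt n) powr 2) powr \<sigma>" by (simp add: powr_mult)
    finally show ?thesis by (simp only: powr_powr)
  qed
  finally have "(1 + (real_of_int n)\<^sup>2) powr (- \<sigma>) * wt n \<le> 2 powr \<sigma> * wt n powr (2 * \<sigma>) * wt n"
    by (intro mult_right_mono) auto
  also have "\<dots> = 2 powr \<sigma> * wt n powr (1 + 2 * \<sigma>)" by (simp add: powr_add)
  finally show ?thesis .
qed

text \<open>The expected square of the $H^{-\sigma}$ norm is $\sum (1 + n^2)^{-\sigma} / (1 + |n|)$, a convergent series
with exponent $1 + 2 \sigma$.\<close>

lemma (in complex_gaussians) AE_in_X0: "AE \<omega> in P. (\<lambda>n. complex_of_real (sqrt (wt n)) * g n \<omega>) \<in> X0"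
proof -
  let ?u = "\<lambda>\<omega> n. complex_of_real (sqrt (wt n)) * g n \<omega>"
  have one: "AE \<omega> in P. in_sobolev (- \<sigma>) (?u \<omega>)" if \<sigma>: "0 < \<sigma>" for \<sigma>
  proof -
    define C where "C = 2 powr \<sigma> * (2 * (\<Sum>n. real (Suc n) powr (- (1 + 2 * \<sigma>))))"
    let ?f = "\<lambda>N \<omega>. \<Sum>n\<in>modes N. sobolev_term (- \<sigma>) (?u \<omega>) n"
    have [measurable]: "?f N \<in> borel_measurable P" for N unfolding sobolev_term_def by measurable
    have s: "sobolev_term (- \<sigma>) (?u \<omega>) n = (1 + (real_of_int n)\<^sup>2) powr (- \<sigma>) * wt n * (cmod (g n \<omega>))\<^sup>2 ^ 1" for n \<omega>
      by (simp add: sobolev_term_def norm_mult power_mult_distrib)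
    have i: "integrable P (\<lambda>\<omega>. sobolev_term (- \<sigma>) (?u \<omega>) n)" for n
      unfolding s by (intro integrable_mult_right g_norm_moment)
    have "(\<integral>\<^sup>+\<omega>. ennreal (?f N \<omega>) \<partial>P) \<le> ennreal C" for N
    proof -
      have "(\<integral>\<^sup>+\<omega>. ennreal (?f N \<omega>) \<partial>P) = ennreal (expectation (?f N))"
        by (intro nn_integral_eq_integral Bochner_Integration.integrable_sum i) (auto intro!: sum_nonneg)
      also have "expectation (?f N) = (\<Sum>n\<in>modes N. (1 + (real_of_int n)\<^sup>2) powr (- \<sigma>) * wt n)"
        by (subst Bochner_Integration.integral_sum, rule i) (simp only: s integral_mult_right_zero g_norm_moment fact_1 mult_1_right)
      also have "\<dots> \<le> (\<Sum>n\<in>modes N. 2 powr \<sigma> * wt n powr (1 + 2 * \<sigma>))"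
        by (intro sum_mono sobolev_weight_le \<sigma>)
      also have "\<dots> \<le> C"
        unfolding C_def sum_distrib_left[symmetric] using \<sigma> by (intro mult_left_mono sum_wt_powr_le) auto
      finally show ?thesis by (simp add: ennreal_leI)
    qed
    moreover have "(\<integral>\<^sup>+\<omega>. (SUP N. ennreal (?f N \<omega>)) \<partial>P) = (SUP N. \<integral>\<^sup>+\<omega>. ennreal (?f N \<omega>) \<partial>P)"
    proof (rule nn_integral_monotone_convergence_SUP)
      show "incseq (\<lambda>N \<omega>. ennreal (?f N \<omega>))"
        by (auto simp: incseq_def le_fun_def intro!: ennreal_leI sum_mono2 modes_mono)
    qed measurable
    ultimately have "(\<integral>\<^sup>+\<omega>. (SUP N. ennreal (?f N \<omega>)) \<partial>P) \<le> ennreal C" by (simp add: SUP_least)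
    then have "(\<integral>\<^sup>+\<omega>. (SUP N. ennreal (?f N \<omega>)) \<partial>P) \<noteq> \<infinity>" by (auto simp: top_unique)
    then have "AE \<omega> in P. (SUP N. ennreal (?f N \<omega>)) \<noteq> \<infinity>" by (intro nn_integral_noteq_infinite) auto
    then show ?thesis
    proof eventually_elim
      case (elim \<omega>)
      then obtain B where B: "0 \<le> B" "(SUP N. ennreal (?f N \<omega>)) = ennreal B" by (cases "SUP N. ennreal (?f N \<omega>)") auto
      have fB: "?f N \<omega> \<le> B" for N
      proof -
        have "ennreal (?f N \<omega>) \<le> ennreal B" unfolding B(2)[symmetric] by (rule SUP_upper) simp
        then show ?thesis using B(1) by simp
      qed
      obtain B' :: nat where "B \<le> real B'" using real_arch_simple by blast
      then show ?case unfolding in_sobolev_iff_bounded using fB by (meson order_trans)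
    qed
  qed
  then have "AE \<omega> in P. \<forall>k. in_sobolev (- (1 / real (Suc k))) (?u \<omega>)" by (subst AE_all_countable) simp
  then show ?thesis unfolding X0_iff .
qed

text \<open>The coordinates of $X^0$ rescaled so that they become normalised Gaussians under the measure.\<close>

definition normal_coord :: "int \<Rightarrow> (int \<Rightarrow> complex) \<Rightarrow> complex" where
  "normal_coord n u = u n / complex_of_real (sqrt (wt n))"

lemma normal_coord_scale: "u n = complex_of_real (sqrt (wt n)) * normal_coord n u"
  by (simp add: normal_coord_def)

lemma gaussian_law_complex_gaussians:
  fixes h l :: "int \<Rightarrow> 'w \<Rightarrow> real"
  assumes "complex_gaussians M (\<lambda>n \<omega>. Complex (h n \<omega>) (l n \<omega>) / complex_of_real (sqrt 2))"
  shows "complex_gaussians (gaussian_law M h l) normal_coord"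
proof -
  let ?g = "\<lambda>n \<omega>. Complex (h n \<omega>) (l n \<omega>) / complex_of_real (sqrt 2)"
  interpret complex_gaussians M ?g by fact
  let ?\<mu> = "gaussian_law M h l"
  define \<Phi> where "\<Phi> \<omega> = (if random_series h l \<omega> \<in> X0 then random_series h l \<omega> else (\<lambda>_. 0))" for \<omega>
  have rs: "random_series h l \<omega> = (\<lambda>n. complex_of_real (sqrt (wt n)) * ?g n \<omega>)" for \<omega>
    by (simp add: random_series_def wt_def fun_eq_iff real_sqrt_divide)
  have ae: "AE \<omega> in M. random_series h l \<omega> \<in> X0" unfolding rs by (rule AE_in_X0)
  have \<Phi>X: "\<Phi> \<omega> \<in> X0" for \<omega> by (simp add: \<Phi>_def zero_in_X0)
  have rsm [measurable]: "(\<lambda>\<omega>. random_series h l \<omega> n) \<in> borel_measurable M" for n unfolding rs by measurable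
  have [measurable]: "Measurable.pred M (\<lambda>\<omega>. random_series h l \<omega> \<in> X0)"
    unfolding X0_iff in_sobolev_iff_bounded sobolev_term_def by measurable
  have \<Phi>n: "(\<lambda>\<omega>. \<Phi> \<omega> n) \<in> borel_measurable M" for n
    unfolding \<Phi>_def if_distribR by measurable
  have \<Phi> [measurable]: "\<Phi> \<in> measurable M X0_borel" by (rule measurable_X0_borelI[OF \<Phi>X \<Phi>n])
  have \<mu>: "?\<mu> = distr M X0_borel \<Phi>" by (simp add: gaussian_law_def \<Phi>_def[abs_def])
  have nc [measurable]: "normal_coord n \<in> borel_measurable X0_borel" for n
    unfolding normal_coord_def[abs_def] using coordinate_measurable by measurable
  have ncm [measurable]: "normal_coord n \<in> borel_measurable ?\<mu>" for n unfolding \<mu> by simp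
  \<comment> \<open>the exceptional event on which the series is replaced by zero is null\<close>
  have nc_ae: "AE \<omega> in M. \<forall>n. normal_coord n (\<Phi> \<omega>) = ?g n \<omega>"
    using ae by eventually_elim (simp add: \<Phi>_def normal_coord_def rs)
  have ps: "prob_space ?\<mu>" unfolding \<mu> by (rule prob_space_distr) measurable
  have law': "distr ?\<mu> borel (normal_coord n) = std_cgauss" for n
  proof -
    have "distr ?\<mu> borel (normal_coord n) = distr M borel (\<lambda>\<omega>. normal_coord n (\<Phi> \<omega>))"
      unfolding \<mu> by (subst distr_distr) (auto simp: comp_def)
    also have "\<dots> = distr M borel (?g n)"
      by (rule distr_cong_AE) (use nc_ae in \<open>auto intro: g_measurable\<close>)
    finally show ?thesis unfolding law .
  qed
  interpret \<mu>: prob_space ?\<mu> by (rule ps)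
  show ?thesis
  proof
    show "distr ?\<mu> borel (normal_coord n) = std_cgauss" for n by (rule law')
    have "distr ?\<mu> (PiM UNIV (\<lambda>_. borel)) (\<lambda>u. \<lambda>n\<in>UNIV. normal_coord n u) = distr M (PiM UNIV (\<lambda>_. borel)) (\<lambda>\<omega>. \<lambda>n\<in>UNIV. normal_coord n (\<Phi> \<omega>))"
      unfolding \<mu> by (subst distr_distr) (auto simp: comp_def intro!: measurable_restrict)
    also have "\<dots> = distr M (PiM UNIV (\<lambda>_. borel)) (\<lambda>\<omega>. \<lambda>n\<in>UNIV. ?g n \<omega>)"
      by (rule distr_cong_AE) (use nc_ae in \<open>auto intro!: measurable_restrict g_measurable measurable_compose[OF \<Phi> nc]\<close>)
    also have "\<dots> = PiM UNIV (\<lambda>n. distr M borel (?g n))"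
      by (rule indep_vars_iff_distr_eq_PiM[THEN iffD1, OF _ g_measurable indep]) simp
    also have "\<dots> = PiM UNIV (\<lambda>n. distr ?\<mu> borel (normal_coord n))" unfolding law law' ..
    finally show "\<mu>.indep_vars (\<lambda>_. borel) normal_coord UNIV"
      by (intro \<mu>.indep_vars_iff_distr_eq_PiM[THEN iffD2]) (auto intro: ncm)
  qed
qed

section \<open>Convergence of the densities $\Theta_N$\<close>

theorem theorem1p6:
  fixes M :: "'w measure"
    and h l :: "int \<Rightarrow> 'w \<Rightarrow> real"
    and \<mu> :: "(int \<Rightarrow> complex) measure"
    and cutoff :: "real \<Rightarrow> real"
    and \<beta> :: "nat \<Rightarrow> real"
  assumes "prob_space M"
    and "prob_space.indep_vars M (\<lambda>_. borel) (case_sum h l) UNIV"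
    and "\<And>n. distributed M lborel (h n) std_normal_density"
    and "\<And>n. distributed M lborel (l n) std_normal_density"
    and "\<mu> = gaussian_law M h l"
    and "smooth_compact_support cutoff"
    and "\<And>x. 0 \<le> cutoff x" and "\<And>x. cutoff x \<le> 1"
    and "\<exists>x. cutoff x \<noteq> 0"
    and "normalising \<mu> cutoff \<beta>"
  shows "(\<exists>\<Theta>. converges_in_measure \<mu> (Theta_N \<mu> cutoff \<beta>) \<Theta>) \<and>
    (\<forall>\<Theta>. converges_in_measure \<mu> (Theta_N \<mu> cutoff \<beta>) \<Theta> \<longrightarrow>
       (AE u in \<mu>. 0 \<le> \<Theta> u) \<and>
       prob_space (density \<mu> (\<lambda>u. ennreal (\<Theta> u))) \<and>
       (\<forall>p\<ge>1. Lp_fun \<mu> p \<Theta> \<and> converges_in_Lp \<mu> p (Theta_N \<mu> cutoff \<beta>) \<Theta>))"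
proof -
  interpret complex_gaussians \<mu> normal_coord
    unfolding assms(5)
    by (rule gaussian_law_complex_gaussians[OF complex_gaussians_of_real_gaussians[OF assms(1-4)]])
  have cont: "continuous_on UNIV cutoff"
  proof -
    have "(deriv ^^ 0) cutoff differentiable_on UNIV"
      using assms(6) unfolding smooth_compact_support_def by blast
    then show ?thesis by (intro differentiable_imp_continuous_on) simp
  qed
  obtain R where R: "0 < R" "\<And>x. cutoff x \<noteq> 0 \<Longrightarrow> \<bar>x\<bar> \<le> R"
  proof -
    have "bounded (closure {x. cutoff x \<noteq> 0})"
      using assms(6) by (simp add: smooth_compact_support_def compact_imp_bounded)
    then obtain R where "0 < R" "\<forall>x\<in>closure {x. cutoff x \<noteq> 0}. norm x \<le> R"
      unfolding bounded_pos by blast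
    then show ?thesis using closure_subset[of "{x. cutoff x \<noteq> 0}"] by (intro that[of R]) auto
  qed
  interpret cutoff_gaussians \<mu> normal_coord cutoff R
  proof
    show "continuous_on UNIV cutoff" by (rule cont)
    show "cutoff x = 0" if "R < x" for x
    proof (rule ccontr)
      assume "cutoff x \<noteq> 0"
      from R(2)[OF this] that show False by linarith
    qed
  qed (use assms R(1) in auto)
  have norm2: "(Lp_norm circle_measure 2 (fourier_proj N u))\<^sup>2 = mass N (\<lambda>n. normal_coord n u)" for N u
    by (rule mass_eq_norm[OF normal_coord_scale])
  have norm4: "Lp_norm circle_measure 4 (fourier_proj N u) ^ 4 - 2 * Lp_norm circle_measure 2 (fourier_proj N u) ^ 4
      = energy N (\<lambda>n. normal_coord n u)" for N u
    by (rule energy_eq_norms[OF normal_coord_scale])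
  have alpha: "alpha \<mu> N = mean_mass N" for N
    unfolding alpha_def norm2 by (rule expectation_mass)
  have T: "Theta_N \<mu> cutoff \<beta> N u = \<beta> N * weight cutoff N u" for N u
    unfolding Theta_N_def weight_def norm2 norm4 alpha wick_mass_def by simp
  have nrm: "\<forall>\<^sub>F N in sequentially. \<beta> N > 0 \<and> prob_space (density \<mu> (\<lambda>u. ennreal (Theta_N \<mu> cutoff \<beta> N u)))"
    using assms(10) unfolding normalising_def .
  show ?thesis
    using gibbs_density_converges[of "Theta_N \<mu> cutoff \<beta>" \<beta>, OF T nrm] by blast
qed

end
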